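(* Let $k$ be a positive integer, let $\boldsymbol\phi(z_1,z_2)=(z_1^k+z_2^k,\,z_1z_2)$ and let $\mathcal D_{2k}=\boldsymbol\phi(\mathbb D^2)$. The Bergman kernel of $\mathcal D_{2k}$ is given, for $(z_1,z_2),(w_1,w_2)\in\mathbb D^2$, by $$\mathcal B_{\mathcal D_{2k}}\big(\boldsymbol\phi(z_1,z_2),\boldsymbol\phi(w_1,w_2)\big)=\frac{z_1-z_2}{k^2(z_1^k-z_2^k)(\overline{w_1}^k-\overline{w_2}^k)}\sum_{i=1}^k\frac{\big(2(1+z_1z_2\overline{w_1}\,\overline{w_2})-(z_1+z_2)(\omega_k^i\overline{w_1}+\omega_k^{k-i}\overline{w_2})\big)(\omega_k^i\overline{w_1}-\omega_k^{k-i}\overline{w_2})}{\big(X_1X_2-(\omega_k^i\overline{w_1}+\omega_k^{k-i}\overline{w_2})(z_2X_1+z_1X_2)+z_1z_2(\omega_k^i\overline{w_1}+\omega_k^{k-i}\overline{w_2})^2\big)^2},$$ where $\omega_k$ is a primitive $k$-th root of unity and $X_\ell=1+z_\ell^2\,\overline{w_1}\,\overline{w_2}$ for $\ell=1,2$.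
   Context: $\mathbb D^2$ is the open unit bidisc. $\mathcal D_{2k}$ is a domain; it is the quotient of $\mathbb D^2$ by the dihedral group of order $2k$ acting on $\mathbb C^2$, generated by $\mathrm{diag}(\omega_k,\omega_k^{-1})$ and the coordinate swap, for which $\boldsymbol\phi$ is a basic polynomial map (its components generate the ring of invariant polynomials). The Bergman kernel of $\mathcal D_{2k}$ is the reproducing kernel of the space of holomorphic functions on $\mathcal D_{2k}$ square integrable with respect to $dV$, where $dV$ is the multiple of Lebesgue measure on $\mathbb C^2$ with $V(\mathbb D^2)=1$. At points where $z_1^k=z_2^k$ or $w_1^k=w_2^k$ the right-hand side is understood as its extension, holomorphic in $\boldsymbol z$ and antiholomorphic in $\boldsymbol w$. *)

theory Defs
  imports "HOL-Analysis.Analysis"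
begin

definition bidisc :: "(complex \<times> complex) set" where
  "bidisc = ball 0 1 \<times> ball 0 1"

(* The Frechet derivative is required to be complex linear; a and b are the two
   complex partial derivatives. *)
definition holomorphic2_on :: "(complex \<times> complex \<Rightarrow> complex) \<Rightarrow> (complex \<times> complex) set \<Rightarrow> bool" where
  "holomorphic2_on f U \<longleftrightarrow>
     (\<forall>p\<in>U. \<exists>a b. (f has_derivative (\<lambda>h. a * fst h + b * snd h)) (at p within U))"

(* Lebesgue measure on complex pairs, rescaled so that the bidisc has measure 1. *)
definition V :: "(complex \<times> complex) measure" where
  "V = scale_measure (1 / emeasure lborel bidisc) lborel"

definition bergman_space :: "(complex \<times> complex) set \<Rightarrow> (complex \<times> complex \<Rightarrow> complex) set" where
  "bergman_space U =
     {f. holomorphic2_on f U \<and> set_integrable V U (\<lambda>p. (cmod (f p))\<^sup>2)}"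

definition bergman_inner ::
    "(complex \<times> complex) set \<Rightarrow> (complex \<times> complex \<Rightarrow> complex) \<Rightarrow> (complex \<times> complex \<Rightarrow> complex) \<Rightarrow> complex" where
  "bergman_inner U f g = set_lebesgue_integral V U (\<lambda>p. f p * cnj (g p))"

definition is_bergman_kernel ::
    "(complex \<times> complex) set \<Rightarrow> (complex \<times> complex \<Rightarrow> complex \<times> complex \<Rightarrow> complex) \<Rightarrow> bool" where
  "is_bergman_kernel U K \<longleftrightarrow>
     (\<forall>w\<in>U. (\<lambda>z. K z w) \<in> bergman_space U \<and>
        (\<forall>f\<in>bergman_space U. f w = bergman_inner U f (\<lambda>z. K z w)))"

(* A reproducing kernel is unique only as a function on U \<times> U. The convention that it
   vanishes elsewhere makes it unique as a total function. *)
definition bergman_kernel ::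
    "(complex \<times> complex) set \<Rightarrow> complex \<times> complex \<Rightarrow> complex \<times> complex \<Rightarrow> complex" where
  "bergman_kernel U =
     (THE K. is_bergman_kernel U K \<and> (\<forall>z w. z \<notin> U \<or> w \<notin> U \<longrightarrow> K z w = 0))"

definition phi :: "nat \<Rightarrow> complex \<times> complex \<Rightarrow> complex \<times> complex" where
  "phi k = (\<lambda>(z1, z2). (z1 ^ k + z2 ^ k, z1 * z2))"

definition dihedral_domain :: "nat \<Rightarrow> (complex \<times> complex) set" where
  "dihedral_domain k = phi k ` bidisc"

definition primitive_root_of_unity :: "nat \<Rightarrow> complex \<Rightarrow> bool" where
  "primitive_root_of_unity k \<omega> \<longleftrightarrow> \<omega> ^ k = 1 \<and> (\<forall>j. 0 < j \<and> j < k \<longrightarrow> \<omega> ^ j \<noteq> 1)"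

(* Because division by 0 yields 0, this is only the intended value when
   z1 ^ k \<noteq> z2 ^ k and w1 ^ k \<noteq> w2 ^ k. *)
definition kernel_formula ::
    "nat \<Rightarrow> complex \<Rightarrow> complex \<times> complex \<Rightarrow> complex \<times> complex \<Rightarrow> complex" where
  "kernel_formula k \<omega> = (\<lambda>(z1, z2) (w1, w2).
     let X1 = 1 + z1\<^sup>2 * cnj w1 * cnj w2;
         X2 = 1 + z2\<^sup>2 * cnj w1 * cnj w2
     in (z1 - z2) / (of_nat k ^ 2 * (z1 ^ k - z2 ^ k) * (cnj w1 ^ k - cnj w2 ^ k)) *
        (\<Sum>i = 1..k.
           ((2 * (1 + z1 * z2 * cnj w1 * cnj w2)
               - (z1 + z2) * (\<omega> ^ i * cnj w1 + \<omega> ^ (k - i) * cnj w2))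
             * (\<omega> ^ i * cnj w1 - \<omega> ^ (k - i) * cnj w2))
           / (X1 * X2
               - (\<omega> ^ i * cnj w1 + \<omega> ^ (k - i) * cnj w2) * (z2 * X1 + z1 * X2)
               + z1 * z2 * (\<omega> ^ i * cnj w1 + \<omega> ^ (k - i) * cnj w2)\<^sup>2)\<^sup>2))"

definition regular_points :: "nat \<Rightarrow> (complex \<times> complex) set" where
  "regular_points k = {(z1, z2) \<in> bidisc. z1 ^ k \<noteq> z2 ^ k}"

(* R extends the restriction of F to S \<times> S, holomorphically in the first and
   antiholomorphically in the second argument. For S dense in U there is at most one
   such R on U \<times> U, by continuity in each variable separately. *)
definition sesquiholomorphic_extension ::
    "(complex \<times> complex) set \<Rightarrow> (complex \<times> complex) set \<Rightarrow>
     (complex \<times> complex \<Rightarrow> complex \<times> complex \<Rightarrow> complex) \<Rightarrow>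
     (complex \<times> complex \<Rightarrow> complex \<times> complex \<Rightarrow> complex) \<Rightarrow> bool" where
  "sesquiholomorphic_extension S U F R \<longleftrightarrow>
     (\<forall>w\<in>U. holomorphic2_on (\<lambda>z. R z w) U) \<and>
     (\<forall>z\<in>U. holomorphic2_on (\<lambda>w. cnj (R z w)) U) \<and>
     (\<forall>z\<in>S. \<forall>w\<in>S. R z w = F z w)"

end

theory Submission
  imports Defs "HOL-Complex_Analysis.Cauchy_Integral_Formula"
begin

text \<open>
  Write J(z) = k (z1^k - z2^k) for the Jacobian determinant of phi, G for the dihedral group of
  order 2k, sgn for its determinant character, D for the quotient domain, and
  B(z, w) = 1 / ((1 - z1 cnj w1)^2 (1 - z2 cnj w2)^2) for the Bergman kernel of the bidisc.
  Off the null set where J vanishes, phi is 2k-to-one, so f |-> J (f o phi) is, up to the factor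
  2k in the squared norm, an isometry of the Bergman space of D into that of the bidisc. Its image
  consists of functions that change by sgn under G. Hence, for the Bergman kernel K of D,

    K(phi z, phi w) J(z) cnj (J(w)) = sum over g in G of sgn(g) B(g z, w).

  The right-hand side is antisym_kernel. For every i it contains the contribution of a
  rotation and of a reflection, 1/Q^2 - 1/P^2 = (P - Q)(P + Q) / (P Q)^2, and P - Q is divisible
  by z1 - z2; this is the i-th summand of the formula (kernel_formula_eq).

  Dividing by J(z) cnj (J(w)) makes sense only at regular points, whereas a kernel is needed on
  all of D, and it has to be holomorphic there. Both are settled by evaluating the sum over the
  roots of unity in closed form (rotation_sum): with x = z1^k, y = z2^k and x', y' built likewise
  from the conjugates of w1, w2, the antisymmetrised sum is (x - y)(x' - y') times an explicit
  rational function of the invariants phi z and phi (cnj w) (orbit_sum_antisym). Its denominators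
  are powers of 1 - z1 z2 cnj (w1 w2) and of the product of the four factors
  1 - (z_i cnj w_j)^k (kernel_denominator_phi), and so have no zeros. This rational function is the
  kernel K, and its pullback under phi is the required extension R.

  The reproducing property is transferred from the bidisc. Integrals over D are integrals over
  the bidisc with weight |J|^2 / (2k) (distr_phi): the bidisc is, up to a null set, a union of
  2k sheets, each of which phi maps injectively onto almost all of D, and on each sheet the real
  Jacobian determinant of phi is |J|^2. On the bidisc, B reproduces integrable holomorphic
  functions by Fubini and the one-variable case, which is a comparison of power
  series coefficients. This yields f(v) = <f, K(., v)> for v = phi w with J(w) nonzero. Such points
  are dense, K(., v) is bounded on D locally uniformly in v, and so dominated
  convergence gives the identity at every v. Finally, any two reproducing kernels are conjugate
  transposes of each other, which makes the Bergman kernel unique.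
\<close>

section \<open>Averages over the roots of unity\<close>

lemma sum_powers_of_roots:
  assumes "primitive_root_of_unity k \<omega>" "0 < j" "j < k"
  shows "(\<Sum>i=1..k. (\<omega> ^ i) ^ j) = 0"
proof -
  have one: "\<omega> ^ k = 1" and ne: "\<omega> ^ j \<noteq> 1"
    using assms by (auto simp: primitive_root_of_unity_def)
  have "(\<Sum>i=1..k. (\<omega> ^ i) ^ j) = (\<Sum>i<k. \<omega> ^ j * (\<omega> ^ j) ^ i)"
    by (simp add: sum.atLeast1_atMost_eq power_mult_distrib power_mult[symmetric] mult.commute power_add)
  also have "\<dots> = \<omega> ^ j * (((\<omega> ^ j) ^ k - 1) / (\<omega> ^ j - 1))"
    using ne by (subst sum_distrib_left[symmetric], subst geometric_sum) auto
  also have "(\<omega> ^ j) ^ k = 1"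
    using one by (metis power_mult mult.commute power_one)
  finally show ?thesis by simp
qed

text \<open>
  The derivative of the geometric sum, multiplied out so that it holds for y = 1 as well. It
  turns 1 / (1 - y)^2 into a polynomial of degree less than k in y plus a multiple of 1 / (1 -
  y), with coefficients that depend on y^k only.
\<close>

lemma weighted_geometric_sum:
  fixes y :: complex
  shows "(1 - y)\<^sup>2 * (\<Sum>j<k. of_nat (Suc j) * y ^ j) = 1 - y ^ k - of_nat k * y ^ k * (1 - y)"
  by (induction k) (auto simp: algebra_simps power2_eq_square)

text \<open>
  Averaging a polynomial of degree less than k over the rotations of its argument by k-th roots
  of unity leaves the constant term.
\<close>

lemma sum_roots_filter:
  fixes c :: "nat \<Rightarrow> complex"
  assumes "primitive_root_of_unity k \<omega>" "0 < k"
  shows "(\<Sum>i=1..k. \<Sum>j<k. c j * (\<omega> ^ i * a) ^ j) = of_nat k * c 0"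
proof -
  have "(\<Sum>i=1..k. \<Sum>j<k. c j * (\<omega> ^ i * a) ^ j) = (\<Sum>j<k. c j * a ^ j * (\<Sum>i=1..k. (\<omega> ^ i) ^ j))"
    by (subst sum.swap) (simp add: sum_distrib_left power_mult_distrib mult_ac)
  also have "\<dots> = (\<Sum>j<k. if j = 0 then of_nat k * c 0 else 0)"
    using sum_powers_of_roots[OF assms(1)] by (intro sum.cong) auto
  also have "\<dots> = of_nat k * c 0" using \<open>0 < k\<close> by simp
  finally show ?thesis .
qed

lemma norm_power_lt_1: "norm (x::complex) < 1 \<Longrightarrow> 0 < n \<Longrightarrow> norm (x ^ n) < 1"
  by (simp add: norm_power power_less_one_iff)

lemma norm_root_of_unity:
  assumes "primitive_root_of_unity k \<omega>" "0 < k" shows "norm \<omega> = 1"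
  using assms by (metis primitive_root_of_unity_def norm_power norm_one norm_ge_zero power_eq_1_iff neq0_conv)

text \<open>
  With y = \<omega>^i a, the powers y^k = a^k are independent of i. Therefore 1 / (1 - y) and 1
  / (1 - y)^2 are polynomials of degree less than k in y with coefficients independent of i, to
  which the averaging principle applies.
\<close>

lemma sum_inverse_roots:
  assumes \<omega>: "primitive_root_of_unity k \<omega>" and k: "0 < k" and a: "norm a < 1"
  shows "(\<Sum>i=1..k. 1 / (1 - \<omega> ^ i * a)) = of_nat k / (1 - a ^ k)"
    and "(\<Sum>i=1..k. 1 / (1 - \<omega> ^ i * a)\<^sup>2)
          = of_nat k * (1 - a ^ k + of_nat k * a ^ k) / (1 - a ^ k)\<^sup>2"
proof -
  have nz: "1 - a ^ k \<noteq> 0"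
    using norm_power_lt_1[OF a k] by auto
  have nzi: "1 - \<omega> ^ i * a \<noteq> 0" for i
  proof -
    have "norm (\<omega> ^ i * a) < 1" using a norm_root_of_unity[OF \<omega> k] by (simp add: norm_mult norm_power)
    thus ?thesis by auto
  qed
  have pw: "(\<omega> ^ i * a) ^ k = a ^ k" for i
  proof -
    have "(\<omega> ^ i) ^ k = (\<omega> ^ k) ^ i" by (simp add: power_mult[symmetric] mult.commute)
    thus ?thesis using \<omega> by (simp add: power_mult_distrib primitive_root_of_unity_def)
  qed
  have "1 / (1 - \<omega> ^ i * a) = (\<Sum>j<k. (1 / (1 - a ^ k)) * (\<omega> ^ i * a) ^ j)" for i
  proof -
    have "(1 - \<omega> ^ i * a) * (\<Sum>j<k. (\<omega> ^ i * a) ^ j) = 1 - a ^ k"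
      using pw[of i] one_diff_power_eq[of "\<omega> ^ i * a" k] by metis
    thus ?thesis using nz nzi[of i] by (simp add: field_simps flip: sum_divide_distrib sum_distrib_left)
  qed
  thus 1: "(\<Sum>i=1..k. 1 / (1 - \<omega> ^ i * a)) = of_nat k / (1 - a ^ k)"
    using sum_roots_filter[OF \<omega> k, of "\<lambda>_. 1 / (1 - a ^ k)" a] by simp
  have "1 / (1 - \<omega> ^ i * a)\<^sup>2 = (\<Sum>j<k. (of_nat (Suc j) / (1 - a ^ k)) * (\<omega> ^ i * a) ^ j)
           + of_nat k * a ^ k / (1 - a ^ k) * (1 / (1 - \<omega> ^ i * a))" for i
  proof -
    define y where "y = \<omega> ^ i * a"
    define S where "S = (\<Sum>j<k. of_nat (Suc j) * y ^ j)"
    have y: "1 - y \<noteq> 0" "y ^ k = a ^ k" using nzi pw y_def by auto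
    have S: "(1 - y)\<^sup>2 * S = 1 - a ^ k - of_nat k * a ^ k * (1 - y)"
      using weighted_geometric_sum[of y k] y unfolding S_def by simp
    have "(\<Sum>j<k. (of_nat (Suc j) / (1 - a ^ k)) * y ^ j) = S / (1 - a ^ k)"
      unfolding S_def by (simp add: sum_divide_distrib)
    also have "S = (1 - a ^ k - of_nat k * a ^ k * (1 - y)) / (1 - y)\<^sup>2"
      using S y by (simp add: field_simps)
    finally have e: "(\<Sum>j<k. (of_nat (Suc j) / (1 - a ^ k)) * y ^ j)
        = (1 - a ^ k - of_nat k * a ^ k * (1 - y)) / (1 - y)\<^sup>2 / (1 - a ^ k)" .
    show ?thesis unfolding y_def[symmetric] e using y nz
      by (simp add: divide_simps power2_eq_square)
  qed
  hence "(\<Sum>i=1..k. 1 / (1 - \<omega> ^ i * a)\<^sup>2) =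
     (\<Sum>i=1..k. \<Sum>j<k. (of_nat (Suc j) / (1 - a ^ k)) * (\<omega> ^ i * a) ^ j)
      + of_nat k * a ^ k / (1 - a ^ k) * (\<Sum>i=1..k. 1 / (1 - \<omega> ^ i * a))"
    by (simp add: sum.distrib sum_distrib_left)
  also have "\<dots> = of_nat k / (1 - a ^ k) + of_nat k * a ^ k / (1 - a ^ k) * (of_nat k / (1 - a ^ k))"
    unfolding 1 using sum_roots_filter[OF \<omega> k, of "\<lambda>j. of_nat (Suc j) / (1 - a ^ k)" a] by simp
  also have "\<dots> = of_nat k * (1 - a ^ k + of_nat k * a ^ k) / (1 - a ^ k)\<^sup>2"
    using nz by (simp add: divide_simps power2_eq_square) (simp add: algebra_simps)
  finally show "(\<Sum>i=1..k. 1 / (1 - \<omega> ^ i * a)\<^sup>2)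
          = of_nat k * (1 - a ^ k + of_nat k * a ^ k) / (1 - a ^ k)\<^sup>2" .
qed

text \<open>
  The value of the sum over the rotations in the dihedral group of the bidisc kernel, where
  \<tau> = a b, A = a^k and B = b^k for the two products a = z1 cnj w1 and b = z2 cnj w2. Only
  \<tau>, A and B enter, and the value is symmetric in A and B.
\<close>

definition orbit_sum :: "nat \<Rightarrow> complex \<Rightarrow> complex \<Rightarrow> complex \<Rightarrow> complex" where
  "orbit_sum k \<tau> A B =
     of_nat k / (1 - \<tau>)\<^sup>2 * ((1 + \<tau>) / (1 - \<tau>) * (1 / (1 - A) + 1 / (1 - B) - 1)
        + of_nat k * (A / (1 - A)\<^sup>2 + B / (1 - B)\<^sup>2))"

lemma sum_inverse_roots_reverse:
  assumes "primitive_root_of_unity k \<omega>" 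
  shows "(\<Sum>i=1..k. f (\<omega> ^ (k - i))) = (\<Sum>i=1..k. f (\<omega> ^ i) :: complex)"
proof -
  have "(\<Sum>i=1..k. f (\<omega> ^ (k - i))) = (\<Sum>i<k. f (\<omega> ^ i))"
    by (rule sum.reindex_bij_witness[of _ "\<lambda>i. k - i" "\<lambda>i. k - i"]) auto
  also have "\<dots> = (\<Sum>i=1..k. f (\<omega> ^ i))"
    using assms unfolding primitive_root_of_unity_def
    by (intro sum.reindex_bij_witness[of _ "\<lambda>i. if i = k then 0 else i" "\<lambda>i. if i = 0 then k else i"])
       (auto split: if_splits)
  finally show ?thesis .
qed

text \<open>
  The point is that the factors u = 1 / (1 - \<omega>^i a) and v = 1 / (1 - \<omega>^(k-i) b)
  satisfy (1 - \<tau>) u v = u + v - 1 with \<tau> = a b independent of i. So the mixed product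
  u^2 v^2 reduces to a combination of u^2, v^2, u, v and 1, which are summed separately.
\<close>

lemma rotation_sum:
  assumes \<omega>: "primitive_root_of_unity k \<omega>" and k: "0 < k" and a: "norm a < 1" and b: "norm b < 1"
  shows "(\<Sum>i=1..k. 1 / ((1 - \<omega> ^ i * a)\<^sup>2 * (1 - \<omega> ^ (k - i) * b)\<^sup>2))
           = orbit_sum k (a * b) (a ^ k) (b ^ k)"
proof -
  have n1: "norm (a * b) < 1"
    using a b by (simp add: norm_mult) (metis mult_less_cancel_right2 mult_le_one norm_ge_zero less_eq_real_def mult_strict_mono' mult_1 norm_mult)
  define t where "t = 1 - a * b"
  have t: "t \<noteq> 0" using n1 unfolding t_def by auto
  have nz: "1 - a ^ k \<noteq> 0" "1 - b ^ k \<noteq> 0"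
    using norm_power_lt_1[OF a k] norm_power_lt_1[OF b k] by auto
  let ?u = "\<lambda>i. 1 / (1 - \<omega> ^ i * a)" and ?v = "\<lambda>i. 1 / (1 - \<omega> ^ (k - i) * b)"
  have summand: "1 / ((1 - \<omega> ^ i * a)\<^sup>2 * (1 - \<omega> ^ (k - i) * b)\<^sup>2) =
     ((?u i)\<^sup>2 + (?v i)\<^sup>2 + 1 + (2/t - 2) * (?u i + ?v i) - 2 / t) / t\<^sup>2" if "i \<in> {1..k}" for i
  proof -
    define x y where "x = \<omega> ^ i * a" and "y = \<omega> ^ (k - i) * b"
    have "\<omega> ^ i * \<omega> ^ (k - i) = 1"
      using \<omega> that by (simp add: primitive_root_of_unity_def flip: power_add)
    hence xy: "x * y = a * b" unfolding x_def y_def by (simp add: algebra_simps)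
    have "norm x < 1" "norm y < 1"
      using a b norm_root_of_unity[OF \<omega> k] by (auto simp: x_def y_def norm_mult norm_power)
    hence nz: "1 - x \<noteq> 0" "1 - y \<noteq> 0" by auto
    define u v where "u = 1 / (1 - x)" and "v = 1 / (1 - y)"
    have uv: "t * (u * v) = u + v - 1"
      unfolding u_def v_def t_def xy[symmetric] using nz by (simp add: divide_simps) (simp add: algebra_simps)
    have "1 / ((1 - x)\<^sup>2 * (1 - y)\<^sup>2) = (u * v)\<^sup>2"
      unfolding u_def v_def by (simp add: power_divide power_mult_distrib)
    also have "\<dots> = (u + v - 1)\<^sup>2 / t\<^sup>2" using uv t by (simp add: power_mult_distrib flip: uv)
    also have "(u + v - 1)\<^sup>2 = u\<^sup>2 + v\<^sup>2 + 1 + 2 * (u * v) - 2 * (u + v)"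
      by (simp add: power2_eq_square algebra_simps)
    also have "u * v = (u + v - 1) / t" using uv t by (simp add: field_simps)
    finally have e: "1 / ((1 - x)\<^sup>2 * (1 - y)\<^sup>2)
        = (u\<^sup>2 + v\<^sup>2 + 1 + 2 * ((u + v - 1) / t) - 2 * (u + v)) / t\<^sup>2" .
    show ?thesis unfolding x_def[symmetric] y_def[symmetric] u_def[symmetric] v_def[symmetric] e
      using t by (simp add: divide_simps) (simp add: algebra_simps)
  qed
  have sv: "(\<Sum>i=1..k. ?v i) = of_nat k / (1 - b ^ k)"
    "(\<Sum>i=1..k. (?v i)\<^sup>2) = of_nat k * (1 - b ^ k + of_nat k * b ^ k) / (1 - b ^ k)\<^sup>2"
    using sum_inverse_roots[OF \<omega> k b] sum_inverse_roots_reverse[OF \<omega>, of "\<lambda>x. 1 / (1 - x * b)"]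
      sum_inverse_roots_reverse[OF \<omega>, of "\<lambda>x. 1 / (1 - x * b)\<^sup>2"] by (simp_all add: power_divide)
  have su: "(\<Sum>i=1..k. ?u i) = of_nat k / (1 - a ^ k)"
    "(\<Sum>i=1..k. (?u i)\<^sup>2) = of_nat k * (1 - a ^ k + of_nat k * a ^ k) / (1 - a ^ k)\<^sup>2"
    using sum_inverse_roots[OF \<omega> k a] by (simp_all add: power_divide)
  have "(\<Sum>i=1..k. 1 / ((1 - \<omega> ^ i * a)\<^sup>2 * (1 - \<omega> ^ (k - i) * b)\<^sup>2))
      = (\<Sum>i=1..k. ((?u i)\<^sup>2 + (?v i)\<^sup>2 + 1 + (2/t - 2) * (?u i + ?v i) - 2 / t) / t\<^sup>2)"
    using summand by (rule sum.cong[OF refl])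
  also have "\<dots> = ((\<Sum>i=1..k. (?u i)\<^sup>2) + (\<Sum>i=1..k. (?v i)\<^sup>2) + of_nat k
      + (2/t - 2) * ((\<Sum>i=1..k. ?u i) + (\<Sum>i=1..k. ?v i)) - of_nat k * (2 / t)) / t\<^sup>2"
    by (simp only: sum_divide_distrib[symmetric] sum_subtractf sum.distrib sum_distrib_left[symmetric]) simp
  also have "\<dots> = orbit_sum k (a * b) (a ^ k) (b ^ k)"
  proof -
    have a: "of_nat k * (1 - X + of_nat k * X) / (1 - X)\<^sup>2 = of_nat k * (1 / (1 - X)) + of_nat k * of_nat k * (X / (1 - X)\<^sup>2)"
      if "1 - X \<noteq> 0" for X :: complex using that by (simp add: divide_simps power2_eq_square) (simp add: algebra_simps)
    have b: "of_nat k / (1 - X) = of_nat k * (1 / (1 - X))" for X :: complex by simp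
    define p q p2 q2 where "p = 1 / (1 - a ^ k)" "q = 1 / (1 - b ^ k)" "p2 = a ^ k / (1 - a ^ k)\<^sup>2" "q2 = b ^ k / (1 - b ^ k)\<^sup>2"
    have t1: "(1 + a * b) / (1 - a * b) = 2 / t - 1" using t unfolding t_def by (simp add: divide_simps)
    show ?thesis unfolding su sv orbit_sum_def a[OF nz(1)] a[OF nz(2)] b[of "a ^ k"] b[of "b ^ k"] t1
      unfolding p_q_p2_q2_def[symmetric] t_def[symmetric] using t by (simp add: field_simps)
  qed
  finally show ?thesis .
qed

section \<open>The antisymmetrised kernel as a rational function of invariants\<close>

text \<open>
  At (s, p) = phi z and (s', p') = phi w this is the product of 1 - (z_i w_j)^k over all i and
  j, written in the invariants.
\<close>

definition kernel_denominator :: "nat \<Rightarrow> complex \<times> complex \<Rightarrow> complex \<times> complex \<Rightarrow> complex" where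
  "kernel_denominator k = (\<lambda>(s, p) (s', p').
     (1 + (p * p') ^ k)\<^sup>2 - (1 + (p * p') ^ k) * (s * s')
       + (p ^ k * (s'\<^sup>2 - 2 * p' ^ k) + p' ^ k * (s\<^sup>2 - 2 * p ^ k)))"

text \<open>
  The second argument stands for the conjugate of the point of the quotient domain, so that the
  function is rational and symmetric in its two arguments.
\<close>

definition kernel_rational :: "nat \<Rightarrow> complex \<times> complex \<Rightarrow> complex \<times> complex \<Rightarrow> complex" where
  "kernel_rational k = (\<lambda>(s, p) (s', p').
     let \<tau> = p * p'; T = \<tau> ^ k; c = 1 + T;
         m = p ^ k * (s'\<^sup>2 - 2 * p' ^ k) + p' ^ k * (s\<^sup>2 - 2 * p ^ k);
         D = kernel_denominator k (s, p) (s', p')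
     in ((1 + \<tau>) * (1 - T) / ((1 - \<tau>) ^ 3 * D)
         + of_nat k * (c ^ 3 - c * m - 4 * T * (2 * c - s * s')) / ((1 - \<tau>)\<^sup>2 * D\<^sup>2)) / of_nat k)"

lemma kernel_denominator_phi:
  "kernel_denominator k (phi k (z1, z2)) (phi k (w1, w2)) =
     (1 - (z1 * w1) ^ k) * (1 - (z2 * w2) ^ k) * (1 - (z1 * w2) ^ k) * (1 - (z2 * w1) ^ k)"
  unfolding kernel_denominator_def phi_def
  by (simp add: power_mult_distrib algebra_simps power2_eq_square)

text \<open>
  Exchanging x and y keeps x x' y y' = T and replaces \<alpha> = x x' + y y' by \<beta> = y x' +
  x y'. The orbit sum depends on \<tau>, T and \<alpha> only. Thus the difference is divisible
  by \<alpha> - \<beta> = (x - y) (x' - y'), and the quotient is symmetric in \<alpha> and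
  \<beta>; it is a function of \<alpha> + \<beta> = s s' and \<alpha> \<beta> = m.
\<close>

lemma orbit_sum_antisym:
  fixes x y x' y' \<tau> :: complex
  assumes "1 - x * x' \<noteq> 0" "1 - y * y' \<noteq> 0" "1 - x * y' \<noteq> 0" "1 - y * x' \<noteq> 0" "1 - \<tau> \<noteq> 0"
    and T: "T = x * y * (x' * y')"
    and "c = 1 + T" "s = x + y" "s' = x' + y'" "m = x * y * (s'\<^sup>2 - 2 * (x' * y')) + x' * y' * (s\<^sup>2 - 2 * (x * y))"
    and "D = c\<^sup>2 - c * (s * s') + m"
  shows "orbit_sum k \<tau> (x * x') (y * y') - orbit_sum k \<tau> (y * x') (x * y') =
     (x - y) * (x' - y') * of_nat k * ((1 + \<tau>) * (1 - T) / ((1 - \<tau>) ^ 3 * D)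
         + of_nat k * (c ^ 3 - c * m - 4 * T * (2 * c - s * s')) / ((1 - \<tau>)\<^sup>2 * D\<^sup>2))"
proof -
  define \<alpha> \<beta> where "\<alpha> = x * x' + y * y'" and "\<beta> = y * x' + x * y'"
  have split: "1 / (1 - A) + 1 / (1 - B) - 1 = (1 - A * B) / (c - \<gamma>)"
    "A / (1 - A)\<^sup>2 + B / (1 - B)\<^sup>2 = (c * \<gamma> - 4 * T) / (c - \<gamma>)\<^sup>2"
    if "1 - A \<noteq> 0" "1 - B \<noteq> 0" "A * B = T" "\<gamma> = A + B" for A B \<gamma>
  proof -
    have cg: "c - \<gamma> = (1 - A) * (1 - B)"
      unfolding \<open>c = 1 + T\<close> that(3)[symmetric] that(4) by (simp add: algebra_simps)
    show "1 / (1 - A) + 1 / (1 - B) - 1 = (1 - A * B) / (c - \<gamma>)"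
      unfolding cg using that(1,2) by (simp add: divide_simps) (simp add: algebra_simps)
    have "A / (1 - A)\<^sup>2 + B / (1 - B)\<^sup>2 = (A * (1 - B)\<^sup>2 + B * (1 - A)\<^sup>2) / (c - \<gamma>)\<^sup>2"
      unfolding cg using that(1,2) by (simp add: add_frac_eq power_mult_distrib)
    also have "A * (1 - B)\<^sup>2 + B * (1 - A)\<^sup>2 = c * \<gamma> - 4 * T"
      unfolding \<open>c = 1 + T\<close> that(3)[symmetric] that(4) by (simp add: algebra_simps power2_eq_square)
    finally show "A / (1 - A)\<^sup>2 + B / (1 - B)\<^sup>2 = (c * \<gamma> - 4 * T) / (c - \<gamma>)\<^sup>2" .
  qed
  have T1: "x * x' * (y * y') = T" and T2: "y * x' * (x * y') = T" by (simp_all add: T)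
  have ca: "c - \<alpha> = (1 - x * x') * (1 - y * y')" and cb: "c - \<beta> = (1 - y * x') * (1 - x * y')"
    unfolding \<alpha>_def \<beta>_def assms by (simp_all add: algebra_simps)
  have nz: "c - \<alpha> \<noteq> 0" "c - \<beta> \<noteq> 0" using assms(1-4) unfolding ca cb by auto
  have ss: "s * s' = \<alpha> + \<beta>" and mm: "m = \<alpha> * \<beta>"
    unfolding \<alpha>_def \<beta>_def assms by (simp_all add: algebra_simps power2_eq_square)
  have D: "D = (c - \<alpha>) * (c - \<beta>)"
    unfolding assms(11) ss mm by (simp add: algebra_simps power2_eq_square)
  have d: "\<alpha> - \<beta> = (x - y) * (x' - y')" unfolding \<alpha>_def \<beta>_def by (simp add: algebra_simps)
  have E1: "(1 - T) / (c - \<alpha>) - (1 - T) / (c - \<beta>) = (\<alpha> - \<beta>) * ((1 - T) / D)"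
    unfolding D using nz by (simp add: divide_simps) (simp add: algebra_simps)
  have E2: "(c * \<alpha> - 4 * T) / (c - \<alpha>)\<^sup>2 - (c * \<beta> - 4 * T) / (c - \<beta>)\<^sup>2
      = (\<alpha> - \<beta>) * ((c ^ 3 - c * m - 4 * T * (2 * c - s * s')) / D\<^sup>2)"
  proof -
    have "(c * \<alpha> - 4 * T) / (c - \<alpha>)\<^sup>2 - (c * \<beta> - 4 * T) / (c - \<beta>)\<^sup>2
      = ((c * \<alpha> - 4 * T) * (c - \<beta>)\<^sup>2 - (c * \<beta> - 4 * T) * (c - \<alpha>)\<^sup>2) / D\<^sup>2"
      unfolding D using nz by (simp add: diff_frac_eq power_mult_distrib)
    also have "(c * \<alpha> - 4 * T) * (c - \<beta>)\<^sup>2 - (c * \<beta> - 4 * T) * (c - \<alpha>)\<^sup>2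
      = (\<alpha> - \<beta>) * (c ^ 3 - c * m - 4 * T * (2 * c - s * s'))"
      unfolding ss mm by (simp add: algebra_simps power2_eq_square power3_eq_cube)
    finally show ?thesis by simp
  qed
  have "orbit_sum k \<tau> (x * x') (y * y') - orbit_sum k \<tau> (y * x') (x * y') =
    of_nat k / (1 - \<tau>)\<^sup>2 * ((1 + \<tau>) / (1 - \<tau>) * ((1 - T) / (c - \<alpha>) - (1 - T) / (c - \<beta>))
        + of_nat k * ((c * \<alpha> - 4 * T) / (c - \<alpha>)\<^sup>2 - (c * \<beta> - 4 * T) / (c - \<beta>)\<^sup>2))"
    unfolding orbit_sum_def split[OF assms(1,2) T1 \<alpha>_def] split[OF assms(4,3) T2 \<beta>_def] T1 T2
    by (simp add: algebra_simps)
  also have "\<dots> = of_nat k / (1 - \<tau>)\<^sup>2 * ((1 + \<tau>) / (1 - \<tau>) * ((\<alpha> - \<beta>) * ((1 - T) / D))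
        + of_nat k * ((\<alpha> - \<beta>) * ((c ^ 3 - c * m - 4 * T * (2 * c - s * s')) / D\<^sup>2)))"
    unfolding E1 E2 ..
  also have "\<dots> = (\<alpha> - \<beta>) * of_nat k * ((1 + \<tau>) * (1 - T) / ((1 - \<tau>) ^ 3 * D)
         + of_nat k * (c ^ 3 - c * m - 4 * T * (2 * c - s * s')) / ((1 - \<tau>)\<^sup>2 * D\<^sup>2))"
  proof -
    have "a / t\<^sup>2 * (b / t * (e * (f / D)) + a * (e * (g / D2))) 
        = e * a * (b * f / (t ^ 3 * D) + a * g / (t\<^sup>2 * D2))"
      for a t b e f g D D2 :: complex
      by (simp add: algebra_simps power3_eq_cube power2_eq_square)
    thus ?thesis .
  qed
  finally show ?thesis unfolding d .
qed

text \<open>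
  The sum over the dihedral group of the bidisc kernel, twisted by the determinant character:
  the first term belongs to a rotation and the second to that rotation followed by the swap. The
  second argument is already conjugated.
\<close>

definition antisym_kernel :: "nat \<Rightarrow> complex \<Rightarrow> complex \<times> complex \<Rightarrow> complex \<times> complex \<Rightarrow> complex" where
  "antisym_kernel k \<omega> = (\<lambda>(z1, z2) (w1, w2).
     \<Sum>i=1..k. 1 / ((1 - z1 * (\<omega> ^ i * w1))\<^sup>2 * (1 - z2 * (\<omega> ^ (k - i) * w2))\<^sup>2)
             - 1 / ((1 - z2 * (\<omega> ^ i * w1))\<^sup>2 * (1 - z1 * (\<omega> ^ (k - i) * w2))\<^sup>2))"

lemma norm_mult_less_1: "norm a < 1 \<Longrightarrow> norm b < 1 \<Longrightarrow> norm (a * b :: complex) < 1"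
  by (metis norm_mult mult_1 mult_strict_mono' norm_ge_zero)

lemma antisym_kernel_eq:
  assumes \<omega>: "primitive_root_of_unity k \<omega>" and k: "0 < k"
    and n: "norm z1 < 1" "norm z2 < 1" "norm w1 < 1" "norm w2 < 1"
  shows "antisym_kernel k \<omega> (z1, z2) (w1, w2) = 
     of_nat k ^ 2 * (z1 ^ k - z2 ^ k) * (w1 ^ k - w2 ^ k) * kernel_rational k (phi k (z1, z2)) (phi k (w1, w2))"
proof -
  have nz: "1 - a ^ k * b ^ k \<noteq> 0" if "norm a < 1" "norm b < 1" for a b :: complex
    using norm_power_lt_1[OF norm_mult_less_1[OF that] k] by (auto simp: power_mult_distrib)
  have nt: "1 - z1 * z2 * (w1 * w2) \<noteq> 0"
    using norm_mult_less_1[OF norm_mult_less_1[OF n(1,2)] norm_mult_less_1[OF n(3,4)]] by auto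
  have "antisym_kernel k \<omega> (z1, z2) (w1, w2) = 
      (\<Sum>i=1..k. 1 / ((1 - \<omega> ^ i * (z1 * w1))\<^sup>2 * (1 - \<omega> ^ (k - i) * (z2 * w2))\<^sup>2))
    - (\<Sum>i=1..k. 1 / ((1 - \<omega> ^ i * (z2 * w1))\<^sup>2 * (1 - \<omega> ^ (k - i) * (z1 * w2))\<^sup>2))"
    unfolding antisym_kernel_def by (simp add: sum_subtractf mult_ac)
  also have "\<dots> = orbit_sum k (z1 * z2 * (w1 * w2)) (z1 ^ k * w1 ^ k) (z2 ^ k * w2 ^ k) -
      orbit_sum k (z1 * z2 * (w1 * w2)) (z2 ^ k * w1 ^ k) (z1 ^ k * w2 ^ k)"
    using rotation_sum[OF \<omega> k norm_mult_less_1[OF n(1,3)] norm_mult_less_1[OF n(2,4)]]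
      rotation_sum[OF \<omega> k norm_mult_less_1[OF n(2,3)] norm_mult_less_1[OF n(1,4)]]
    by (simp add: power_mult_distrib mult_ac)
  also have "\<dots> = of_nat k ^ 2 * (z1 ^ k - z2 ^ k) * (w1 ^ k - w2 ^ k)
      * kernel_rational k (phi k (z1, z2)) (phi k (w1, w2))"
    unfolding orbit_sum_antisym[OF nz[OF n(1,3)] nz[OF n(2,4)] nz[OF n(1,4)] nz[OF n(2,3)] nt refl refl refl refl refl refl]
    unfolding kernel_rational_def kernel_denominator_def phi_def Let_def
    using k by (simp add: power_mult_distrib mult_ac power2_eq_square)
  finally show ?thesis .
qed

text \<open>
  Each summand of the formula, multiplied by z1 - z2, is the difference of the contributions of
  a rotation and a reflection: with a = \<omega>^i cnj w1 and b = \<omega>^(k-i) cnj w2, the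
  denominator is the square of the product of P = (1 - z2 a) (1 - z1 b) and Q = (1 - z1 a) (1 -
  z2 b), and the numerator is P^2 - Q^2.
\<close>

lemma kernel_formula_eq:
  assumes \<omega>: "primitive_root_of_unity k \<omega>" and k: "0 < k"
    and z: "(z1, z2) \<in> regular_points k" and w: "(w1, w2) \<in> regular_points k"
  shows "kernel_formula k \<omega> (z1, z2) (w1, w2) = kernel_rational k (phi k (z1, z2)) (phi k (cnj w1, cnj w2))"
proof -
  have n: "norm z1 < 1" "norm z2 < 1" "norm (cnj w1) < 1" "norm (cnj w2) < 1"
    and ne: "z1 ^ k - z2 ^ k \<noteq> 0" "w1 ^ k \<noteq> w2 ^ k"
    using z w by (auto simp: regular_points_def bidisc_def)
  have ne': "cnj w1 ^ k - cnj w2 ^ k \<noteq> 0" 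
    using ne(2) by (metis complex_cnj_power complex_cnj_cancel_iff eq_iff_diff_eq_0)
  let ?a = "cnj w1" and ?b = "cnj w2"
  define num where "num i = (2 * (1 + z1 * z2 * ?a * ?b)
               - (z1 + z2) * (\<omega> ^ i * ?a + \<omega> ^ (k - i) * ?b))
             * (\<omega> ^ i * ?a - \<omega> ^ (k - i) * ?b)" for i
  define den where "den i = ((1 + z1\<^sup>2 * ?a * ?b) * (1 + z2\<^sup>2 * ?a * ?b)
               - (\<omega> ^ i * ?a + \<omega> ^ (k - i) * ?b) * (z2 * (1 + z1\<^sup>2 * ?a * ?b) + z1 * (1 + z2\<^sup>2 * ?a * ?b))
               + z1 * z2 * (\<omega> ^ i * ?a + \<omega> ^ (k - i) * ?b)\<^sup>2)\<^sup>2" for i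
  have summand: "(z1 - z2) * (num i / den i) = 
      1 / ((1 - z1 * (\<omega> ^ i * ?a))\<^sup>2 * (1 - z2 * (\<omega> ^ (k - i) * ?b))\<^sup>2)
             - 1 / ((1 - z2 * (\<omega> ^ i * ?a))\<^sup>2 * (1 - z1 * (\<omega> ^ (k - i) * ?b))\<^sup>2)" if "i \<in> {1..k}" for i
  proof -
    define a b where "a = \<omega> ^ i * ?a" and "b = \<omega> ^ (k - i) * ?b"
    have ab: "x * ?a * ?b = x * (a * b)" for x
    proof -
      have "\<omega> ^ i * \<omega> ^ (k - i) = 1"
        using \<omega> that by (simp add: primitive_root_of_unity_def flip: power_add)
      thus ?thesis unfolding a_def b_def by (simp add: algebra_simps)
    qed
    have "norm a < 1" "norm b < 1"
      using n norm_root_of_unity[OF \<omega> k] by (auto simp: a_def b_def norm_mult norm_power)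
    hence nz: "1 - z * a \<noteq> 0" "1 - z * b \<noteq> 0" if "norm z < 1" for z
      using norm_mult_less_1 that by fastforce+
    define P Q where "P = (1 - z2 * a) * (1 - z1 * b)" and "Q = (1 - z1 * a) * (1 - z2 * b)"
    have PQ: "P \<noteq> 0" "Q \<noteq> 0" using nz n unfolding P_def Q_def by auto
    have "(z1 - z2) * num i = P\<^sup>2 - Q\<^sup>2"
      unfolding num_def a_def[symmetric] b_def[symmetric] ab P_def Q_def
      by (simp add: algebra_simps power2_eq_square)
    moreover have "den i = (P * Q)\<^sup>2"
      unfolding den_def a_def[symmetric] b_def[symmetric] ab P_def Q_def
      by (rule arg_cong[of _ _ "\<lambda>x. x\<^sup>2"]) (simp add: algebra_simps power2_eq_square)
    ultimately have "(z1 - z2) * (num i / den i) = 1 / Q\<^sup>2 - 1 / P\<^sup>2"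
      using PQ by (simp add: field_simps)
    thus ?thesis unfolding a_def[symmetric] b_def[symmetric] P_def Q_def by (simp add: power_mult_distrib)
  qed
  have "(z1 - z2) * (\<Sum>i=1..k. num i / den i) = antisym_kernel k \<omega> (z1, z2) (?a, ?b)"
    unfolding antisym_kernel_def using summand by (simp add: sum_distrib_left)
  moreover have "kernel_formula k \<omega> (z1, z2) (w1, w2) = 
      ((z1 - z2) * (\<Sum>i=1..k. num i / den i)) / (of_nat k ^ 2 * (z1 ^ k - z2 ^ k) * (?a ^ k - ?b ^ k))"
    unfolding kernel_formula_def num_def den_def Let_def by simp
  ultimately show ?thesis
    using antisym_kernel_eq[OF \<omega> k n] ne ne' k by simp
qed

section \<open>The quotient domain and holomorphic functions of two variables\<close>

lemma bidisc_iff: "(z1, z2) \<in> bidisc \<longleftrightarrow> norm z1 < 1 \<and> norm z2 < 1"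
  by (simp add: bidisc_def)

lemma complex_nth_root: "0 < k \<Longrightarrow> \<exists>z::complex. z ^ k = x"
proof (cases "x = 0")
  case False
  assume "0 < k"
  have "exp (Ln x / of_nat k) ^ k = exp (of_nat k * (Ln x / of_nat k))"
    by (rule exp_of_nat_mult[symmetric])
  also have "\<dots> = x" using False \<open>0 < k\<close> by simp
  finally show ?thesis by blast
qed (auto intro!: exI[of _ 0])

lemma norm_lt_1_of_power: "0 < k \<Longrightarrow> norm (z ^ k) < 1 \<Longrightarrow> norm (z::complex) < 1"
  by (metis norm_power norm_ge_zero one_le_power linorder_not_less)

text \<open>
  A point (s, p) determines the unordered pair of k-th powers of z1 and z2 as the roots of X^2 -
  s X + p^k. It lies in the image of the bidisc iff both roots have modulus less than one, and
  the condition is stated for the reciprocals y = 1/X because these range over a compact set.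
\<close>

lemma dihedral_domain_iff:
  assumes k: "0 < k"
  shows "(s, p) \<in> dihedral_domain k \<longleftrightarrow> (\<forall>y\<in>cball 0 1. 1 - s * y + p ^ k * y\<^sup>2 \<noteq> 0)"
proof
  assume "(s, p) \<in> dihedral_domain k"
  then obtain z1 z2 where z: "norm z1 < 1" "norm z2 < 1" "s = z1 ^ k + z2 ^ k" "p = z1 * z2"
    by (auto simp: dihedral_domain_def phi_def bidisc_def)
  show "\<forall>y\<in>cball 0 1. 1 - s * y + p ^ k * y\<^sup>2 \<noteq> 0"
  proof
    fix y :: complex assume y: "y \<in> cball 0 1"
    have "1 - z ^ k * y \<noteq> 0" if "norm z < 1" for z
    proof
      assume "1 - z ^ k * y = 0"
      hence "norm (z ^ k) * norm y = 1" by (metis norm_mult norm_one eq_iff_diff_eq_0)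
      moreover have "norm (z ^ k) * norm y \<le> norm (z ^ k) * 1" using y by (intro mult_left_mono) auto
      ultimately show False using norm_power_lt_1[OF that k] by linarith
    qed
    hence "(1 - z1 ^ k * y) * (1 - z2 ^ k * y) \<noteq> 0" using z by auto
    thus "1 - s * y + p ^ k * y\<^sup>2 \<noteq> 0"
      unfolding z by (simp add: algebra_simps power2_eq_square power_mult_distrib)
  qed
next
  assume R: "\<forall>y\<in>cball 0 1. 1 - s * y + p ^ k * y\<^sup>2 \<noteq> 0"
  (* The two roots of X^2 - s X + p^k, by the quadratic formula. *)
  define d where "d = csqrt (s\<^sup>2 - 4 * p ^ k)"
  define x x' where "x = (s + d) / 2" and "x' = (s - d) / 2"
  have d: "d\<^sup>2 = s\<^sup>2 - 4 * p ^ k" unfolding d_def by simp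
  have sx: "x + x' = s" and px: "x * x' = p ^ k"
  proof -
    show "x + x' = s" unfolding x_def x'_def by (simp add: field_simps)
    have "4 * (x * x') = s\<^sup>2 - d\<^sup>2" unfolding x_def x'_def by (simp add: field_simps power2_eq_square)
    thus "x * x' = p ^ k" unfolding d by simp
  qed
  have small: "norm x < 1" if "x + x' = s" "x * x' = p ^ k" for x x'
  proof (rule ccontr)
    assume "\<not> norm x < 1"
    hence x: "x \<noteq> 0" "norm x \<ge> 1" by auto
    hence "1 / x \<in> cball 0 1" by (simp add: norm_divide)
    moreover have "1 - s * (1 / x) + p ^ k * (1 / x)\<^sup>2 = 0"
      unfolding that[symmetric] using x by (simp add: field_simps power2_eq_square)
    ultimately show False using R by blast
  qed
  have nx: "norm x < 1" "norm x' < 1" using small[of x x'] small[of x' x] sx px by (auto simp: add.commute mult.commute)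
  (* It remains to lift the pair (x, x') to (z1, z2) with the prescribed product p. If x is
     nonzero, z2 = p / z1 works for every k-th root z1 of x; otherwise p = 0 and z1 = 0. *)
  show "(s, p) \<in> dihedral_domain k"
  proof (cases "x = 0")
    case True
    obtain z2 where z2: "z2 ^ k = x'" using complex_nth_root[OF k] by blast
    have "p = 0" using px True k by simp
    moreover have "norm z2 < 1" using norm_lt_1_of_power[OF k] z2 nx by auto
    ultimately have "(s, p) = phi k (0, z2)" "(0, z2) \<in> bidisc"
      using z2 sx True k by (auto simp: phi_def bidisc_iff)
    thus ?thesis unfolding dihedral_domain_def by blast
  next
    case False
    obtain z1 where z1: "z1 ^ k = x" using complex_nth_root[OF k] by blast
    with False k have nz: "z1 \<noteq> 0" by auto
    have "(p / z1) ^ k = x'" using z1 px False by (simp add: power_divide flip: px)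
    hence "(s, p) = phi k (z1, p / z1)" "(z1, p / z1) \<in> bidisc"
      using z1 sx nz nx norm_lt_1_of_power[OF k] by (auto simp: phi_def bidisc_iff)
    thus ?thesis unfolding dihedral_domain_def by blast
  qed
qed

lemma open_bidisc: "open bidisc"
  unfolding bidisc_def by (intro open_Times) auto

text \<open>
  The complement is the projection of a closed set along the compact disc of all y.
\<close>

lemma open_dihedral_domain:
  assumes k: "0 < k" shows "open (dihedral_domain k)"
proof -
  let ?T = "{q :: complex \<times> complex \<times> complex. 1 - fst (snd q) * fst q + snd (snd q) ^ k * (fst q)\<^sup>2 = 0}"
  have "closed ?T" by (intro closed_Collect_eq continuous_intros)
  hence "closed {u. \<exists>y. y \<in> cball 0 1 \<and> (y, u) \<in> ?T}"
    by (intro closed_compact_projection) auto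
  moreover have "(s, p) \<in> dihedral_domain k \<longleftrightarrow> (s, p) \<in> - {u. \<exists>y. y \<in> cball 0 1 \<and> (y, u) \<in> ?T}" for s p
    unfolding dihedral_domain_iff[OF k] Compl_iff mem_Collect_eq fst_conv snd_conv by blast
  hence "dihedral_domain k = - {u. \<exists>y. y \<in> cball 0 1 \<and> (y, u) \<in> ?T}"
    by (intro set_eqI) (simp only: split_paired_all)
  ultimately show ?thesis by (simp add: open_Compl)
qed

lemma continuous_on_phi: "continuous_on S (phi k)"
  unfolding phi_def case_prod_beta by (intro continuous_intros)

lemma bounded_dihedral_domain: "bounded (dihedral_domain k)"
proof -
  have "compact (phi k ` (cball 0 1 \<times> cball 0 1))"
    by (intro compact_continuous_image continuous_on_phi compact_Times) auto
  moreover have "dihedral_domain k \<subseteq> phi k ` (cball 0 1 \<times> cball 0 1)"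
    unfolding dihedral_domain_def bidisc_def by (intro image_mono Sigma_mono) auto
  ultimately show ?thesis using compact_imp_bounded bounded_subset by blast
qed

lemma holomorphic2_onD:
  assumes "holomorphic2_on f U" "open U" "q \<in> U"
  obtains a b where "(f has_derivative (\<lambda>h. a * fst h + b * snd h)) (at q)"
proof -
  obtain a b where "(f has_derivative (\<lambda>h. a * fst h + b * snd h)) (at q within U)"
    using assms unfolding holomorphic2_on_def by blast
  hence "(f has_derivative (\<lambda>h. a * fst h + b * snd h)) (at q)"
    unfolding at_within_open[OF assms(3,2)] .
  thus ?thesis by (rule that)
qed

lemma holomorphic2_on_const: "holomorphic2_on (\<lambda>_. c) U"
  unfolding holomorphic2_on_def
  by (rule ballI, rule exI[of _ 0], rule exI[of _ 0]) auto

lemma holomorphic2_on_fst: "holomorphic2_on fst U"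
  unfolding holomorphic2_on_def
  by (rule ballI, rule exI[of _ 1], rule exI[of _ 0])
     (simp add: bounded_linear_imp_has_derivative bounded_linear_fst)

lemma holomorphic2_on_snd: "holomorphic2_on snd U"
  unfolding holomorphic2_on_def
  by (rule ballI, rule exI[of _ 0], rule exI[of _ 1])
     (simp add: bounded_linear_imp_has_derivative bounded_linear_snd)

lemma holomorphic2_on_add:
  assumes "holomorphic2_on f U" "holomorphic2_on g U"
  shows "holomorphic2_on (\<lambda>q. f q + g q) U"
  unfolding holomorphic2_on_def
proof
  fix q assume "q \<in> U"
  with assms obtain a b c d where
    "(f has_derivative (\<lambda>h. a * fst h + b * snd h)) (at q within U)"
    "(g has_derivative (\<lambda>h. c * fst h + d * snd h)) (at q within U)"
    unfolding holomorphic2_on_def by blast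
  from has_derivative_add[OF this]
  have "((\<lambda>q. f q + g q) has_derivative (\<lambda>h. (a + c) * fst h + (b + d) * snd h)) (at q within U)"
    by (rule has_derivative_eq_rhs) (simp add: algebra_simps)
  thus "\<exists>a b. ((\<lambda>q. f q + g q) has_derivative (\<lambda>h. a * fst h + b * snd h)) (at q within U)" by blast
qed

lemma holomorphic2_on_mult:
  assumes "holomorphic2_on f U" "holomorphic2_on g U"
  shows "holomorphic2_on (\<lambda>q. f q * g q) U"
  unfolding holomorphic2_on_def
proof
  fix q assume "q \<in> U"
  with assms obtain a b c d where
    "(f has_derivative (\<lambda>h. a * fst h + b * snd h)) (at q within U)"
    "(g has_derivative (\<lambda>h. c * fst h + d * snd h)) (at q within U)"
    unfolding holomorphic2_on_def by blast
  from has_derivative_mult[OF this]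
  have "((\<lambda>q. f q * g q) has_derivative (\<lambda>h. (f q * c + a * g q) * fst h + (f q * d + b * g q) * snd h)) (at q within U)"
    by (rule has_derivative_eq_rhs) (simp add: algebra_simps)
  thus "\<exists>a b. ((\<lambda>q. f q * g q) has_derivative (\<lambda>h. a * fst h + b * snd h)) (at q within U)" by blast
qed

lemma holomorphic2_on_inverse:
  assumes "holomorphic2_on f U" "\<And>q. q \<in> U \<Longrightarrow> f q \<noteq> 0"
  shows "holomorphic2_on (\<lambda>q. inverse (f q)) U"
  unfolding holomorphic2_on_def
proof
  fix q assume q: "q \<in> U"
  with assms obtain a b where
    "(f has_derivative (\<lambda>h. a * fst h + b * snd h)) (at q within U)"
    unfolding holomorphic2_on_def by blast
  from Deriv.has_derivative_inverse[OF assms(2)[OF q] this]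
  have "((\<lambda>q. inverse (f q)) has_derivative
      (\<lambda>h. (- (inverse (f q) * a * inverse (f q))) * fst h + (- (inverse (f q) * b * inverse (f q))) * snd h)) (at q within U)"
    by (rule has_derivative_eq_rhs) (simp add: algebra_simps)
  thus "\<exists>a b. ((\<lambda>q. inverse (f q)) has_derivative (\<lambda>h. a * fst h + b * snd h)) (at q within U)" by blast
qed

lemma holomorphic2_on_diff:
  assumes "holomorphic2_on f U" "holomorphic2_on g U"
  shows "holomorphic2_on (\<lambda>q. f q - g q) U"
  using holomorphic2_on_add[OF assms(1) holomorphic2_on_mult[OF holomorphic2_on_const[of "-1"] assms(2)]]
  by simp

lemma holomorphic2_on_power:
  assumes "holomorphic2_on f U" shows "holomorphic2_on (\<lambda>q. f q ^ n) U"
  by (induction n) (simp_all add: holomorphic2_on_const holomorphic2_on_mult assms)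

lemma holomorphic2_on_divide:
  assumes "holomorphic2_on f U" "holomorphic2_on g U" "\<And>q. q \<in> U \<Longrightarrow> g q \<noteq> 0"
  shows "holomorphic2_on (\<lambda>q. f q / g q) U"
  unfolding divide_inverse using assms by (intro holomorphic2_on_mult holomorphic2_on_inverse)

lemmas holomorphic2_intros = holomorphic2_on_const holomorphic2_on_fst holomorphic2_on_snd
  holomorphic2_on_add holomorphic2_on_diff holomorphic2_on_mult holomorphic2_on_power holomorphic2_on_divide

lemma holomorphic2_on_compose:
  assumes f: "holomorphic2_on f U" "open U" and g1: "holomorphic2_on g1 W" and g2: "holomorphic2_on g2 W"
    and W: "open W" and sub: "\<And>q. q \<in> W \<Longrightarrow> (g1 q, g2 q) \<in> U"
  shows "holomorphic2_on (\<lambda>q. f (g1 q, g2 q)) W"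
  unfolding holomorphic2_on_def
proof
  fix q assume q: "q \<in> W"
  obtain a b where fd: "(f has_derivative (\<lambda>h. a * fst h + b * snd h)) (at (g1 q, g2 q))"
    using holomorphic2_onD[OF f sub[OF q]] by blast
  obtain c d where g1d: "(g1 has_derivative (\<lambda>h. c * fst h + d * snd h)) (at q)"
    using holomorphic2_onD[OF g1 W q] by blast
  obtain c' d' where g2d: "(g2 has_derivative (\<lambda>h. c' * fst h + d' * snd h)) (at q)"
    using holomorphic2_onD[OF g2 W q] by blast
  from has_derivative_compose[OF has_derivative_Pair[OF g1d g2d] fd]
  have "((\<lambda>q. f (g1 q, g2 q)) has_derivative (\<lambda>h. (a * c + b * c') * fst h + (a * d + b * d') * snd h)) (at q)"
    by (rule has_derivative_eq_rhs) (simp add: algebra_simps)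
  thus "\<exists>a b. ((\<lambda>q. f (g1 q, g2 q)) has_derivative (\<lambda>h. a * fst h + b * snd h)) (at q within W)"
    unfolding at_within_open[OF q W] by blast
qed

lemma holomorphic2_on_imp_continuous_on: "holomorphic2_on f U \<Longrightarrow> continuous_on U f"
  unfolding holomorphic2_on_def continuous_on_eq_continuous_within
  by (blast intro: has_derivative_continuous)

lemma holomorphic2_on_slices:
  assumes f: "holomorphic2_on f (A \<times> B)" "open A" "open B"
  shows "y \<in> B \<Longrightarrow> (\<lambda>x. f (x, y)) holomorphic_on A"
    and "x \<in> A \<Longrightarrow> (\<lambda>y. f (x, y)) holomorphic_on B"
proof -
  have o: "open (A \<times> B)" using f by (intro open_Times)
  have 1: "(\<lambda>x. f (x, y)) field_differentiable (at x)" if xy: "x \<in> A" "y \<in> B" for x y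
  proof -
    obtain a b where fd: "(f has_derivative (\<lambda>h. a * fst h + b * snd h)) (at (x, y))"
      using holomorphic2_onD[OF f(1) o] xy by blast
    have "((\<lambda>x. (x, y)) has_derivative (\<lambda>h. (h, 0))) (at x)" by (auto intro!: derivative_eq_intros)
    from has_derivative_compose[OF this fd] show ?thesis
      by (auto simp: field_differentiable_def has_field_derivative_def)
  qed
  have 2: "(\<lambda>y. f (x, y)) field_differentiable (at y)" if xy: "x \<in> A" "y \<in> B" for x y
  proof -
    obtain a b where fd: "(f has_derivative (\<lambda>h. a * fst h + b * snd h)) (at (x, y))"
      using holomorphic2_onD[OF f(1) o] xy by blast
    have "((\<lambda>y. (x, y)) has_derivative (\<lambda>h. (0, h))) (at y)" by (auto intro!: derivative_eq_intros)
    from has_derivative_compose[OF this fd] show ?thesis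
      by (auto simp: field_differentiable_def has_field_derivative_def)
  qed
  show "y \<in> B \<Longrightarrow> (\<lambda>x. f (x, y)) holomorphic_on A"
    using 1 by (auto simp: holomorphic_on_def intro: field_differentiable_at_within)
  show "x \<in> A \<Longrightarrow> (\<lambda>y. f (x, y)) holomorphic_on B"
    using 2 by (auto simp: holomorphic_on_def intro: field_differentiable_at_within)
qed

section \<open>Regularity of the rational kernel\<close>

definition cnj2 :: "complex \<times> complex \<Rightarrow> complex \<times> complex" where
  "cnj2 = map_prod cnj cnj"

definition phi_jacobian :: "nat \<Rightarrow> complex \<times> complex \<Rightarrow> complex" where
  "phi_jacobian k = (\<lambda>(z1, z2). of_nat k * (z1 ^ k - z2 ^ k))"

lemma cnj2_simps [simp]: "cnj2 (a, b) = (cnj a, cnj b)" "cnj2 (cnj2 q) = q"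
  "cnj2 q \<in> bidisc \<longleftrightarrow> q \<in> bidisc" 
  "phi k (cnj2 q) = cnj2 (phi k q)"
  by (cases q; simp add: cnj2_def bidisc_def phi_def)+

text \<open>
  One of the two points may come from the closed bidisc. This is what makes the kernel bounded,
  and not just finite, in its first argument.
\<close>

lemma kernel_rational_denominators:
  assumes k: "0 < k" and u: "(s, p) \<in> phi k ` (cball 0 1 \<times> cball 0 1)" and v: "(s', p') \<in> dihedral_domain k"
  shows "1 - p * p' \<noteq> 0" "kernel_denominator k (s, p) (s', p') \<noteq> 0"
proof -
  obtain z1 z2 w1 w2 where z: "norm z1 \<le> 1" "norm z2 \<le> 1" "(s, p) = phi k (z1, z2)"
     and w: "norm w1 < 1" "norm w2 < 1" "(s', p') = phi k (w1, w2)"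
    using u v unfolding dihedral_domain_def bidisc_def by (auto simp del: cnj2_simps)
  have lt: "norm (a * b) < 1" if "norm a \<le> 1" "norm b < 1" for a b :: complex
    using that by (metis norm_mult mult_left_le_one_le norm_ge_zero le_less_trans)
  have pp: "p * p' = (z1 * z2 * w1) * w2" using z w by (simp add: phi_def)
  have "norm (z1 * z2 * w1) \<le> 1"
    using z w by (simp add: norm_mult mult_le_one less_imp_le)
  from lt[OF this w(2)] show "1 - p * p' \<noteq> 0" unfolding pp by auto
  have "1 - (a * b) ^ k \<noteq> 0" if "norm a \<le> 1" "norm b < 1" for a b :: complex
    using norm_power_lt_1[OF lt[OF that] k] by auto
  thus "kernel_denominator k (s, p) (s', p') \<noteq> 0"
    unfolding z w kernel_denominator_phi using z w by auto
qed

lemma dihedral_domain_subset: "dihedral_domain k \<subseteq> phi k ` (cball 0 1 \<times> cball 0 1)"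
  unfolding dihedral_domain_def bidisc_def by (intro image_mono Sigma_mono) auto

lemma kernel_rational_alt:
  "kernel_rational k u v =
     ((1 + snd u * snd v) * (1 - (snd u * snd v) ^ k) / ((1 - snd u * snd v) ^ 3 * kernel_denominator k u v)
       + of_nat k * ((1 + (snd u * snd v) ^ k) ^ 3
           - (1 + (snd u * snd v) ^ k) * (snd u ^ k * ((fst v)\<^sup>2 - 2 * snd v ^ k) + snd v ^ k * ((fst u)\<^sup>2 - 2 * snd u ^ k))
           - 4 * (snd u * snd v) ^ k * (2 * (1 + (snd u * snd v) ^ k) - fst u * fst v))
         / ((1 - snd u * snd v)\<^sup>2 * (kernel_denominator k u v)\<^sup>2)) / of_nat k"
  unfolding kernel_rational_def Let_def by (simp add: case_prod_beta)

lemma kernel_denominator_alt: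
  "kernel_denominator k u v = (1 + (snd u * snd v) ^ k)\<^sup>2 - (1 + (snd u * snd v) ^ k) * (fst u * fst v)
       + (snd u ^ k * ((fst v)\<^sup>2 - 2 * snd v ^ k) + snd v ^ k * ((fst u)\<^sup>2 - 2 * snd u ^ k))"
  unfolding kernel_denominator_def by (simp add: case_prod_beta)

lemma kernel_rational_symmetric: "kernel_rational k u v = kernel_rational k v u"
  unfolding kernel_rational_alt kernel_denominator_alt
  by (simp only: mult.commute[of "snd v" "snd u"] mult.commute[of "fst v" "fst u"]
      add.commute[of "snd v ^ k * ((fst u)\<^sup>2 - 2 * snd u ^ k)" "snd u ^ k * ((fst v)\<^sup>2 - 2 * snd v ^ k)"])

lemma cnj_kernel_ratio: "cnj (kernel_rational k u v) = kernel_rational k (cnj2 u) (cnj2 v)"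
  unfolding kernel_rational_alt kernel_denominator_alt by (cases u; cases v) simp

lemma holomorphic2_on_kernel_ratio:
  assumes k: "0 < k" and v: "v \<in> dihedral_domain k"
  shows "holomorphic2_on (\<lambda>u. kernel_rational k u v) (dihedral_domain k)"
proof -
  have nz: "1 - snd u * snd v \<noteq> 0" "kernel_denominator k u v \<noteq> 0" if "u \<in> dihedral_domain k" for u
    using kernel_rational_denominators[OF k, of "fst u" "snd u" "fst v" "snd v"] that v dihedral_domain_subset by auto
  have "holomorphic2_on (\<lambda>u. kernel_denominator k u v) (dihedral_domain k)"
    unfolding kernel_denominator_alt by (intro holomorphic2_intros)
  thus ?thesis
    unfolding kernel_rational_alt
    by (intro holomorphic2_intros) (use k nz in simp_all)
qed

text \<open>
  The rational kernel is continuous on a compact set that contains all the pairs in question.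
\<close>

lemma kernel_rational_bounded:
  fixes r :: real
  assumes k: "0 < k" and r: "r < 1"
  obtains C where "\<And>u (w :: complex \<times> complex). u \<in> dihedral_domain k \<Longrightarrow> w \<in> cball 0 r \<times> cball 0 r \<Longrightarrow> norm (kernel_rational k u (phi k w)) \<le> C"
proof -
  let ?B = "phi k ` (cball 0 1 \<times> cball 0 1)"
  let ?E = "?B \<times> phi k ` (cball 0 r \<times> cball 0 r)"
  have sub: "phi k ` (cball 0 r \<times> cball 0 r) \<subseteq> dihedral_domain k"
    unfolding dihedral_domain_def bidisc_def using r by (intro image_mono Sigma_mono) auto
  have comp: "compact ?E"
    by (intro compact_Times compact_continuous_image continuous_on_phi) auto
  have nz: "1 - snd (fst q) * snd (snd q) \<noteq> 0" "kernel_denominator k (fst q) (snd q) \<noteq> 0" if "q \<in> ?E" for q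
  proof -
    have "fst q \<in> ?B" "snd q \<in> dihedral_domain k" using that sub by auto
    thus "1 - snd (fst q) * snd (snd q) \<noteq> 0" "kernel_denominator k (fst q) (snd q) \<noteq> 0"
    using kernel_rational_denominators[OF k, of "fst (fst q)" "snd (fst q)" "fst (snd q)" "snd (snd q)"] by simp_all
  qed
  have "continuous_on ?E (\<lambda>q. kernel_denominator k (fst q) (snd q))"
    unfolding kernel_denominator_alt by (intro continuous_intros)
  hence "continuous_on ?E (\<lambda>q. kernel_rational k (fst q) (snd q))"
    unfolding kernel_rational_alt
    by (intro continuous_intros) (use k nz in simp_all)
  hence "bounded ((\<lambda>q. kernel_rational k (fst q) (snd q)) ` ?E)"
    using comp compact_continuous_image compact_imp_bounded by blast
  then obtain C where C: "\<And>q. q \<in> ?E \<Longrightarrow> norm (kernel_rational k (fst q) (snd q)) \<le> C"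
    unfolding bounded_iff by blast
  show ?thesis
  proof (rule that)
    fix u and w :: "complex \<times> complex" assume "u \<in> dihedral_domain k" "w \<in> cball 0 r \<times> cball 0 r"
    thus "norm (kernel_rational k u (phi k w)) \<le> C"
      using C[of "(u, phi k w)"] dihedral_domain_subset by auto
  qed
qed

section \<open>Change of variables under holomorphic maps of two variables\<close>

lemma det_4:
  "det (A::real^4^4) =
     A$1$1 * (A$2$2 * (A$3$3 * A$4$4 - A$3$4 * A$4$3) - A$2$3 * (A$3$2 * A$4$4 - A$3$4 * A$4$2) + A$2$4 * (A$3$2 * A$4$3 - A$3$3 * A$4$2))
   - A$1$2 * (A$2$1 * (A$3$3 * A$4$4 - A$3$4 * A$4$3) - A$2$3 * (A$3$1 * A$4$4 - A$3$4 * A$4$1) + A$2$4 * (A$3$1 * A$4$3 - A$3$3 * A$4$1))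
   + A$1$3 * (A$2$1 * (A$3$2 * A$4$4 - A$3$4 * A$4$2) - A$2$2 * (A$3$1 * A$4$4 - A$3$4 * A$4$1) + A$2$4 * (A$3$1 * A$4$2 - A$3$2 * A$4$1))
   - A$1$4 * (A$2$1 * (A$3$2 * A$4$3 - A$3$3 * A$4$2) - A$2$2 * (A$3$1 * A$4$3 - A$3$3 * A$4$1) + A$2$3 * (A$3$1 * A$4$2 - A$3$2 * A$4$1))"
proof -
  have f1234: "finite {2::4, 3, 4}" "1 \<notin> {2::4, 3, 4}" by auto
  have f234: "finite {3::4, 4}" "2 \<notin> {3::4, 4}" by auto
  have f34: "finite {4::4}" "3 \<notin> {4::4}" by auto
  show ?thesis
    unfolding det_def UNIV_4
    unfolding sum_over_permutations_insert[OF f1234]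
    unfolding sum_over_permutations_insert[OF f234]
    unfolding sum_over_permutations_insert[OF f34]
    unfolding permutes_sing
    by (simp add: sign_swap_id permutation_swap_id sign_compose sign_id swap_id_eq permutation_compose)
       (simp add: algebra_simps)
qed

text \<open>
  The change of variables theorem is about maps of real coordinate spaces. The coordinates of a
  pair of complex numbers are its four real and imaginary parts, in an order that keeps Lebesgue
  measure.
\<close>

definition to_vec4 :: "complex \<times> complex \<Rightarrow> real ^ 4" where
  "to_vec4 = (\<lambda>(a, b). \<chi> i. if i = 1 then Re a else if i = 2 then Im a else if i = 3 then Re b else Im b)"

definition of_vec4 :: "real ^ 4 \<Rightarrow> complex \<times> complex" where
  "of_vec4 v = (Complex (v $ 1) (v $ 2), Complex (v $ 3) (v $ 4))"

lemma to_vec4_nth [simp]: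
  "to_vec4 q $ 1 = Re (fst q)" "to_vec4 q $ 2 = Im (fst q)"
  "to_vec4 q $ 3 = Re (snd q)" "to_vec4 q $ 4 = Im (snd q)"
  by (simp_all add: to_vec4_def case_prod_beta)

lemma of_to_vec4 [simp]: "of_vec4 (to_vec4 q) = q"
  by (simp add: of_vec4_def)

lemma to_of_vec4 [simp]: "to_vec4 (of_vec4 v) = v"
  by (simp add: vec_eq_iff forall_4) (simp add: of_vec4_def)

lemma linear_to_vec4: "linear to_vec4"
  by (rule linearI) (simp_all add: vec_eq_iff forall_4)

lemma linear_of_vec4: "linear of_vec4"
  by (rule linearI) (simp_all add: of_vec4_def complex_eq_iff)

lemma bounded_linear_vec4: "bounded_linear to_vec4" "bounded_linear of_vec4"
  using linear_to_vec4 linear_of_vec4 linear_conv_bounded_linear by blast+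

lemma measurable_vec4 [measurable]:
  "to_vec4 \<in> borel_measurable borel" "of_vec4 \<in> borel_measurable borel"
  by (intro borel_measurable_continuous_onI linear_continuous_on bounded_linear_vec4)+

lemma prod_Basis_vec4: "(\<Prod>b\<in>(Basis :: (real^4) set). f b) = f (axis 1 1) * f (axis 2 1) * f (axis 3 1) * f (axis 4 1)"
proof -
  have B: "(Basis :: (real^4) set) = {axis 1 1, axis 2 1, axis 3 1, axis 4 1}"
    by (auto simp: Basis_vec_def UNIV_4)
  show ?thesis unfolding B by (simp add: axis_eq_axis mult.assoc)
qed

lemma Basis_complex_pair: "(Basis :: (complex \<times> complex) set) = {(1, 0), (\<i>, 0), (0, 1), (0, \<i>)}"
  by (auto simp: Basis_prod_def Basis_complex_def)

lemma prod_Basis_complex_pair: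
  "(\<Prod>b\<in>(Basis :: (complex \<times> complex) set). f b) = f (1, 0) * f (\<i>, 0) * f (0, 1) * f (0, \<i>)"
  unfolding Basis_complex_pair by (simp add: mult.assoc)

lemma lborel_eq_distr_to_vec4: "lborel = distr lborel borel to_vec4"
proof (rule lborel_eqI)
  fix l u :: "real ^ 4"
  assume le: "\<And>b. b \<in> Basis \<Longrightarrow> l \<bullet> b \<le> u \<bullet> b"
  have "axis i (1::real) \<in> Basis" for i :: 4 by (auto simp: Basis_vec_def)
  hence le': "l $ i \<le> u $ i" for i
    using le[of "axis i 1"] by (simp add: inner_axis)
  have "to_vec4 -` box l u = box (of_vec4 l) (of_vec4 u)"
    unfolding set_eq_iff vimage_eq mem_box_cart forall_4 unfolding mem_box Basis_complex_pair
    by (auto simp: of_vec4_def)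
  hence "emeasure (distr lborel borel to_vec4) (box l u) = emeasure lborel (box (of_vec4 l) (of_vec4 u))"
    by (simp add: emeasure_distr)
  also have "\<dots> = (\<Prod>b\<in>Basis. (of_vec4 u - of_vec4 l) \<bullet> b)"
    using le' by (subst emeasure_lborel_box) (auto simp: Basis_complex_pair of_vec4_def)
  also have "(\<Prod>b\<in>Basis. (of_vec4 u - of_vec4 l) \<bullet> b) = (\<Prod>b\<in>Basis. (u - l) \<bullet> b)"
    unfolding prod_Basis_vec4 prod_Basis_complex_pair by (simp add: of_vec4_def inner_axis)
  finally show "emeasure (distr lborel borel to_vec4) (box l u) = (\<Prod>b\<in>Basis. (u - l) \<bullet> b)" .
qed simp

lemma det_complex_linear_vec4:
  "det (matrix (to_vec4 \<circ> (\<lambda>h. (a * fst h + b * snd h, c * fst h + d * snd h)) \<circ> of_vec4))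
     = (cmod (a * d - b * c))\<^sup>2"
proof -
  have ax: "of_vec4 (axis 1 1) = (1, 0)" "of_vec4 (axis 2 1) = (\<i>, 0)"
    "of_vec4 (axis 3 1) = (0, 1)" "of_vec4 (axis 4 1) = (0, \<i>)"
    by (simp_all add: of_vec4_def axis_def complex_eq_iff)
  show ?thesis
    unfolding det_4 matrix_def cmod_power2
    by (simp add: ax) (simp add: algebra_simps power2_eq_square)
qed

text \<open>
  The real change of variables theorem, transported along the coordinates, where the absolute
  value of the real determinant is the squared modulus of the complex one. The image being
  bounded, its measure is finite, and this is what makes the integral of the determinant exist.
\<close>

theorem nn_integral_holomorphic_image:
  fixes g :: "complex \<times> complex \<Rightarrow> complex \<times> complex"
  assumes S: "S \<in> sets borel" and gS: "g ` S \<in> sets borel" "bounded (g ` S)" and inj: "inj_on g S"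
    and der: "\<And>z. z \<in> S \<Longrightarrow>
       (g has_derivative (\<lambda>h. (a z * fst h + b z * snd h, c z * fst h + d z * snd h))) (at z)"
    and meas: "(\<lambda>z. a z * d z - b z * c z) \<in> borel_measurable borel"
  shows "(\<integral>\<^sup>+z\<in>S. ennreal ((cmod (a z * d z - b z * c z))\<^sup>2) \<partial>lborel) = emeasure lborel (g ` S)"
proof -
  note meas[measurable] S[measurable]
  let ?f = "to_vec4 \<circ> g \<circ> of_vec4"
  let ?A = "\<lambda>v. to_vec4 \<circ> (\<lambda>h. (a (of_vec4 v) * fst h + b (of_vec4 v) * snd h, c (of_vec4 v) * fst h + d (of_vec4 v) * snd h)) \<circ> of_vec4"
  have img: "to_vec4 ` X = of_vec4 -` X" for X
    by (auto simp: image_iff) (metis to_of_vec4)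
  have pre: "to_vec4 -` (of_vec4 -` X) = X" for X by auto
  have Bm: "of_vec4 -` X \<in> sets borel" if "X \<in> sets borel" for X
    using measurable_sets_borel[OF measurable_vec4(2) that] by simp
  have em: "emeasure lborel (of_vec4 -` X) = emeasure lborel X" if "X \<in> sets borel" for X
    by (subst lborel_eq_distr_to_vec4) (use that Bm[OF that] in \<open>simp add: emeasure_distr pre\<close>)
  let ?S = "of_vec4 -` S"
  have fS: "?f ` ?S = of_vec4 -` (g ` S)"
    unfolding img[symmetric] by (simp add: image_comp)
  have "bounded (of_vec4 -` (g ` S))"
    unfolding img[symmetric] using gS(2) bounded_linear_vec4(1) by (rule bounded_linear_image)
  hence lm: "of_vec4 -` (g ` S) \<in> lmeasurable"
    using Bm[OF gS(1)] by (intro bounded_set_imp_lmeasurable) auto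
  have "(?f has_derivative ?A v) (at v within ?S)" if "v \<in> ?S" for v
  proof -
    have g: "(g has_derivative (\<lambda>h. (a (of_vec4 v) * fst h + b (of_vec4 v) * snd h, c (of_vec4 v) * fst h + d (of_vec4 v) * snd h))) (at (of_vec4 v))"
      using der that by simp
    have "(?f has_derivative ?A v) (at v)"
      by (intro diff_chain_at bounded_linear_imp_has_derivative bounded_linear_vec4 g)
    thus ?thesis by (rule has_derivative_at_withinI)
  qed
  moreover have "inj_on ?f ?S"
  proof (rule inj_onI)
    fix x y assume "x \<in> ?S" "y \<in> ?S" "?f x = ?f y"
    hence "g (of_vec4 x) = g (of_vec4 y)" by (metis comp_apply of_to_vec4)
    with \<open>x \<in> ?S\<close> \<open>y \<in> ?S\<close> inj have "of_vec4 x = of_vec4 y" by (auto dest: inj_onD)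
    thus "x = y" by (metis to_of_vec4)
  qed
  ultimately have "((\<lambda>v. \<bar>det (matrix (?A v))\<bar>) has_integral measure lebesgue (?f ` ?S)) ?S"
    using has_measure_differentiable_image[of ?S ?f ?A "measure lebesgue (?f ` ?S)"] Bm[OF S] lm fS
    by simp
  hence "(\<integral>\<^sup>+v. ennreal \<bar>det (matrix (?A v))\<bar> * indicator ?S v \<partial>lborel) = measure lebesgue (?f ` ?S)"
    by (intro nn_integral_has_integral_lebesgue') auto
  also have "\<dots> = emeasure lebesgue (of_vec4 -` (g ` S))"
    using lm unfolding fS by (simp add: emeasure_eq_measure2)
  also have "\<dots> = emeasure lborel (g ` S)"
    using em[OF gS(1)] Bm[OF gS(1)] by simp
  also have "(\<integral>\<^sup>+v. ennreal \<bar>det (matrix (?A v))\<bar> * indicator ?S v \<partial>lborel)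
     = (\<integral>\<^sup>+v. ennreal ((cmod (a (of_vec4 v) * d (of_vec4 v) - b (of_vec4 v) * c (of_vec4 v)))\<^sup>2) * indicator S (of_vec4 v) \<partial>lborel)"
    unfolding det_complex_linear_vec4 by (intro nn_integral_cong) (simp add: indicator_def)
  also have "\<dots> = (\<integral>\<^sup>+z\<in>S. ennreal ((cmod (a z * d z - b z * c z))\<^sup>2) \<partial>lborel)"
    by (subst lborel_eq_distr_to_vec4, subst nn_integral_distr) simp_all
  finally show ?thesis .
qed

lemma emeasure_lborel_Times:
  fixes A :: "'a::euclidean_space set" and B :: "'b::euclidean_space set"
  assumes "A \<in> sets borel" "B \<in> sets borel"
  shows "emeasure lborel (A \<times> B) = emeasure lborel A * emeasure lborel B"
  unfolding lborel_prod[symmetric] using assms by (intro lborel.emeasure_pair_measure_Times) auto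

lemma emeasure_disc: "emeasure lborel (ball (0::complex) r) = ennreal (pi * r\<^sup>2)" if "r \<ge> 0"
  using emeasure_ball[of r "0::complex"] that by (simp add: unit_ball_vol_2 eval_unit_ball_vol)

text \<open>
  Apply the change of variables to (z1, z2) |-> (c z1, z2) on the product of a box with the unit
  disc, and cancel the area of the disc.
\<close>

lemma lborel_rotation_invariant:
  fixes c :: complex
  assumes c: "cmod c = 1"
  shows "distr lborel borel ((*) c) = lborel"
proof (rule lborel_eqI[symmetric])
  fix l u :: complex
  assume le: "\<And>b. b \<in> Basis \<Longrightarrow> l \<bullet> b \<le> u \<bullet> b"
  let ?X = "box l u" and ?B = "ball 0 1 :: complex set"
  define A where "A = (*) c -` ?X"
  have c0: "c \<noteq> 0" using c by auto
  have "x \<in> (*) c ` A" if "x \<in> ?X" for x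
    using c0 that unfolding A_def by (intro image_eqI[of _ _ "x / c"]) auto
  hence imA: "(*) c ` A = ?X" unfolding A_def by blast
  have mA [measurable]: "A \<in> sets borel"
    unfolding A_def using measurable_sets_borel[of "(*) c" borel ?X] by simp
  let ?g = "\<lambda>q. (c * fst q, snd q)"
  have im: "?g ` (A \<times> ?B) = ?X \<times> ?B"
    unfolding imA[symmetric] by (auto simp: image_iff)
  have AB: "A \<times> ?B \<in> sets borel" "?X \<times> ?B \<in> sets borel"
    unfolding borel_prod[symmetric] by auto
  have "(\<integral>\<^sup>+z\<in>A \<times> ?B. ennreal ((cmod (c * 1 - 0 * 0))\<^sup>2) \<partial>lborel) = emeasure lborel (?g ` (A \<times> ?B))"
  proof (rule nn_integral_holomorphic_image)
    show "A \<times> ?B \<in> sets borel" "?g ` (A \<times> ?B) \<in> sets borel"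
      unfolding im using AB by auto
    show "bounded (?g ` (A \<times> ?B))" unfolding im by (intro bounded_Times) auto
    show "inj_on ?g (A \<times> ?B)" using c0 by (auto simp: inj_on_def)
    have "(?g has_derivative ?g) (at z)" for z
      by (intro bounded_linear_imp_has_derivative bounded_linear_Pair bounded_linear_const_mult
          bounded_linear_fst bounded_linear_snd)
    thus "(?g has_derivative (\<lambda>h. (c * fst h + 0 * snd h, 0 * fst h + 1 * snd h))) (at z)" for z
      by simp
  qed auto
  hence "emeasure lborel A * emeasure lborel ?B = emeasure lborel ?X * emeasure lborel ?B"
    using c AB unfolding im by (simp add: emeasure_lborel_Times)
  moreover have "emeasure lborel ?B = ennreal pi" using emeasure_disc[of 1] by simp
  ultimately have "emeasure lborel A = emeasure lborel ?X"
    by (metis ennreal_mult_cancel_left mult.commute ennreal_neq_top ennreal_eq_0_iff not_le pi_gt_zero)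
  hence "emeasure (distr lborel borel ((*) c)) ?X = emeasure lborel ?X"
    by (simp add: emeasure_distr A_def)
  also have "\<dots> = (\<Prod>b\<in>Basis. (u - l) \<bullet> b)"
    using le by (rule emeasure_lborel_box)
  finally show "emeasure (distr lborel borel ((*) c)) ?X = (\<Prod>b\<in>Basis. (u - l) \<bullet> b)" .
qed simp

section \<open>The Bergman projection of the disc and the bidisc\<close>

lemma bidisc_borel [measurable]: "bidisc \<in> sets borel"
  using open_bidisc by (rule borel_open)

lemma ball_borel [measurable]: "ball (x::'a::metric_space) r \<in> sets borel"
  by (rule borel_open) (rule open_ball)

lemma set_integrable_bounded:
  fixes f :: "'a::euclidean_space \<Rightarrow> 'b::{banach, second_countable_topology}"
  assumes A: "A \<in> sets borel" "bounded A" and f: "set_borel_measurable borel A f"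
    and C: "\<And>x. x \<in> A \<Longrightarrow> norm (f x) \<le> C"
  shows "set_integrable lborel A f"
proof (rule set_integrable_bound[of _ _ "\<lambda>_. C"])
  have "emeasure lborel A < \<infinity>" using emeasure_bounded_finite[OF A(2)] by (simp add: top.not_eq_extremum)
  thus "set_integrable lborel A (\<lambda>_. C)"
    unfolding set_integrable_def using A by (intro integrable_scaleR_left) auto
  show "set_borel_measurable lborel A f" using f by (simp add: set_borel_measurable_def)
  show "AE x in lborel. x \<in> A \<longrightarrow> norm (f x) \<le> norm C"
  proof (rule AE_I2, rule impI)
    fix x assume "x \<in> A"
    from C[OF this] show "norm (f x) \<le> norm C" by simp
  qed
qed

lemma set_borel_measurable_continuous_on:
  fixes f :: "'a::topological_space \<Rightarrow> 'b::real_normed_vector"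
  assumes "A \<in> sets borel" "continuous_on A f"
  shows "set_borel_measurable borel A f"
  unfolding set_borel_measurable_def using assms by (rule borel_measurable_continuous_on_indicator)

lemma disc_moment_integrable:
  "set_integrable lborel (ball 0 \<rho>) (\<lambda>z::complex. z ^ n * cnj z ^ m)"
proof (rule set_integrable_bounded[where C = "\<bar>\<rho>\<bar> ^ n * \<bar>\<rho>\<bar> ^ m"])
  show "set_borel_measurable borel (ball 0 \<rho>) (\<lambda>z::complex. z ^ n * cnj z ^ m)"
    by (intro set_borel_measurable_continuous_on continuous_intros) auto
  show "norm (z ^ n * cnj z ^ m) \<le> \<bar>\<rho>\<bar> ^ n * \<bar>\<rho>\<bar> ^ m" if "z \<in> ball 0 \<rho>" for z :: complex
    unfolding norm_mult norm_power complex_mod_cnj using that by (intro mult_mono power_mono) auto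
qed auto

text \<open>
  A rotation by an angle t multiplies the integral by exp (i (n - m) t), which is -1 for a
  suitable t.
\<close>

lemma disc_moment_off_diagonal:
  assumes "n \<noteq> m"
  shows "(LINT z:ball 0 \<rho>|lborel. z ^ n * cnj z ^ m) = 0"
proof -
  define t where "t = pi / (real n - real m)"
  define c where "c = cis t"
  have c: "cmod c = 1" by (simp add: c_def)
  have "(real n - real m) * t = pi" using assms by (simp add: t_def)
  hence nm: "real n * t - real m * t = pi" by (simp only: left_diff_distrib)
  hence cc: "c ^ n * cnj c ^ m = -1"
    unfolding c_def cis_cnj Complex.DeMoivre cis_mult using nm by simp
  let ?f = "\<lambda>z::complex. indicator (ball 0 \<rho>) z *\<^sub>R (z ^ n * cnj z ^ m)"
  have meas: "?f \<in> borel_measurable borel"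
    by (intro borel_measurable_continuous_on_indicator continuous_intros) auto
  have "integral\<^sup>L lborel ?f = integral\<^sup>L (distr lborel borel ((*) c)) ?f"
    by (simp add: lborel_rotation_invariant[OF c])
  also have "\<dots> = integral\<^sup>L lborel (\<lambda>z. ?f (c * z))"
    using meas by (intro integral_distr) auto
  also have "(\<lambda>z. ?f (c * z)) = (\<lambda>z. (c ^ n * cnj c ^ m) * ?f z)"
    using c by (auto simp: fun_eq_iff indicator_def norm_mult power_mult_distrib)
  also have "integral\<^sup>L lborel (\<lambda>z. (c ^ n * cnj c ^ m) * ?f z) = - integral\<^sup>L lborel ?f"
    unfolding cc by simp
  finally show ?thesis by (simp add: set_lebesgue_integral_def)
qed

text \<open>
  The area of a disc is proportional to the square of its radius. So the squared modulus of a
  uniformly distributed point is uniformly distributed, which replaces polar coordinates.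
\<close>

lemma distr_norm_square_disc:
  assumes "0 \<le> \<rho>"
  shows "distr (density lborel (\<lambda>z::complex. ennreal (indicator (ball 0 \<rho>) z))) borel (\<lambda>z. (cmod z)\<^sup>2)
       = density lborel (\<lambda>t. ennreal (pi * indicator {0..\<rho>\<^sup>2} t))" (is "?M = ?N")
proof (rule measure_eqI_lessThan)
  fix x :: real
  have [measurable]: "{z::complex. (cmod z)\<^sup>2 > x} \<in> sets borel" by measurable
  have M: "emeasure ?M {x<..} = emeasure lborel (ball 0 \<rho> \<inter> {z::complex. (cmod z)\<^sup>2 > x})"
  proof -
    have "emeasure ?M {x<..} = emeasure (density lborel (\<lambda>z::complex. ennreal (indicator (ball 0 \<rho>) z))) {z. (cmod z)\<^sup>2 > x}"
      by (subst emeasure_distr) (auto simp: vimage_def)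
    also have "\<dots> = (\<integral>\<^sup>+z. ennreal (indicator (ball 0 \<rho>) z) * indicator {z::complex. (cmod z)\<^sup>2 > x} z \<partial>lborel)"
      by (rule emeasure_density) simp_all
    also have "\<dots> = (\<integral>\<^sup>+z. indicator (ball 0 \<rho> \<inter> {z::complex. (cmod z)\<^sup>2 > x}) z \<partial>lborel)"
      by (intro nn_integral_cong) (auto simp: indicator_def)
    finally show ?thesis by simp
  qed
  have "emeasure lborel (ball 0 \<rho> \<inter> {z::complex. (cmod z)\<^sup>2 > x}) \<le> emeasure lborel (ball (0::complex) \<rho>)"
    by (rule emeasure_mono) auto
  also have "\<dots> < \<infinity>" using emeasure_disc[OF assms] by simp
  finally show "emeasure ?M {x<..} < \<infinity>" unfolding M .
  have N: "emeasure ?N {x<..} = ennreal pi * emeasure lborel ({0..\<rho>\<^sup>2} \<inter> {x<..})"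
  proof -
    have "emeasure ?N {x<..} = (\<integral>\<^sup>+t. ennreal pi * indicator ({0..\<rho>\<^sup>2} \<inter> {x<..}) t \<partial>lborel)"
      by (subst emeasure_density) (auto intro!: nn_integral_cong simp: indicator_def)
    thus ?thesis by (simp add: nn_integral_cmult)
  qed
  consider "x < 0" | "0 \<le> x" "x < \<rho>\<^sup>2" | "\<rho>\<^sup>2 \<le> x" by linarith
  thus "emeasure ?M {x<..} = emeasure ?N {x<..}"
  proof cases
    case 1
    hence "ball 0 \<rho> \<inter> {z::complex. (cmod z)\<^sup>2 > x} = ball 0 \<rho>"
      by (auto intro: less_le_trans)
    moreover have "{0..\<rho>\<^sup>2} \<inter> {x<..} = {0..\<rho>\<^sup>2}" using 1 by auto
    ultimately show ?thesis unfolding M N using emeasure_disc[OF assms] by (simp flip: ennreal_mult)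
  next
    case 2
    have sq: "cmod z \<le> sqrt x \<longleftrightarrow> (cmod z)\<^sup>2 \<le> x" for z
      using 2 by (metis real_sqrt_le_iff real_sqrt_abs abs_norm_cancel)
    have "ball 0 \<rho> \<inter> {z::complex. (cmod z)\<^sup>2 > x} = ball 0 \<rho> - cball 0 (sqrt x)"
      using sq by (auto simp: not_le)
    moreover have "cball 0 (sqrt x) \<subseteq> ball (0::complex) \<rho>"
    proof
      fix z :: complex assume "z \<in> cball 0 (sqrt x)"
      hence "(cmod z)\<^sup>2 < \<rho>\<^sup>2" using sq 2 by (auto intro: le_less_trans)
      thus "z \<in> ball 0 \<rho>" using assms by (simp add: power_less_imp_less_base)
    qed
    moreover have "emeasure lborel (cball (0::complex) (sqrt x)) = ennreal (pi * x)"
      using emeasure_cball[of "sqrt x" "0::complex"] 2 by (simp add: unit_ball_vol_2 eval_unit_ball_vol)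
    ultimately have "emeasure ?M {x<..} = ennreal (pi * \<rho>\<^sup>2) - ennreal (pi * x)"
      unfolding M using emeasure_disc[OF assms] by (simp add: emeasure_Diff)
    also have "\<dots> = ennreal (pi * (\<rho>\<^sup>2 - x))"
      using 2 by (simp add: ennreal_minus algebra_simps)
    also have "{0..\<rho>\<^sup>2} \<inter> {x<..} = {x<..\<rho>\<^sup>2}" using 2 by auto
    hence "ennreal (pi * (\<rho>\<^sup>2 - x)) = emeasure ?N {x<..}" unfolding N using 2 by (simp flip: ennreal_mult)
    finally show ?thesis .
  next
    case 3
    have "\<not> (cmod z)\<^sup>2 > x" if "z \<in> ball 0 \<rho>" for z
      using power_strict_mono[of "cmod z" \<rho> 2] that 3 by simp
    hence "ball 0 \<rho> \<inter> {z::complex. (cmod z)\<^sup>2 > x} = {}" by blast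
    moreover have "{0..\<rho>\<^sup>2} \<inter> {x<..} = {}" using 3 by auto
    ultimately show ?thesis unfolding M N by simp
  qed
qed auto

lemma disc_moment_diagonal:
  assumes "0 \<le> \<rho>"
  shows "(LINT z:ball 0 \<rho>|lborel. z ^ n * cnj z ^ n) = of_real (pi * (\<rho>\<^sup>2) ^ Suc n / real (Suc n))"
proof -
  have "(LINT z:ball 0 \<rho>|lborel. z ^ n * cnj z ^ n)
      = (LINT z|lborel. complex_of_real (indicator (ball 0 \<rho>) z * ((cmod z)\<^sup>2) ^ n))"
    unfolding set_lebesgue_integral_def
    by (intro Bochner_Integration.integral_cong refl)
       (simp add: scaleR_conv_of_real complex_norm_square[unfolded of_real_power] flip: power_mult_distrib)
  also have "\<dots> = complex_of_real (LINT z|lborel. indicator (ball 0 \<rho>) (z::complex) *\<^sub>R ((cmod z)\<^sup>2) ^ n)"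
    unfolding real_scaleR_def by (rule integral_complex_of_real)
  also have "(LINT z|lborel. indicator (ball 0 \<rho>) (z::complex) *\<^sub>R ((cmod z)\<^sup>2) ^ n)
      = integral\<^sup>L (density lborel (\<lambda>z::complex. ennreal (indicator (ball 0 \<rho>) z))) (\<lambda>z. ((cmod z)\<^sup>2) ^ n)"
    by (rule integral_density[symmetric]) auto
  also have "\<dots> = integral\<^sup>L (density lborel (\<lambda>t. ennreal (pi * indicator {0..\<rho>\<^sup>2} t))) (\<lambda>t. t ^ n)"
    unfolding distr_norm_square_disc[OF assms, symmetric] by (rule integral_distr[symmetric]) auto
  also have "\<dots> = (LINT t|lborel. (pi * indicator {0..\<rho>\<^sup>2} t) *\<^sub>R t ^ n)"
    by (rule integral_density) auto
  also have "\<dots> = pi * (LINT t|lborel. t ^ n * indicator {0..\<rho>\<^sup>2} t)"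
    by (simp add: mult_ac)
  also have "\<dots> = pi * (\<rho>\<^sup>2) ^ Suc n / real (Suc n)"
    by (simp add: integral_power)
  finally show ?thesis .
qed

text \<open>
  On a smaller disc, both the power series of h and the series of the kernel in powers of w cnj
  z converge uniformly. Integrating term by term, orthogonality of the monomials leaves one term
  of h for each term of the kernel, whose factor m + 1 cancels against the moment.
\<close>

lemma small_disc_reproducing:
  assumes h: "h holomorphic_on ball 0 1" and \<rho>: "0 < \<rho>" "\<rho> < 1" and w: "norm w < 1"
  shows "(LINT z:ball 0 \<rho>|lborel. h z / (1 - w * cnj z)\<^sup>2) = of_real (pi * \<rho>\<^sup>2) * h (of_real (\<rho>\<^sup>2) * w)"
proof -
  define a where "a n = (deriv ^^ n) h 0 / fact n" for n
  have a: "(\<lambda>n. a n * z ^ n) sums h z" if "z \<in> ball 0 1" for z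
    using holomorphic_power_series[OF h that] by (simp add: a_def)
  have suma: "summable (\<lambda>n. norm (a n) * \<rho> ^ n)"
  proof -
    (* The series converges at a point of larger modulus, hence absolutely at \<rho>. *)
    define r :: real where "r = (1 + \<rho>) / 2"
    have r: "0 < r" "r < 1" "\<rho> < r" using \<rho> by (auto simp: r_def)
    have "summable (\<lambda>n. a n * of_real r ^ n)"
      using a[of "of_real r"] r by (auto dest: sums_summable)
    hence "summable (\<lambda>n. norm (a n * of_real \<rho> ^ n))"
      by (rule powser_insidea) (use \<rho> r in simp)
    thus ?thesis using \<rho> by (simp add: norm_mult norm_power)
  qed
  have area: "emeasure lborel (ball (0::complex) \<rho>) = ennreal (pi * \<rho>\<^sup>2)"
    using emeasure_disc[of \<rho>] \<rho> by simp
  hence fin: "set_integrable lborel (ball (0::complex) \<rho>) (\<lambda>_. C)" for C :: real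
    unfolding set_integrable_def by (intro integrable_scaleR_left) (simp_all add: integrable_indicator_iff)
  have area': "(LINT z|lborel. indicator (ball (0::complex) \<rho>) z *\<^sub>R C) = pi * \<rho>\<^sup>2 * C" for C :: real
    by (simp add: measure_def area)
  (* Pairing h with a single power of cnj z picks out one Taylor coefficient. *)
  have coeff: "(LINT z:ball 0 \<rho>|lborel. h z * cnj z ^ m) = a m * of_real (pi * (\<rho>\<^sup>2) ^ Suc m / real (Suc m))"
    and intm: "set_integrable lborel (ball 0 \<rho>) (\<lambda>z. h z * cnj z ^ m)" for m
  proof -
    let ?f = "\<lambda>n z. indicator (ball 0 \<rho>) z *\<^sub>R (a n * (z ^ n * cnj z ^ m))"
    have int: "integrable lborel (?f n)" for n
      using set_integrable_mult_right[OF disc_moment_integrable[of \<rho> n m], of "a n"]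
      unfolding set_integrable_def by simp
    have bd: "norm (?f n z) \<le> indicator (ball 0 \<rho>) z *\<^sub>R (norm (a n) * \<rho> ^ n)" for n z
    proof (cases "z \<in> ball 0 \<rho>")
      case True
      have "norm z ^ n * norm z ^ m \<le> \<rho> ^ n * 1"
        using True \<rho> by (intro mult_mono power_mono power_le_one) auto
      thus ?thesis using True by (simp add: norm_mult norm_power mult_left_mono)
    qed simp
    have s1: "summable (\<lambda>n. norm (?f n z))" for z
    proof (rule summable_comparison_test'[OF suma])
      show "norm (norm (?f n z)) \<le> norm (a n) * \<rho> ^ n" for n
        using order_trans[OF bd[of z n], of "norm (a n) * \<rho> ^ n"] \<rho> by (simp add: indicator_def split: if_splits)
    qed
    have s2: "summable (\<lambda>n. LINT z|lborel. norm (?f n z))"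
    proof (rule summable_comparison_test'[OF summable_mult[OF suma, of "pi * \<rho>\<^sup>2"]])
      fix n
      have "(LINT z|lborel. norm (?f n z)) \<le> (LINT z|lborel. indicator (ball (0::complex) \<rho>) z *\<^sub>R (norm (a n) * \<rho> ^ n))"
        using int fin[of "norm (a n) * \<rho> ^ n"] bd unfolding set_integrable_def
        by (intro integral_mono integrable_norm) auto
      also have "\<dots> = pi * \<rho>\<^sup>2 * (norm (a n) * \<rho> ^ n)" by (rule area')
      finally show "norm (LINT z|lborel. norm (?f n z)) \<le> pi * \<rho>\<^sup>2 * (norm (a n) * \<rho> ^ n)"
        by simp
    qed
    have sum_f: "(\<Sum>n. ?f n z) = indicator (ball 0 \<rho>) z *\<^sub>R (h z * cnj z ^ m)" for z
    proof (cases "z \<in> ball 0 \<rho>")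
      case True
      hence "(\<lambda>n. a n * z ^ n * cnj z ^ m) sums (h z * cnj z ^ m)"
        using \<rho> by (intro sums_mult2 a) auto
      thus ?thesis using True by (simp add: sums_iff mult.assoc)
    qed simp
    show "set_integrable lborel (ball 0 \<rho>) (\<lambda>z. h z * cnj z ^ m)"
      using integrable_suminf[OF int AE_I2[OF s1] s2] unfolding sum_f set_integrable_def .
    have "(\<lambda>n. integral\<^sup>L lborel (?f n)) sums (LINT z|lborel. (\<Sum>n. ?f n z))"
      by (rule sums_integral[OF int AE_I2[OF s1] s2])
    hence 1: "(\<lambda>n. integral\<^sup>L lborel (?f n)) sums (LINT z:ball 0 \<rho>|lborel. h z * cnj z ^ m)"
      unfolding sum_f set_lebesgue_integral_def .
    have "integral\<^sup>L lborel (?f n) = a n * (LINT z:ball 0 \<rho>|lborel. z ^ n * cnj z ^ m)" for n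
      by (subst set_integral_mult_right[symmetric]) (simp only: set_lebesgue_integral_def)
    hence "(\<lambda>n. integral\<^sup>L lborel (?f n)) =
        (\<lambda>n. if n = m then a n * of_real (pi * (\<rho>\<^sup>2) ^ Suc n / real (Suc n)) else 0)"
      using disc_moment_diagonal[of \<rho>] disc_moment_off_diagonal[of _ m \<rho>] \<rho> by (auto simp: fun_eq_iff)
    hence "(\<lambda>n. integral\<^sup>L lborel (?f n)) sums (a m * of_real (pi * (\<rho>\<^sup>2) ^ Suc m / real (Suc m)))"
      using sums_single[of m "\<lambda>n. a n * of_real (pi * (\<rho>\<^sup>2) ^ Suc n / real (Suc n))"] by simp
    with 1 show "(LINT z:ball 0 \<rho>|lborel. h z * cnj z ^ m) = a m * of_real (pi * (\<rho>\<^sup>2) ^ Suc m / real (Suc m))"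
      by (rule sums_unique2)
  qed
  have "continuous_on (cball 0 \<rho>) h"
    using holomorphic_on_imp_continuous_on[OF h] by (rule continuous_on_subset) (use \<rho> in auto)
  hence "bounded (h ` cball 0 \<rho>)"
    by (intro compact_imp_bounded compact_continuous_image) auto
  then obtain H where H: "\<And>z. z \<in> cball 0 \<rho> \<Longrightarrow> norm (h z) \<le> H"
    unfolding bounded_iff by blast
  have H0: "0 \<le> H" using order_trans[OF norm_ge_zero H[of 0]] \<rho> by simp
  let ?f = "\<lambda>m z. indicator (ball 0 \<rho>) z *\<^sub>R (of_nat (Suc m) * w ^ m * (h z * cnj z ^ m))"
  have int: "integrable lborel (?f m)" for m
    using set_integrable_mult_right[OF intm[of m], of "of_nat (Suc m) * w ^ m"]
    unfolding set_integrable_def by simp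
  have sumw: "summable (\<lambda>m. H * (real (Suc m) * norm w ^ m))"
    using geometric_deriv_sums[of "norm w"] w by (intro summable_mult) (auto simp: sums_iff)
  have bd: "norm (?f m z) \<le> indicator (ball 0 \<rho>) z *\<^sub>R (H * (real (Suc m) * norm w ^ m))" for m z
  proof (cases "z \<in> ball 0 \<rho>")
    case True
    have "norm (h z) * norm z ^ m \<le> H * 1"
      using True \<rho> H[of z] H0 by (intro mult_mono power_le_one) auto
    hence "real (Suc m) * norm w ^ m * (norm (h z) * norm z ^ m) \<le> real (Suc m) * norm w ^ m * H"
      by (intro mult_left_mono) auto
    thus ?thesis using True by (simp add: norm_mult norm_power mult_ac del: of_nat_Suc)
  qed simp
  have s1: "summable (\<lambda>m. norm (?f m z))" for z
  proof (rule summable_comparison_test'[OF sumw])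
    show "norm (norm (?f m z)) \<le> H * (real (Suc m) * norm w ^ m)" for m
      using order_trans[OF bd[of z m], of "H * (real (Suc m) * norm w ^ m)"] H0
      by (simp add: indicator_def split: if_splits)
  qed
  have s2: "summable (\<lambda>m. LINT z|lborel. norm (?f m z))"
  proof (rule summable_comparison_test'[OF summable_mult[OF sumw, of "pi * \<rho>\<^sup>2"]])
    fix m
    have "(LINT z|lborel. norm (?f m z)) \<le> (LINT z|lborel. indicator (ball (0::complex) \<rho>) z *\<^sub>R (H * (real (Suc m) * norm w ^ m)))"
      using int fin[of "H * (real (Suc m) * norm w ^ m)"] bd unfolding set_integrable_def
      by (intro integral_mono integrable_norm) auto
    also have "\<dots> = pi * \<rho>\<^sup>2 * (H * (real (Suc m) * norm w ^ m))" by (rule area')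
    finally show "norm (LINT z|lborel. norm (?f m z)) \<le> pi * \<rho>\<^sup>2 * (H * (real (Suc m) * norm w ^ m))"
      by simp
  qed
  have sum_f: "(\<Sum>m. ?f m z) = indicator (ball 0 \<rho>) z *\<^sub>R (h z / (1 - w * cnj z)\<^sup>2)" for z
  proof (cases "z \<in> ball 0 \<rho>")
    case True
    have "norm (w * cnj z) < 1" using True \<rho> w by (intro norm_mult_less_1) auto
    from sums_mult[OF geometric_deriv_sums[OF this], of "h z"] True
    show ?thesis by (simp add: sums_iff power_mult_distrib mult_ac)
  qed simp
  have "(\<lambda>m. integral\<^sup>L lborel (?f m)) sums (LINT z|lborel. (\<Sum>m. ?f m z))"
    by (rule sums_integral[OF int AE_I2[OF s1] s2])
  hence 1: "(\<lambda>m. integral\<^sup>L lborel (?f m)) sums (LINT z:ball 0 \<rho>|lborel. h z / (1 - w * cnj z)\<^sup>2)"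
    unfolding sum_f set_lebesgue_integral_def .
  have term_m: "integral\<^sup>L lborel (?f m) = of_real (pi * \<rho>\<^sup>2) * (a m * (of_real (\<rho>\<^sup>2) * w) ^ m)" for m
  proof -
    have "integral\<^sup>L lborel (?f m) = of_nat (Suc m) * w ^ m * (LINT z:ball 0 \<rho>|lborel. h z * cnj z ^ m)"
      by (subst set_integral_mult_right[symmetric]) (simp only: set_lebesgue_integral_def)
    thus ?thesis unfolding coeff
      by (simp add: power_mult_distrib field_simps del: of_nat_Suc)
  qed
  have "norm (of_real (\<rho>\<^sup>2) * w) < 1"
    using \<rho> w by (intro norm_mult_less_1) (auto simp: norm_power power_less_one_iff)
  hence "(\<lambda>m. integral\<^sup>L lborel (?f m)) sums (of_real (pi * \<rho>\<^sup>2) * h (of_real (\<rho>\<^sup>2) * w))"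
    unfolding term_m by (intro sums_mult a) auto
  with 1 show ?thesis by (rule sums_unique2)
qed

lemma norm_one_minus_mult_cnj_ge:
  fixes z w :: complex
  assumes "norm z < 1"
  shows "1 - norm w \<le> norm (1 - w * cnj z)"
proof -
  have "norm (w * cnj z) \<le> norm w * 1" using assms unfolding norm_mult by (intro mult_left_mono) auto
  thus ?thesis using norm_triangle_ineq2[of 1 "w * cnj z"] by simp
qed

text \<open>
  Let the radius of the smaller discs tend to one; the kernel being bounded in z, a multiple of
  the integrable function norm (h z) dominates. Stated for integrable h, the result can be
  iterated in two variables.
\<close>

theorem disc_reproducing:
  assumes h: "h holomorphic_on ball 0 1" and int: "set_integrable lborel (ball 0 1) h" and w: "norm w < 1"
  shows "(LINT z:ball 0 1|lborel. h z / (1 - w * cnj z)\<^sup>2) = of_real pi * h w"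
proof -
  define \<rho> where "\<rho> j = real (Suc j) / real (Suc (Suc j))" for j
  have \<rho>: "0 < \<rho> j" "\<rho> j < 1" for j by (auto simp: \<rho>_def)
  have lim: "\<rho> \<longlonglongrightarrow> 1"
    unfolding \<rho>_def using LIMSEQ_Suc[OF LIMSEQ_n_over_Suc_n[where 'a = real]] .
  let ?g = "\<lambda>z. h z / (1 - w * cnj z)\<^sup>2"
  have nz0: "1 - w * cnj z \<noteq> 0" if "norm z < 1" for z using norm_one_minus_mult_cnj_ge[OF that, of w] w by auto
  have cont: "continuous_on (ball 0 1) ?g"
    using holomorphic_on_imp_continuous_on[OF h] nz0 by (intro continuous_intros) auto
  have "(\<lambda>j. LINT z|lborel. indicator (ball 0 (\<rho> j)) z *\<^sub>R ?g z) \<longlonglongrightarrow> (LINT z|lborel. indicator (ball 0 1) z *\<^sub>R ?g z)"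
  proof (rule integral_dominated_convergence[where w = "\<lambda>z. (1 / (1 - norm w)\<^sup>2) * norm (indicator (ball 0 1) z *\<^sub>R h z)"])
    show "(\<lambda>z. indicator (ball 0 1) z *\<^sub>R ?g z) \<in> borel_measurable lborel"
      using borel_measurable_continuous_on_indicator[OF _ cont] by simp
    show "(\<lambda>z. indicator (ball 0 (\<rho> j)) z *\<^sub>R ?g z) \<in> borel_measurable lborel" for j
      using borel_measurable_continuous_on_indicator[OF _ continuous_on_subset[OF cont], of "ball 0 (\<rho> j)"] \<rho>[of j]
      by (simp add: subset_ball less_imp_le)
    show "integrable lborel (\<lambda>z. (1 / (1 - norm w)\<^sup>2) * norm (indicator (ball 0 1) z *\<^sub>R h z))"
      using int unfolding set_integrable_def by (intro integrable_mult_right integrable_norm)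
    show "AE z in lborel. (\<lambda>j. indicator (ball 0 (\<rho> j)) z *\<^sub>R ?g z) \<longlonglongrightarrow> indicator (ball 0 1) z *\<^sub>R ?g z"
    proof (rule AE_I2)
      fix z :: complex
      show "(\<lambda>j. indicator (ball 0 (\<rho> j)) z *\<^sub>R ?g z) \<longlonglongrightarrow> indicator (ball 0 1) z *\<^sub>R ?g z"
      proof (cases "z \<in> ball 0 1")
        case True
        hence "eventually (\<lambda>j. norm z < \<rho> j) sequentially"
          using lim by (intro order_tendstoD(1)[OF lim]) auto
        hence "eventually (\<lambda>j. indicator (ball 0 (\<rho> j)) z *\<^sub>R ?g z = indicator (ball 0 1) z *\<^sub>R ?g z) sequentially"
          by eventually_elim (use True in \<open>simp add: indicator_def\<close>)
        thus ?thesis by (rule tendsto_eventually)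
      next
        case False
        hence "z \<notin> ball 0 (\<rho> j)" for j using \<rho>[of j] by (auto simp: not_less intro: less_imp_le order_trans)
        thus ?thesis using False by simp
      qed
    qed
    show "AE z in lborel. norm (indicator (ball 0 (\<rho> j)) z *\<^sub>R ?g z)
       \<le> (1 / (1 - norm w)\<^sup>2) * norm (indicator (ball 0 1) z *\<^sub>R h z)" for j
    proof (rule AE_I2)
      fix z :: complex
      show "norm (indicator (ball 0 (\<rho> j)) z *\<^sub>R ?g z) \<le> (1 / (1 - norm w)\<^sup>2) * norm (indicator (ball 0 1) z *\<^sub>R h z)"
      proof (cases "z \<in> ball 0 (\<rho> j)")
        case True
        hence z: "norm z < 1" using \<rho>[of j] by auto
        have "norm (h z) / (norm (1 - w * cnj z))\<^sup>2 \<le> norm (h z) / (1 - norm w)\<^sup>2"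
          using norm_one_minus_mult_cnj_ge[OF z, of w] w by (intro divide_left_mono power_mono mult_pos_pos) (auto simp: nz0[OF z])
        thus ?thesis using True z by (simp add: norm_divide norm_power)
      qed simp
    qed
  qed
  moreover have "(LINT z|lborel. indicator (ball 0 (\<rho> j)) z *\<^sub>R ?g z)
      = of_real (pi * (\<rho> j)\<^sup>2) * h (of_real ((\<rho> j)\<^sup>2) * w)" for j
    using small_disc_reproducing[OF h \<rho> w, of j] unfolding set_lebesgue_integral_def .
  moreover have "(\<lambda>j. of_real (pi * (\<rho> j)\<^sup>2) * h (of_real ((\<rho> j)\<^sup>2) * w)) \<longlonglongrightarrow> of_real (pi * 1\<^sup>2) * h w"
  proof (intro tendsto_mult tendsto_of_real tendsto_const tendsto_power lim)
    have "isCont h w"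
      using holomorphic_on_imp_continuous_on[OF h] w by (simp add: continuous_on_eq_continuous_at)
    moreover have "(\<lambda>j. of_real ((\<rho> j)\<^sup>2) * w) \<longlonglongrightarrow> of_real (1\<^sup>2) * w"
      by (intro tendsto_mult tendsto_of_real tendsto_const tendsto_power lim)
    ultimately show "(\<lambda>j. h (of_real ((\<rho> j)\<^sup>2) * w)) \<longlonglongrightarrow> h w"
      by (intro isCont_tendsto_compose[of w h]) auto
  qed
  ultimately have "(LINT z|lborel. indicator (ball 0 1) z *\<^sub>R ?g z) = of_real (pi * 1\<^sup>2) * h w"
    using LIMSEQ_unique by auto
  thus ?thesis unfolding set_lebesgue_integral_def by simp
qed

lemma indicator_bidisc: "indicator bidisc (x, y) = (indicator (ball 0 1) x * indicator (ball 0 1) y :: real)"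
  by (auto simp: indicator_def bidisc_def)

text \<open>
  Almost every slice of g in the second variable is integrable and is reproduced by the
  one-variable kernel. The remaining function g(., w2) is, up to the factor pi, a partial
  integral of an integrable function of two variables, hence integrable, so the one-variable
  result applies again.
\<close>

theorem bidisc_reproducing:
  assumes g: "holomorphic2_on g bidisc" and int: "set_integrable lborel bidisc g"
    and w: "norm w1 < 1" "norm w2 < 1"
  shows "set_integrable lborel bidisc (\<lambda>z. g z / ((1 - w1 * cnj (fst z))\<^sup>2 * (1 - w2 * cnj (snd z))\<^sup>2))"
    and "(LINT z:bidisc|lborel. g z / ((1 - w1 * cnj (fst z))\<^sup>2 * (1 - w2 * cnj (snd z))\<^sup>2)) = of_real (pi\<^sup>2) * g (w1, w2)"
proof -
  define b where "b w z = 1 / (1 - w * cnj z)\<^sup>2" for w z :: complex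
  have b_bound: "norm (b w z) \<le> 1 / (1 - norm w)\<^sup>2" if "norm w < 1" "norm z < 1" for w z
  proof -
    have "(1 - norm w)\<^sup>2 \<le> (norm (1 - w * cnj z))\<^sup>2"
      using norm_one_minus_mult_cnj_ge[of z w] that by (intro power_mono) auto
    moreover have "0 < (1 - norm w)\<^sup>2" using that by simp
    ultimately show ?thesis unfolding b_def norm_divide norm_power norm_one
      by (simp add: frac_le)
  qed
  have nz: "1 - w * cnj z \<noteq> 0" if "norm w < 1" "norm z < 1" for w z
    using norm_one_minus_mult_cnj_ge[of z w] that by auto
  have contg: "continuous_on bidisc g" using g by (rule holomorphic2_on_imp_continuous_on)
  have slice1: "(\<lambda>x. g (x, y)) holomorphic_on ball 0 1" if "y \<in> ball 0 1" for y
    using holomorphic2_on_slices(1)[of g "ball 0 1" "ball 0 1" y] g that by (simp add: bidisc_def)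
  have slice2: "(\<lambda>y. g (x, y)) holomorphic_on ball 0 1" if "x \<in> ball 0 1" for x
    using holomorphic2_on_slices(2)[of g "ball 0 1" "ball 0 1" x] g that by (simp add: bidisc_def)
  have int_mult: "set_integrable lborel bidisc (\<lambda>z. g z * h z)"
    if h: "continuous_on bidisc h" "\<And>z. z \<in> bidisc \<Longrightarrow> norm (h z) \<le> C" for h C
  proof (rule set_integrable_bound)
    show "set_integrable lborel bidisc (\<lambda>z. of_real C * g z)" using int by (intro set_integrable_mult_right)
    have "set_borel_measurable borel bidisc (\<lambda>z. g z * h z)"
      by (intro set_borel_measurable_continuous_on continuous_intros contg h) auto
    thus "set_borel_measurable lborel bidisc (\<lambda>z. g z * h z)" by (simp add: set_borel_measurable_def)
    show "AE z in lborel. z \<in> bidisc \<longrightarrow> norm (g z * h z) \<le> norm (of_real C * g z)"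
    proof (rule AE_I2, rule impI)
      fix z assume z: "z \<in> bidisc"
      have "norm (h z) \<le> \<bar>C\<bar>" using h(2)[OF z] by linarith
      from mult_right_mono[OF this norm_ge_zero[of "g z"]]
      show "norm (g z * h z) \<le> norm (of_real C * g z)" by (simp add: norm_mult mult.commute)
    qed
  qed
  have nzb: "1 - w1 * cnj (fst z) \<noteq> 0" "1 - w2 * cnj (snd z) \<noteq> 0" if "z \<in> bidisc" for z
    using nz w that by (auto simp: bidisc_def)
  have contb: "continuous_on bidisc (\<lambda>z. b w1 (fst z))" "continuous_on bidisc (\<lambda>z. b w2 (snd z))"
    unfolding b_def using nzb by (intro continuous_intros; auto)+
  have i2: "set_integrable lborel bidisc (\<lambda>z. g z * b w2 (snd z))"
    by (rule int_mult[OF contb(2), of "1 / (1 - norm w2)\<^sup>2"]) (use b_bound w in \<open>auto simp: bidisc_def\<close>)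
  have i12: "set_integrable lborel bidisc (\<lambda>z. g z * (b w1 (fst z) * b w2 (snd z)))"
  proof (rule int_mult)
    show "continuous_on bidisc (\<lambda>z. b w1 (fst z) * b w2 (snd z))" by (intro continuous_intros contb)
    show "norm (b w1 (fst z) * b w2 (snd z)) \<le> (1 / (1 - norm w1)\<^sup>2) * (1 / (1 - norm w2)\<^sup>2)" if "z \<in> bidisc" for z
      unfolding norm_mult using that w by (intro mult_mono b_bound) (auto simp: bidisc_def)
  qed
  thus "set_integrable lborel bidisc (\<lambda>z. g z / ((1 - w1 * cnj (fst z))\<^sup>2 * (1 - w2 * cnj (snd z))\<^sup>2))"
    by (simp add: b_def)
  let ?G = "\<lambda>z. indicator bidisc z *\<^sub>R g z"
  let ?G2 = "\<lambda>z. indicator bidisc z *\<^sub>R (g z * b w2 (snd z))"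
  let ?G12 = "\<lambda>z. indicator bidisc z *\<^sub>R (g z * (b w1 (fst z) * b w2 (snd z)))"
  have I: "integrable (lborel \<Otimes>\<^sub>M lborel) ?G" "integrable (lborel \<Otimes>\<^sub>M lborel) ?G2" "integrable (lborel \<Otimes>\<^sub>M lborel) ?G12"
    using int i2 i12 unfolding set_integrable_def lborel_prod by auto
  (* Integrate over the second variable first. *)
  have "AE x in lborel. integrable lborel (\<lambda>y. ?G (x, y))"
    by (rule lborel_pair.AE_integrable_fst'[OF I(1)])
  hence inner: "AE x in lborel. (LINT y|lborel. ?G2 (x, y)) = indicator (ball 0 1) x *\<^sub>R (of_real pi * g (x, w2))"
  proof (rule AE_mp[OF _ AE_I2[OF impI]])
    fix x assume x: "integrable lborel (\<lambda>y. ?G (x, y))"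
    show "(LINT y|lborel. ?G2 (x, y)) = indicator (ball 0 1) x *\<^sub>R (of_real pi * g (x, w2))"
    proof (cases "x \<in> ball 0 1")
      case True
      have "set_integrable lborel (ball 0 1) (\<lambda>y. g (x, y))"
        using x True unfolding set_integrable_def by (simp add: indicator_bidisc)
      from disc_reproducing[OF slice2[OF True] this w(2)] show ?thesis
        using True by (simp add: indicator_bidisc set_lebesgue_integral_def b_def)
    next
      case False
      thus ?thesis by (simp add: indicator_bidisc)
    qed
  qed
  have meas_slice: "(\<lambda>x. indicator (ball 0 1) x *\<^sub>R (of_real pi * g (x, w2))) \<in> borel_measurable lborel"
    using borel_measurable_continuous_on_indicator[of "ball 0 1" "\<lambda>x. of_real pi * g (x, w2)"]
      holomorphic_on_imp_continuous_on[OF slice1[of w2]] w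
    by (simp add: continuous_on_mult_left)
  have "integrable lborel (\<lambda>x. LINT y|lborel. ?G2 (x, y))"
    by (rule lborel_pair.integrable_fst'[OF I(2)])
  hence "integrable lborel (\<lambda>x. indicator (ball 0 1) x *\<^sub>R (of_real pi * g (x, w2)))"
    using integrable_cong_AE[OF borel_measurable_integrable[OF lborel_pair.integrable_fst'[OF I(2)]] meas_slice inner]
    by blast
  hence "integrable lborel (\<lambda>x. (1 / of_real pi) * (indicator (ball 0 1) x *\<^sub>R (of_real pi * g (x, w2))))"
    by (intro integrable_mult_right)
  hence int1: "set_integrable lborel (ball 0 1) (\<lambda>x. g (x, w2))"
    unfolding set_integrable_def by simp
  have "(LINT z:bidisc|lborel. g z * (b w1 (fst z) * b w2 (snd z))) = integral\<^sup>L (lborel \<Otimes>\<^sub>M lborel) ?G12"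
    unfolding set_lebesgue_integral_def lborel_prod ..
  also have "\<dots> = (LINT x|lborel. LINT y|lborel. ?G12 (x, y))"
    by (rule lborel_pair.integral_fst'[OF I(3), symmetric])
  also have "\<dots> = (LINT x|lborel. of_real pi * (indicator (ball 0 1) x *\<^sub>R (g (x, w2) * b w1 x)))"
  proof (rule integral_cong_AE)
    show "(\<lambda>x. LINT y|lborel. ?G12 (x, y)) \<in> borel_measurable lborel"
      by (rule borel_measurable_integrable[OF lborel_pair.integrable_fst'[OF I(3)]])
    have "continuous_on (ball 0 1) (\<lambda>x. g (x, w2) * b w1 x)"
      unfolding b_def using holomorphic_on_imp_continuous_on[OF slice1[of w2]] w nz
      by (intro continuous_intros) auto
    from borel_measurable_continuous_on_indicator[OF _ this]
    show "(\<lambda>x. of_real pi * (indicator (ball 0 1) x *\<^sub>R (g (x, w2) * b w1 x))) \<in> borel_measurable lborel"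
      by (intro borel_measurable_times) auto
    show "AE x in lborel. (LINT y|lborel. ?G12 (x, y)) = of_real pi * (indicator (ball 0 1) x *\<^sub>R (g (x, w2) * b w1 x))"
      using inner
    proof (rule AE_mp[OF _ AE_I2[OF impI]])
      fix x assume x: "(LINT y|lborel. ?G2 (x, y)) = indicator (ball 0 1) x *\<^sub>R (of_real pi * g (x, w2))"
      have "(LINT y|lborel. ?G12 (x, y)) = (LINT y|lborel. b w1 x * ?G2 (x, y))"
        by (intro Bochner_Integration.integral_cong refl) (simp add: mult_ac)
      also have "\<dots> = b w1 x * (LINT y|lborel. ?G2 (x, y))" by (rule integral_mult_right_zero)
      finally show "(LINT y|lborel. ?G12 (x, y)) = of_real pi * (indicator (ball 0 1) x *\<^sub>R (g (x, w2) * b w1 x))"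
        unfolding x by (simp add: mult_ac)
    qed
  qed
  also have "\<dots> = of_real pi * (LINT x:ball 0 1|lborel. g (x, w2) / (1 - w1 * cnj x)\<^sup>2)"
    unfolding integral_mult_right_zero set_lebesgue_integral_def b_def by simp
  also have "\<dots> = of_real (pi\<^sup>2) * g (w1, w2)"
    using disc_reproducing[OF slice1[of w2] int1 w(1)] w by (simp add: power2_eq_square)
  finally show "(LINT z:bidisc|lborel. g z / ((1 - w1 * cnj (fst z))\<^sup>2 * (1 - w2 * cnj (snd z))\<^sup>2)) = of_real (pi\<^sup>2) * g (w1, w2)"
    by (simp add: b_def)
qed

section \<open>Integration over the quotient domain\<close>

lemma coordinates_borel [measurable]:
  "fst \<in> borel_measurable (borel :: (complex \<times> complex) measure)"
  "snd \<in> borel_measurable (borel :: (complex \<times> complex) measure)"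
  by (intro borel_measurable_continuous_onI continuous_intros)+

text \<open>
  The k-th powers of the coordinates have the same sum and the same product, hence agree as an
  unordered pair.
\<close>

lemma phi_eq_cases:
  assumes "phi k (z1, z2) = phi k (w1, w2)"
  shows "z1 ^ k = w1 ^ k \<and> z2 ^ k = w2 ^ k \<or> z1 ^ k = w2 ^ k \<and> z2 ^ k = w1 ^ k"
proof -
  have s: "z1 ^ k + z2 ^ k = w1 ^ k + w2 ^ k" and "(z1 * z2) ^ k = (w1 * w2) ^ k"
    using assms by (auto simp: phi_def)
  hence p: "z1 ^ k * z2 ^ k = w1 ^ k * w2 ^ k" by (simp add: power_mult_distrib)
  have "(z1 ^ k - w1 ^ k) * (z1 ^ k - w2 ^ k) = z1 ^ k * (z1 ^ k - (w1 ^ k + w2 ^ k)) + w1 ^ k * w2 ^ k"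
    by (simp add: algebra_simps)
  also have "\<dots> = 0" unfolding s[symmetric] p[symmetric] by (simp add: algebra_simps)
  finally have "z1 ^ k = w1 ^ k \<or> z1 ^ k = w2 ^ k" by simp
  thus ?thesis using s by auto
qed

lemma norm_eq_of_power_eq: "0 < k \<Longrightarrow> (a::complex) ^ k = b ^ k \<Longrightarrow> norm a = norm b"
  by (metis norm_power norm_ge_zero power_eq_imp_eq_base)

text \<open>
  The complement is a null set, is invariant under the dihedral group and contains the zeros of
  the Jacobian. On the set itself, the larger coordinate singles out one of the two orders of a
  pair.
\<close>

definition off_diagonal :: "(complex \<times> complex) set" where
  "off_diagonal = {z. norm (fst z) \<noteq> norm (snd z)}"

lemma phi_off_diagonal:
  assumes "0 < k" "phi k z = phi k w" "z \<in> off_diagonal"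
  shows "w \<in> off_diagonal"
proof -
  have "norm (fst z) = norm (fst w) \<and> norm (snd z) = norm (snd w)
      \<or> norm (fst z) = norm (snd w) \<and> norm (snd z) = norm (fst w)"
    using phi_eq_cases[of k "fst z" "snd z" "fst w" "snd w"] assms(2) norm_eq_of_power_eq[OF assms(1)]
    by (metis surjective_pairing)
  thus ?thesis using assms(3) by (auto simp: off_diagonal_def)
qed

definition principal_root :: "nat \<Rightarrow> complex \<Rightarrow> complex" where
  "principal_root k y = exp (Ln y / of_nat k)"

lemma principal_root_power: "0 < k \<Longrightarrow> y \<noteq> 0 \<Longrightarrow> principal_root k y ^ k = y"
  unfolding principal_root_def by (simp flip: exp_of_nat_mult)

lemma principal_root_nonzero: "principal_root k y \<noteq> 0"
  by (simp add: principal_root_def)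

lemma principal_root_measurable [measurable]: "principal_root k \<in> borel_measurable borel"
  unfolding principal_root_def by measurable

text \<open>
  A fundamental domain: (p, q) says which coordinate is the larger one, and \<zeta> says by
  which k-th root of unity it differs from the principal k-th root of its k-th power. Using the
  principal root, and not an arbitrary choice of representatives, makes the 2k sheets Borel
  sets.
\<close>

definition sheet :: "nat \<Rightarrow> (complex \<times> complex \<Rightarrow> complex) \<Rightarrow> (complex \<times> complex \<Rightarrow> complex) \<Rightarrow> complex \<Rightarrow> (complex \<times> complex) set" where
  "sheet k p q \<zeta> = {z \<in> bidisc. norm (q z) < norm (p z) \<and> p z = \<zeta> * principal_root k (p z ^ k)}"

lemma sheet_borel:
  assumes [measurable]: "p \<in> borel_measurable borel" "q \<in> borel_measurable borel"
  shows "sheet k p q \<zeta> \<in> sets borel"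
  unfolding sheet_def by measurable

lemma phi_inj_on_sheet:
  assumes k: "0 < k" and pq: "(p, q) \<in> {(fst, snd), (snd, fst)}"
  shows "inj_on (phi k) (sheet k p q \<zeta>)"
proof (rule inj_onI)
  fix z w assume z: "z \<in> sheet k p q \<zeta>" and w: "w \<in> sheet k p q \<zeta>" and eq: "phi k z = phi k w"
  have "p z ^ k = p w ^ k \<and> q z ^ k = q w ^ k \<or> p z ^ k = q w ^ k \<and> q z ^ k = p w ^ k"
    using phi_eq_cases[of k "fst z" "snd z" "fst w" "snd w"] eq pq by auto
  moreover have "\<not> (p z ^ k = q w ^ k \<and> q z ^ k = p w ^ k)"
    using norm_eq_of_power_eq[OF k, of "p z" "q w"] norm_eq_of_power_eq[OF k, of "q z" "p w"] z w
    by (auto simp: sheet_def)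
  ultimately have "p z ^ k = p w ^ k" by blast
  hence p: "p z = p w" using z w unfolding sheet_def by (metis (mono_tags, lifting) mem_Collect_eq)
  have "p z \<noteq> 0" using z by (auto simp: sheet_def)
  moreover have "p z * q z = p w * q w"
    using eq pq by (cases z; cases w) (auto simp: phi_def mult.commute)
  ultimately have "q z = q w" using p by simp
  thus "z = w" using p pq by (auto simp: prod_eq_iff)
qed

lemma phi_image_sheet:
  assumes k: "0 < k" and pq: "(p, q) \<in> {(fst, snd), (snd, fst)}" and \<zeta>: "\<zeta> ^ k = 1"
  shows "phi k ` sheet k p q \<zeta> = phi k ` (bidisc \<inter> off_diagonal)"
proof
  show "phi k ` sheet k p q \<zeta> \<subseteq> phi k ` (bidisc \<inter> off_diagonal)"
    using pq by (intro image_mono) (auto simp: sheet_def off_diagonal_def)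
  show "phi k ` (bidisc \<inter> off_diagonal) \<subseteq> phi k ` sheet k p q \<zeta>"
  proof
    fix u assume "u \<in> phi k ` (bidisc \<inter> off_diagonal)"
    then obtain z1 z2 where z: "norm z1 < 1" "norm z2 < 1" "norm z1 \<noteq> norm z2" "u = phi k (z1, z2)"
      by (auto simp: bidisc_def off_diagonal_def)
    have swap: "phi k (z1, z2) = phi k (z2, z1)" by (simp add: phi_def add.commute mult.commute)
    obtain a b where ab: "norm a < 1" "norm b < norm a" "u = phi k (a, b)"
    proof (cases "norm z1 < norm z2")
      case True
      show ?thesis by (rule that[of z2 z1]) (use z True swap in auto)
    next
      case False
      show ?thesis by (rule that[of z1 z2]) (use z False in auto)
    qed
    have a0: "a \<noteq> 0" using ab by auto
    define x where "x = \<zeta> * principal_root k (a ^ k)"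
    define y where "y = a * b / x"
    have xk: "x ^ k = a ^ k"
      using principal_root_power[OF k, of "a ^ k"] a0 \<zeta> by (simp add: x_def power_mult_distrib)
    hence x: "norm x = norm a" by (rule norm_eq_of_power_eq[OF k])
    hence x0: "x \<noteq> 0" using a0 by auto
    have yk: "y ^ k = b ^ k" unfolding y_def using a0 by (simp add: power_divide power_mult_distrib xk)
    hence y: "norm y = norm b" by (rule norm_eq_of_power_eq[OF k])
    define z where "z = (if (p, q) = (fst, snd) then (x, y) else (y, x))"
    have "fst \<noteq> (snd :: complex \<times> complex \<Rightarrow> complex)"
    proof
      assume "fst = (snd :: complex \<times> complex \<Rightarrow> complex)"
      hence "fst (0 :: complex, 1 :: complex) = snd (0 :: complex, 1 :: complex)" by metis
      thus False by simp
    qed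
    hence pz: "p z = x" "q z = y" using pq by (auto simp: z_def)
    have "z \<in> sheet k p q \<zeta>"
      unfolding sheet_def using ab x y xk pz by (auto simp: z_def bidisc_def x_def)
    moreover have "phi k z = u"
      unfolding ab using xk yk x0 by (auto simp: z_def phi_def y_def)
    ultimately show "u \<in> phi k ` sheet k p q \<zeta>" by blast
  qed
qed

text \<open>
  Since being off the diagonal depends on phi z only, the image is the quotient domain minus the
  compact image of the diagonal part of the closed bidisc.
\<close>

lemma phi_off_diagonal_image_borel:
  assumes k: "0 < k" shows "phi k ` (bidisc \<inter> off_diagonal) \<in> sets borel"
proof -
  let ?D = "(cball 0 1 \<times> cball 0 1) - off_diagonal"
  have "?D = (cball 0 1 \<times> cball 0 1) \<inter> {z :: complex \<times> complex. norm (fst z) = norm (snd z)}"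
    by (auto simp: off_diagonal_def)
  moreover have "compact \<dots>"
    by (intro compact_Int_closed compact_Times closed_Collect_eq continuous_intros) auto
  ultimately have "closed (phi k ` ?D)"
    by (metis compact_continuous_image continuous_on_phi compact_imp_closed)
  moreover have "phi k ` (bidisc \<inter> off_diagonal) = dihedral_domain k - phi k ` ?D"
  proof
    show "phi k ` (bidisc \<inter> off_diagonal) \<subseteq> dihedral_domain k - phi k ` ?D"
    proof
      fix u assume "u \<in> phi k ` (bidisc \<inter> off_diagonal)"
      then obtain z where z: "z \<in> bidisc" "z \<in> off_diagonal" "u = phi k z" by blast
      have "u \<noteq> phi k w" if "w \<in> ?D" for w
        using phi_off_diagonal[OF k, of z w] z that by auto
      thus "u \<in> dihedral_domain k - phi k ` ?D"
        using z unfolding dihedral_domain_def by blast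
    qed
    have "bidisc \<subseteq> cball 0 1 \<times> cball 0 1" by (auto simp: bidisc_def)
    thus "dihedral_domain k - phi k ` ?D \<subseteq> phi k ` (bidisc \<inter> off_diagonal)"
      unfolding dihedral_domain_def by blast
  qed
  ultimately show ?thesis using open_dihedral_domain[OF k] by (simp add: borel_open open_Diff)
qed

text \<open>
  By Fubini: each slice is a circle or a point.
\<close>

lemma negligible_diagonal: "negligible (- off_diagonal)"
proof -
  have eq: "- off_diagonal = {z :: complex \<times> complex. norm (fst z) = norm (snd z)}"
    by (auto simp: off_diagonal_def)
  have cl: "closed (- off_diagonal)"
    unfolding eq by (intro closed_Collect_eq continuous_intros)
  hence b: "- off_diagonal \<in> sets borel" by (rule borel_closed)
  have "emeasure lborel (- off_diagonal) = (\<integral>\<^sup>+x. emeasure lborel (Pair x -` (- off_diagonal)) \<partial>lborel)"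
  proof -
    have "- off_diagonal \<in> sets (lborel \<Otimes>\<^sub>M lborel)" unfolding lborel_prod using b by simp
    from lborel.emeasure_pair_measure_alt[OF this] show ?thesis unfolding lborel_prod .
  qed
  also have "\<dots> = integral\<^sup>N lborel (\<lambda>x::complex. 0)"
  proof (rule nn_integral_cong)
    fix x :: complex
    have "Pair x -` (- off_diagonal) = sphere 0 (norm x)" unfolding eq by auto
    moreover have "sphere (0::complex) (norm x) \<in> null_sets lborel"
      using negligible_sphere[of "0::complex" "norm x"] unfolding negligible_iff_null_sets
      by (subst (asm) null_sets_completion_iff) auto
    ultimately show "emeasure lborel (Pair x -` (- off_diagonal)) = 0" by auto
  qed
  also have "\<dots> = 0" by simp
  finally have "- off_diagonal \<in> null_sets lborel" using b by auto
  thus ?thesis unfolding negligible_iff_null_sets by (rule null_sets_completionI)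
qed

lemma phi_has_derivative:
  "(phi k has_derivative (\<lambda>h. (of_nat k * fst z ^ (k - 1) * fst h + of_nat k * snd z ^ (k - 1) * snd h,
      snd z * fst h + fst z * snd h))) (at z)"
proof -
  have 1: "((\<lambda>z. fst z ^ k) has_derivative (\<lambda>h. of_nat k * fst h * fst z ^ (k - 1))) (at z)"
    "((\<lambda>z. snd z ^ k) has_derivative (\<lambda>h. of_nat k * snd h * snd z ^ (k - 1))) (at z)"
    by (intro has_derivative_power has_derivative_fst has_derivative_snd has_derivative_ident)+
  have 2: "((\<lambda>z. fst z * snd z) has_derivative (\<lambda>h. fst z * snd h + fst h * snd z)) (at z)"
    by (intro has_derivative_mult has_derivative_fst has_derivative_snd has_derivative_ident)
  have "((\<lambda>z. (fst z ^ k + snd z ^ k, fst z * snd z)) has_derivative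
     (\<lambda>h. (of_nat k * fst h * fst z ^ (k - 1) + of_nat k * snd h * snd z ^ (k - 1), fst z * snd h + fst h * snd z))) (at z)"
    by (intro has_derivative_Pair has_derivative_add 1 2)
  thus ?thesis unfolding phi_def case_prod_beta
    by (rule has_derivative_eq_rhs) (simp add: fun_eq_iff mult_ac add_ac)
qed

lemma phi_jacobian_eq:
  "0 < k \<Longrightarrow> of_nat k * fst z ^ (k - 1) * fst z - of_nat k * snd z ^ (k - 1) * snd z = phi_jacobian k z"
  by (cases k; cases z) (simp_all add: phi_jacobian_def algebra_simps)

lemma phi_jacobian_measurable [measurable]: "phi_jacobian k \<in> borel_measurable borel"
  unfolding phi_jacobian_def case_prod_beta
  by (intro borel_measurable_continuous_onI continuous_intros)

lemma phi_measurable [measurable]: "phi k \<in> borel_measurable borel"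
  by (intro borel_measurable_continuous_onI continuous_on_phi)

text \<open>
  A differentiable map sends null sets to null sets.
\<close>

lemma emeasure_dihedral_off_diagonal:
  assumes k: "0 < k" and E: "E \<in> sets borel"
  shows "emeasure lborel (phi k ` (bidisc \<inter> off_diagonal) \<inter> E) = emeasure lborel (dihedral_domain k \<inter> E)"
proof -
  let ?U = "phi k ` (bidisc \<inter> off_diagonal)"
  have U: "dihedral_domain k \<in> sets borel" using open_dihedral_domain[OF k] by (rule borel_open)
  have "phi k differentiable_on S" for S
    unfolding differentiable_on_def differentiable_def using phi_has_derivative has_derivative_at_withinI by blast
  hence "negligible (phi k ` (- off_diagonal))"
    by (intro negligible_differentiable_image_negligible negligible_diagonal) auto
  hence "negligible (dihedral_domain k \<inter> E - ?U \<inter> E)"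
    by (rule negligible_subset) (auto simp: dihedral_domain_def)
  hence N: "dihedral_domain k \<inter> E - ?U \<inter> E \<in> null_sets lborel"
    unfolding negligible_iff_null_sets using U E phi_off_diagonal_image_borel[OF k]
    by (subst (asm) null_sets_completion_iff) auto
  have "emeasure lborel (dihedral_domain k \<inter> E) = emeasure lborel (?U \<inter> E \<union> (dihedral_domain k \<inter> E - ?U \<inter> E))"
    by (rule arg_cong[of _ _ "emeasure lborel"]) (auto simp: dihedral_domain_def)
  also have "\<dots> = emeasure lborel (?U \<inter> E)"
    using N E phi_off_diagonal_image_borel[OF k] by (intro emeasure_Un_null_set) auto
  finally show ?thesis by simp
qed

lemma sheet_integral:
  assumes k: "0 < k" and pq: "(p, q) \<in> {(fst, snd), (snd, fst)}" and \<zeta>: "\<zeta> ^ k = 1" and E: "E \<in> sets borel"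
  shows "(\<integral>\<^sup>+z. ennreal ((cmod (phi_jacobian k z))\<^sup>2) * indicator (sheet k p q \<zeta> \<inter> phi k -` E) z \<partial>lborel)
    = emeasure lborel (dihedral_domain k \<inter> E)"
proof -
  let ?S = "sheet k p q \<zeta> \<inter> phi k -` E"
  have img: "phi k ` ?S = phi k ` (bidisc \<inter> off_diagonal) \<inter> E"
    unfolding phi_image_sheet[OF k pq \<zeta>, symmetric] by auto
  have mp: "p \<in> borel_measurable borel" "q \<in> borel_measurable borel"
    using pq coordinates_borel by auto
  have "(\<integral>\<^sup>+z\<in>?S. ennreal ((cmod (of_nat k * fst z ^ (k - 1) * fst z - of_nat k * snd z ^ (k - 1) * snd z))\<^sup>2) \<partial>lborel)
      = emeasure lborel (phi k ` ?S)"
  proof (rule nn_integral_holomorphic_image)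
    show "?S \<in> sets borel"
      using sheet_borel[OF mp] measurable_sets_borel[OF phi_measurable E] by auto
    show "phi k ` ?S \<in> sets borel" unfolding img using phi_off_diagonal_image_borel[OF k] E by auto
    show "bounded (phi k ` ?S)"
      by (rule bounded_subset[OF bounded_dihedral_domain[of k]]) (auto simp: dihedral_domain_def sheet_def)
    show "inj_on (phi k) ?S" using phi_inj_on_sheet[OF k pq] by (rule inj_on_subset) auto
    show "(phi k has_derivative (\<lambda>h. (of_nat k * fst z ^ (k - 1) * fst h + of_nat k * snd z ^ (k - 1) * snd h,
      snd z * fst h + fst z * snd h))) (at z)" for z by (rule phi_has_derivative)
    show "(\<lambda>z :: complex \<times> complex. of_nat k * fst z ^ (k - 1) * fst z - of_nat k * snd z ^ (k - 1) * snd z) \<in> borel_measurable borel"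
      unfolding phi_jacobian_eq[OF k] by measurable
  qed
  thus ?thesis
    unfolding phi_jacobian_eq[OF k] img emeasure_dihedral_off_diagonal[OF k E] .
qed

lemma indicator_sheets:
  assumes k: "0 < k" and z: "z \<in> off_diagonal"
  shows "(indicator bidisc z :: ennreal) =
    (\<Sum>\<zeta>\<in>{\<zeta>. \<zeta> ^ k = 1}. indicator (sheet k fst snd \<zeta>) z + indicator (sheet k snd fst \<zeta>) z)"
proof (cases "z \<in> bidisc")
  case False
  thus ?thesis by (simp add: sheet_def)
next
  case True
  have fin: "finite {\<zeta>::complex. \<zeta> ^ k = 1}" using finite_roots_unity[of k] k by simp
  have main: "(\<Sum>\<zeta>\<in>{\<zeta>. \<zeta> ^ k = 1}. indicator (sheet k p q \<zeta>) z) = (1::ennreal)"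
    if lt: "norm (q z) < norm (p z)" for p q
  proof -
    have p0: "p z \<noteq> 0" using lt by auto
    define r where "r = principal_root k (p z ^ k)"
    have r: "r \<noteq> 0" "r ^ k = p z ^ k"
      using principal_root_power[OF k] p0 by (auto simp: r_def principal_root_nonzero)
    have "(\<Sum>\<zeta>\<in>{\<zeta>. \<zeta> ^ k = 1}. indicator (sheet k p q \<zeta>) z) = (\<Sum>\<zeta>\<in>{\<zeta>. \<zeta> ^ k = 1}. if \<zeta> = p z / r then 1 else (0::ennreal))"
      using True lt r unfolding sheet_def r_def[symmetric]
      by (intro sum.cong) (auto simp: indicator_def field_simps r_def)
    also have "\<dots> = 1" using r p0 fin by (simp add: power_divide)
    finally show ?thesis .
  qed
  have zero: "(\<Sum>\<zeta>\<in>{\<zeta>. \<zeta> ^ k = 1}. indicator (sheet k p q \<zeta>) z) = (0::ennreal)"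
    if "norm (p z) \<le> norm (q z)" for p q
    using that by (simp add: sheet_def)
  have "norm (fst z) \<noteq> norm (snd z)" using z by (simp add: off_diagonal_def)
  then consider "norm (fst z) < norm (snd z)" | "norm (snd z) < norm (fst z)" by linarith
  thus ?thesis
    by cases (use main[of fst snd] main[of snd fst] zero[of fst snd] zero[of snd fst] True in \<open>simp_all add: sum.distrib\<close>)
qed

text \<open>
  Each of the 2k sheets contributes the measure of the quotient domain once.
\<close>

theorem distr_phi:
  assumes k: "0 < k"
  shows "distr (density lborel (\<lambda>z. ennreal (indicator bidisc z * (cmod (phi_jacobian k z))\<^sup>2))) borel (phi k)
     = density lborel (\<lambda>u. ennreal (2 * real k * indicator (dihedral_domain k) u))" (is "?M = ?N")
proof (rule measure_eqI)
  fix E assume "E \<in> sets ?M"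
  hence E [measurable]: "E \<in> sets borel" by simp
  have U [measurable]: "dihedral_domain k \<in> sets borel" using open_dihedral_domain[OF k] by (rule borel_open)
  let ?R = "{\<zeta>::complex. \<zeta> ^ k = 1}"
  let ?J = "\<lambda>z. ennreal ((cmod (phi_jacobian k z))\<^sup>2)"
  have card: "card ?R = k" using card_roots_unity_eq[OF k] .
  have mS [measurable]: "sheet k fst snd \<zeta> \<in> sets borel" "sheet k snd fst \<zeta> \<in> sets borel" for \<zeta>
    by (intro sheet_borel coordinates_borel)+
  have mE [measurable]: "phi k -` E \<in> sets borel" using measurable_sets_borel[OF phi_measurable E] .
  have "emeasure ?M E = emeasure (density lborel (\<lambda>z. ennreal (indicator bidisc z * (cmod (phi_jacobian k z))\<^sup>2))) (phi k -` E)"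
    by (subst emeasure_distr) auto
  also have "\<dots> = (\<integral>\<^sup>+z. ennreal (indicator bidisc z * (cmod (phi_jacobian k z))\<^sup>2) * indicator (phi k -` E) z \<partial>lborel)"
    by (rule emeasure_density) (use mE in simp_all)
  also have "\<dots> = (\<integral>\<^sup>+z. (\<Sum>\<zeta>\<in>?R. ?J z * indicator (sheet k fst snd \<zeta> \<inter> phi k -` E) z
        + ?J z * indicator (sheet k snd fst \<zeta> \<inter> phi k -` E) z) \<partial>lborel)"
  proof (rule nn_integral_cong_AE)
    have "- off_diagonal \<in> null_sets lebesgue" using negligible_diagonal negligible_iff_null_sets by blast
    hence "AE z in lebesgue. z \<in> off_diagonal" by (rule AE_I') auto
    hence "AE z in lborel. z \<in> off_diagonal" by (simp add: AE_completion_iff)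
    thus "AE z in lborel. ennreal (indicator bidisc z * (cmod (phi_jacobian k z))\<^sup>2) * indicator (phi k -` E) z
      = (\<Sum>\<zeta>\<in>?R. ?J z * indicator (sheet k fst snd \<zeta> \<inter> phi k -` E) z
        + ?J z * indicator (sheet k snd fst \<zeta> \<inter> phi k -` E) z)"
    proof (rule AE_mp[OF _ AE_I2[OF impI]])
      fix z assume z: "z \<in> off_diagonal"
      have "ennreal (indicator bidisc z * (cmod (phi_jacobian k z))\<^sup>2) * indicator (phi k -` E) z
         = ?J z * indicator (phi k -` E) z * indicator bidisc z"
        by (simp add: indicator_def)
      also have "\<dots> = (\<Sum>\<zeta>\<in>?R. ?J z * indicator (phi k -` E) z * (indicator (sheet k fst snd \<zeta>) z + indicator (sheet k snd fst \<zeta>) z))"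
        unfolding indicator_sheets[OF k z] by (rule sum_distrib_left)
      also have "\<dots> = (\<Sum>\<zeta>\<in>?R. ?J z * indicator (sheet k fst snd \<zeta> \<inter> phi k -` E) z
        + ?J z * indicator (sheet k snd fst \<zeta> \<inter> phi k -` E) z)"
        by (intro sum.cong refl) (auto simp: indicator_def mult_2_right)
      finally show "ennreal (indicator bidisc z * (cmod (phi_jacobian k z))\<^sup>2) * indicator (phi k -` E) z = \<dots>" .
    qed
  qed
  also have "\<dots> = (\<Sum>\<zeta>\<in>?R. (\<integral>\<^sup>+z. ?J z * indicator (sheet k fst snd \<zeta> \<inter> phi k -` E) z \<partial>lborel)
        + (\<integral>\<^sup>+z. ?J z * indicator (sheet k snd fst \<zeta> \<inter> phi k -` E) z \<partial>lborel))"
    using mS mE by (subst nn_integral_sum; (subst nn_integral_add)?; (intro sum.cong refl nn_integral_add)?; measurable)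
  also have "\<dots> = (\<Sum>\<zeta>\<in>?R. emeasure lborel (dihedral_domain k \<inter> E) + emeasure lborel (dihedral_domain k \<inter> E))"
    by (intro sum.cong refl arg_cong2[of _ _ _ _ "(+)"] sheet_integral[OF k _ _ E]) auto
  also have "\<dots> = ennreal (2 * real k) * emeasure lborel (dihedral_domain k \<inter> E)"
    using card by (simp add: ennreal_mult mult_2[symmetric] mult_ac ennreal_of_nat_eq_real_of_nat)
  also have "\<dots> = (\<integral>\<^sup>+u. ennreal (2 * real k) * indicator (dihedral_domain k \<inter> E) u \<partial>lborel)"
    by (simp add: nn_integral_cmult)
  also have "\<dots> = (\<integral>\<^sup>+u. ennreal (2 * real k * indicator (dihedral_domain k) u) * indicator E u \<partial>lborel)"
    by (intro nn_integral_cong) (auto simp: indicator_def)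
  also have "\<dots> = emeasure ?N E"
    by (rule emeasure_density[symmetric]) auto
  finally show "emeasure ?M E = emeasure ?N E" .
qed simp

corollary dihedral_integral:
  fixes f :: "complex \<times> complex \<Rightarrow> 'b::{banach, second_countable_topology}"
  assumes k: "0 < k" and f: "set_borel_measurable borel (dihedral_domain k) f"
  shows "set_integrable lborel (dihedral_domain k) f \<longleftrightarrow>
      set_integrable lborel bidisc (\<lambda>z. (cmod (phi_jacobian k z))\<^sup>2 *\<^sub>R f (phi k z))" (is ?int)
    and "(2 * real k) *\<^sub>R (LINT u:dihedral_domain k|lborel. f u) =
      (LINT z:bidisc|lborel. (cmod (phi_jacobian k z))\<^sup>2 *\<^sub>R f (phi k z))" (is ?eq)
proof -
  have U [measurable]: "dihedral_domain k \<in> sets borel" using open_dihedral_domain[OF k] by (rule borel_open)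
  define F where "F u = indicator (dihedral_domain k) u *\<^sub>R f u" for u
  have F [measurable]: "F \<in> borel_measurable borel"
    using f unfolding F_def set_borel_measurable_def by simp
  let ?d = "\<lambda>z. indicator bidisc z * (cmod (phi_jacobian k z))\<^sup>2"
  let ?e = "\<lambda>u. 2 * real k * indicator (dihedral_domain k) u"
  have pull: "?d z *\<^sub>R F (phi k z) = indicator bidisc z *\<^sub>R ((cmod (phi_jacobian k z))\<^sup>2 *\<^sub>R f (phi k z))" for z
    by (auto simp: indicator_def F_def dihedral_domain_def)
  have push: "?e u *\<^sub>R F u = (2 * real k) *\<^sub>R (indicator (dihedral_domain k) u *\<^sub>R f u)" for u
    by (auto simp: indicator_def F_def)
  have dist: "distr (density lborel (\<lambda>z. ennreal (?d z))) borel (phi k) = density lborel (\<lambda>u. ennreal (?e u))"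
    by (rule distr_phi[OF k])
  have m1: "?d \<in> borel_measurable lborel" by measurable
  have m2: "?e \<in> borel_measurable lborel" by measurable
  have "integrable (density lborel (\<lambda>u. ennreal (?e u))) F \<longleftrightarrow> integrable lborel (\<lambda>u. ?e u *\<^sub>R F u)"
    by (rule integrable_density) (use m2 in auto)
  also have "\<dots> \<longleftrightarrow> set_integrable lborel (dihedral_domain k) f"
  proof -
    have "integrable lborel (\<lambda>u. c *\<^sub>R g u) \<longleftrightarrow> integrable lborel g" if "c \<noteq> 0"
      for c :: real and g :: "complex \<times> complex \<Rightarrow> 'b"
      using integrable_scaleR_right[of "1 / c" lborel "\<lambda>u. c *\<^sub>R g u"] integrable_scaleR_right[of c lborel g] that
      by auto
    from this[of "2 * real k"] show ?thesis unfolding push set_integrable_def using k by (simp del: scaleR_scaleR)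
  qed
  finally have 1: "integrable (density lborel (\<lambda>u. ennreal (?e u))) F \<longleftrightarrow> set_integrable lborel (dihedral_domain k) f" .
  have "integrable (distr (density lborel (\<lambda>z. ennreal (?d z))) borel (phi k)) F
      \<longleftrightarrow> integrable (density lborel (\<lambda>z. ennreal (?d z))) (\<lambda>z. F (phi k z))"
    by (rule integrable_distr_eq) auto
  also have "\<dots> \<longleftrightarrow> integrable lborel (\<lambda>z. ?d z *\<^sub>R F (phi k z))"
    by (rule integrable_density) (use m1 in auto)
  finally show ?int using 1 unfolding pull dist set_integrable_def by simp
  have "(2 * real k) *\<^sub>R (LINT u:dihedral_domain k|lborel. f u) = (LINT u|lborel. ?e u *\<^sub>R F u)"
    unfolding push set_lebesgue_integral_def by (rule integral_scaleR_right[symmetric])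
  also have "\<dots> = integral\<^sup>L (density lborel (\<lambda>u. ennreal (?e u))) F"
    by (rule integral_density[symmetric]) (use m2 in auto)
  also have "\<dots> = integral\<^sup>L (density lborel (\<lambda>z. ennreal (?d z))) (\<lambda>z. F (phi k z))"
    unfolding dist[symmetric] by (rule integral_distr) auto
  also have "\<dots> = (LINT z|lborel. ?d z *\<^sub>R F (phi k z))"
    by (rule integral_density) (use m1 in auto)
  finally show ?eq unfolding pull set_lebesgue_integral_def .
qed

section \<open>Bergman spaces and uniqueness of reproducing kernels\<close>

lemma cnj2_dihedral_domain [simp]: "cnj2 u \<in> dihedral_domain k \<longleftrightarrow> u \<in> dihedral_domain k"
proof -
  have "cnj2 u \<in> dihedral_domain k" if "u \<in> dihedral_domain k" for u
  proof -
    obtain q where q: "q \<in> bidisc" "u = phi k q" using \<open>u \<in> _\<close> unfolding dihedral_domain_def by blast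
    hence "cnj2 u = phi k (cnj2 q)" "cnj2 q \<in> bidisc" by simp_all
    thus ?thesis unfolding dihedral_domain_def by blast
  qed
  from this[of u] this[of "cnj2 u"] show ?thesis by auto
qed

lemma phi_in_dihedral_domain: "z \<in> bidisc \<Longrightarrow> phi k z \<in> dihedral_domain k"
  unfolding dihedral_domain_def by blast

lemma V_eq_density: "V = density lborel (\<lambda>_. ennreal (1 / pi\<^sup>2))"
proof -
  have "emeasure lborel bidisc = ennreal pi * ennreal pi"
    unfolding bidisc_def using emeasure_disc[of 1] by (simp add: emeasure_lborel_Times)
  hence "1 / emeasure lborel bidisc = ennreal (1 / pi\<^sup>2)"
    by (simp add: power2_eq_square divide_ennreal flip: ennreal_mult ennreal_1)
  thus ?thesis unfolding V_def
    by (intro measure_eqI) (auto simp: emeasure_density nn_integral_cmult)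
qed

lemma set_integrable_V:
  fixes f :: "complex \<times> complex \<Rightarrow> 'b::{banach, second_countable_topology}"
  assumes "set_borel_measurable borel A f"
  shows "set_integrable V A f \<longleftrightarrow> set_integrable lborel A f"
proof -
  have m: "(\<lambda>x. indicator A x *\<^sub>R f x) \<in> borel_measurable lborel"
    using assms by (simp add: set_borel_measurable_def)
  have "set_integrable V A f \<longleftrightarrow> integrable lborel (\<lambda>x. (1 / pi\<^sup>2) *\<^sub>R (indicator A x *\<^sub>R f x))"
    unfolding set_integrable_def V_eq_density using m by (intro integrable_density) auto
  also have "\<dots> \<longleftrightarrow> set_integrable lborel A f"
    unfolding set_integrable_def
    using integrable_scaleR_right[of "pi\<^sup>2" lborel "\<lambda>x. (1 / pi\<^sup>2) *\<^sub>R (indicator A x *\<^sub>R f x)"]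
      integrable_scaleR_right[of "1 / pi\<^sup>2" lborel "\<lambda>x. indicator A x *\<^sub>R f x"] by auto
  finally show ?thesis .
qed

lemma set_integral_V:
  fixes f :: "complex \<times> complex \<Rightarrow> 'b::{banach, second_countable_topology}"
  assumes "set_borel_measurable borel A f"
  shows "(LINT x:A|V. f x) = (1 / pi\<^sup>2) *\<^sub>R (LINT x:A|lborel. f x)"
proof -
  have m: "(\<lambda>x. indicator A x *\<^sub>R f x) \<in> borel_measurable lborel"
    using assms by (simp add: set_borel_measurable_def)
  have "(LINT x:A|V. f x) = (LINT x|lborel. (1 / pi\<^sup>2) *\<^sub>R (indicator A x *\<^sub>R f x))"
    unfolding set_lebesgue_integral_def V_eq_density using m by (intro integral_density) auto
  also have "\<dots> = (1 / pi\<^sup>2) *\<^sub>R (LINT x:A|lborel. f x)"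
    unfolding set_lebesgue_integral_def by (rule integral_scaleR_right)
  finally show ?thesis .
qed

lemma square_integrable_imp_integrable:
  fixes f :: "complex \<times> complex \<Rightarrow> complex"
  assumes A: "A \<in> sets borel" "bounded A" and f: "set_borel_measurable borel A f"
    and sq: "set_integrable lborel A (\<lambda>x. (cmod (f x))\<^sup>2)"
  shows "set_integrable lborel A f"
proof (rule set_integrable_bound)
  have "set_integrable lborel A (\<lambda>_. 1 :: real)"
    by (rule set_integrable_bounded[OF A, of _ 1]) (use A in \<open>auto simp: set_borel_measurable_def\<close>)
  thus "set_integrable lborel A (\<lambda>x. 1 + (cmod (f x))\<^sup>2)"
    using sq by (rule set_integral_add)
  show "set_borel_measurable lborel A f" using f by (simp add: set_borel_measurable_def)
  show "AE x in lborel. x \<in> A \<longrightarrow> cmod (f x) \<le> norm (1 + (cmod (f x))\<^sup>2)"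
  proof (rule AE_I2, rule impI)
    fix x
    have "0 \<le> (1 - cmod (f x))\<^sup>2" by simp
    hence "2 * cmod (f x) \<le> 1 + (cmod (f x))\<^sup>2" by (simp add: power2_eq_square algebra_simps)
    hence "cmod (f x) \<le> 1 + (cmod (f x))\<^sup>2" using norm_ge_zero[of "f x"] by linarith
    thus "cmod (f x) \<le> norm (1 + (cmod (f x))\<^sup>2)" by simp
  qed
qed

lemma bergman_space_measurable:
  assumes "f \<in> bergman_space U" "open U"
  shows "set_borel_measurable borel U f"
  using assms holomorphic2_on_imp_continuous_on
  by (intro set_borel_measurable_continuous_on) (auto simp: bergman_space_def)

lemma bergman_space_integrable:
  assumes f: "f \<in> bergman_space U" and U: "open U" "bounded U"
  shows "set_integrable lborel U (\<lambda>x. (cmod (f x))\<^sup>2)" "set_integrable lborel U f"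
proof -
  have c: "continuous_on U f" using f holomorphic2_on_imp_continuous_on by (auto simp: bergman_space_def)
  have "set_borel_measurable borel U (\<lambda>x. (cmod (f x))\<^sup>2)"
    using U by (intro set_borel_measurable_continuous_on continuous_intros c) auto
  thus 1: "set_integrable lborel U (\<lambda>x. (cmod (f x))\<^sup>2)"
    using f by (simp add: bergman_space_def set_integrable_V)
  show "set_integrable lborel U f"
    using 1 bergman_space_measurable[OF f U(1)] U
    by (intro square_integrable_imp_integrable) auto
qed

lemma bergman_inner_cnj: "bergman_inner U g f = cnj (bergman_inner U f g)"
proof -
  have "cnj (bergman_inner U f g) = (LINT p|V. cnj (indicator U p *\<^sub>R (f p * cnj (g p))))"
    unfolding bergman_inner_def set_lebesgue_integral_def by (rule Bochner_Integration.integral_cnj[symmetric])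
  thus ?thesis unfolding bergman_inner_def set_lebesgue_integral_def by (simp add: mult.commute)
qed

text \<open>
  Testing each of two kernels against the other one shows that they are conjugate transposes of
  each other. Applied to one kernel twice, this says that it is Hermitian.
\<close>

lemma bergman_kernel_unique:
  assumes K: "is_bergman_kernel U K" and L: "is_bergman_kernel U L" and z: "z \<in> U" and w: "w \<in> U"
  shows "K z w = L z w"
proof -
  have herm: "K z w = cnj (L w z)" if "is_bergman_kernel U K" "is_bergman_kernel U L" for K L
  proof -
    have mem: "(\<lambda>x. K x w) \<in> bergman_space U" "(\<lambda>x. L x z) \<in> bergman_space U"
      using that z w by (simp_all add: is_bergman_kernel_def)
    have rep: "\<forall>f\<in>bergman_space U. f z = bergman_inner U f (\<lambda>x. L x z)"
      "\<forall>f\<in>bergman_space U. f w = bergman_inner U f (\<lambda>x. K x w)"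
      using that z w by (simp_all add: is_bergman_kernel_def)
    have "K z w = bergman_inner U (\<lambda>x. K x w) (\<lambda>x. L x z)"
      by (rule bspec[OF rep(1) mem(1)])
    also have "\<dots> = cnj (bergman_inner U (\<lambda>x. L x z) (\<lambda>x. K x w))" by (rule bergman_inner_cnj)
    also have "bergman_inner U (\<lambda>x. L x z) (\<lambda>x. K x w) = L w z"
      by (rule bspec[OF rep(2) mem(2), symmetric])
    finally show ?thesis .
  qed
  show ?thesis using herm[OF K L] herm[OF L L] by simp
qed

lemma is_bergman_kernel_cong:
  assumes K: "is_bergman_kernel U K" and eq: "\<And>z w. z \<in> U \<Longrightarrow> w \<in> U \<Longrightarrow> L z w = K z w"
  shows "is_bergman_kernel U L"
  unfolding is_bergman_kernel_def
proof (intro ballI conjI)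
  fix w assume w: "w \<in> U"
  have Kw: "(\<lambda>z. K z w) \<in> bergman_space U" and
    rep: "\<And>f. f \<in> bergman_space U \<Longrightarrow> f w = bergman_inner U f (\<lambda>z. K z w)"
    using K w unfolding is_bergman_kernel_def by auto
  have "holomorphic2_on (\<lambda>z. L z w) U"
    unfolding holomorphic2_on_def
  proof
    fix p assume p: "p \<in> U"
    have "holomorphic2_on (\<lambda>z. K z w) U" using Kw by (simp add: bergman_space_def)
    then obtain a b where "((\<lambda>z. K z w) has_derivative (\<lambda>h. a * fst h + b * snd h)) (at p within U)"
      using p unfolding holomorphic2_on_def by blast
    hence "((\<lambda>z. L z w) has_derivative (\<lambda>h. a * fst h + b * snd h)) (at p within U)"
      by (rule has_derivative_transform[OF p, rotated]) (use eq w in auto)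
    thus "\<exists>a b. ((\<lambda>z. L z w) has_derivative (\<lambda>h. a * fst h + b * snd h)) (at p within U)" by blast
  qed
  moreover have "set_integrable V U (\<lambda>p. (cmod (L p w))\<^sup>2) = set_integrable V U (\<lambda>p. (cmod (K p w))\<^sup>2)"
    unfolding set_integrable_def using eq[OF _ w]
    by (intro Bochner_Integration.integrable_cong refl) (auto simp: indicator_def)
  ultimately show "(\<lambda>z. L z w) \<in> bergman_space U" using Kw by (simp add: bergman_space_def)
  fix f assume "f \<in> bergman_space U"
  hence "f w = bergman_inner U f (\<lambda>z. K z w)" by (rule rep)
  also have "\<dots> = bergman_inner U f (\<lambda>z. L z w)"
    unfolding bergman_inner_def set_lebesgue_integral_def using eq[OF _ w]
    by (intro Bochner_Integration.integral_cong refl) (auto simp: indicator_def)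
  finally show "f w = bergman_inner U f (\<lambda>z. L z w)" .
qed

text \<open>
  A kernel set to zero outside U still reproduces, since membership in the Bergman space and the
  inner product only see values on U.
\<close>

lemma bergman_kernel_eq:
  assumes K: "is_bergman_kernel U K" and z: "z \<in> U" and w: "w \<in> U"
  shows "bergman_kernel U z w = K z w"
proof -
  define K0 where "K0 z w = (if z \<in> U \<and> w \<in> U then K z w else 0)" for z w
  have K0: "is_bergman_kernel U K0 \<and> (\<forall>z w. z \<notin> U \<or> w \<notin> U \<longrightarrow> K0 z w = 0)"
    using is_bergman_kernel_cong[OF K, of K0] by (auto simp: K0_def)
  have "bergman_kernel U = K0"
    unfolding bergman_kernel_def
  proof (rule the_equality)
    show "is_bergman_kernel U K0 \<and> (\<forall>z w. z \<notin> U \<or> w \<notin> U \<longrightarrow> K0 z w = 0)" by (rule K0)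
    fix L assume L: "is_bergman_kernel U L \<and> (\<forall>z w. z \<notin> U \<or> w \<notin> U \<longrightarrow> L z w = 0)"
    show "L = K0"
    proof (intro ext)
      fix z w show "L z w = K0 z w"
        using L K0 bergman_kernel_unique[of U L K0 z w] by (cases "z \<in> U \<and> w \<in> U") (auto simp del: split_paired_All)
    qed
  qed
  thus ?thesis using z w by (simp add: K0_def)
qed

section \<open>The reproducing property on the quotient domain\<close>

definition dihedral_kernel :: "nat \<Rightarrow> complex \<times> complex \<Rightarrow> complex \<times> complex \<Rightarrow> complex" where
  "dihedral_kernel k u v = kernel_rational k u (cnj2 v)"

lemma holomorphic2_on_dihedral_kernel:
  assumes "0 < k" "v \<in> dihedral_domain k"
  shows "holomorphic2_on (\<lambda>u. dihedral_kernel k u v) (dihedral_domain k)"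
  unfolding dihedral_kernel_def using assms by (intro holomorphic2_on_kernel_ratio) auto

lemma cnj_dihedral_kernel: "cnj (dihedral_kernel k u v) = dihedral_kernel k v u"
  unfolding dihedral_kernel_def cnj_kernel_ratio by (simp add: kernel_rational_symmetric)

lemma dihedral_kernel_bounded:
  fixes r :: real
  assumes k: "0 < k" and r: "r < 1"
  obtains C where "\<And>u w. u \<in> dihedral_domain k \<Longrightarrow> norm (fst w) \<le> r \<Longrightarrow> norm (snd w) \<le> r
     \<Longrightarrow> norm (dihedral_kernel k u (phi k w)) \<le> C"
proof -
  obtain C where C: "\<And>u (w :: complex \<times> complex). u \<in> dihedral_domain k \<Longrightarrow> w \<in> cball 0 r \<times> cball 0 r
     \<Longrightarrow> norm (kernel_rational k u (phi k w)) \<le> C"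
    using kernel_rational_bounded[OF k r] by blast
  show ?thesis
  proof (rule that)
    fix u and w :: "complex \<times> complex" assume u: "u \<in> dihedral_domain k" and w: "norm (fst w) \<le> r" "norm (snd w) \<le> r"
    have "cnj2 w \<in> cball 0 r \<times> cball 0 r" using w by (cases w) simp
    from C[OF u this] show "norm (dihedral_kernel k u (phi k w)) \<le> C"
      by (simp add: dihedral_kernel_def)
  qed
qed

lemma dihedral_kernel_in_bergman_space:
  assumes k: "0 < k" and v: "v \<in> dihedral_domain k"
  shows "(\<lambda>u. dihedral_kernel k u v) \<in> bergman_space (dihedral_domain k)"
proof -
  have U: "open (dihedral_domain k)" "bounded (dihedral_domain k)"
    using open_dihedral_domain[OF k] bounded_dihedral_domain by auto
  obtain w1 w2 where w: "norm w1 < 1" "norm w2 < 1" "v = phi k (w1, w2)"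
    using v by (auto simp: dihedral_domain_def bidisc_def)
  obtain C where C: "\<And>u w. u \<in> dihedral_domain k \<Longrightarrow> norm (fst w) \<le> max (norm w1) (norm w2)
     \<Longrightarrow> norm (snd w) \<le> max (norm w1) (norm w2) \<Longrightarrow> norm (dihedral_kernel k u (phi k w)) \<le> C"
    using dihedral_kernel_bounded[OF k, of "max (norm w1) (norm w2)"] w by auto
  have hol: "holomorphic2_on (\<lambda>u. dihedral_kernel k u v) (dihedral_domain k)"
    by (rule holomorphic2_on_dihedral_kernel[OF k v])
  have m: "set_borel_measurable borel (dihedral_domain k) (\<lambda>u. (cmod (dihedral_kernel k u v))\<^sup>2)"
    using U by (intro set_borel_measurable_continuous_on continuous_intros holomorphic2_on_imp_continuous_on hol) auto
  have "set_integrable lborel (dihedral_domain k) (\<lambda>u. (cmod (dihedral_kernel k u v))\<^sup>2)"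
  proof (rule set_integrable_bounded[OF _ U(2) m])
    show "norm ((cmod (dihedral_kernel k u v))\<^sup>2) \<le> C\<^sup>2" if "u \<in> dihedral_domain k" for u
      using C[OF that, of "(w1, w2)"] w by (simp add: power_mono)
  qed (use U in auto)
  thus ?thesis using hol m by (simp add: bergman_space_def set_integrable_V)
qed

text \<open>
  Up to the factor 2k, this is an isometry into the Bergman space of the bidisc.
\<close>

definition pullback :: "nat \<Rightarrow> (complex \<times> complex \<Rightarrow> complex) \<Rightarrow> complex \<times> complex \<Rightarrow> complex" where
  "pullback k f z = f (phi k z) * phi_jacobian k z"

lemma holomorphic2_on_compose_phi:
  assumes k: "0 < k" and f: "holomorphic2_on f (dihedral_domain k)"
  shows "holomorphic2_on (\<lambda>z. f (phi k z)) bidisc"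
proof -
  have "holomorphic2_on (\<lambda>z. f (fst z ^ k + snd z ^ k, fst z * snd z)) bidisc"
    by (rule holomorphic2_on_compose[OF f open_dihedral_domain[OF k] _ _ open_bidisc])
       (intro holomorphic2_intros | use phi_in_dihedral_domain[of _ k] in \<open>simp add: phi_def case_prod_beta\<close>)+
  thus ?thesis by (simp add: phi_def case_prod_beta)
qed

lemma pullback_holomorphic:
  assumes k: "0 < k" and f: "holomorphic2_on f (dihedral_domain k)"
  shows "holomorphic2_on (pullback k f) bidisc"
  unfolding pullback_def[abs_def] phi_jacobian_def case_prod_beta
  by (intro holomorphic2_intros holomorphic2_on_compose_phi[OF k f])

lemma bounded_bidisc: "bounded bidisc"
  unfolding bidisc_def by (intro bounded_Times) auto

text \<open>
  The change of variables gives square integrability, and the bidisc has finite measure.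
\<close>

lemma pullback_integrable:
  assumes k: "0 < k" and f: "f \<in> bergman_space (dihedral_domain k)"
  shows "set_integrable lborel bidisc (pullback k f)"
proof (rule square_integrable_imp_integrable)
  have U: "open (dihedral_domain k)" "bounded (dihedral_domain k)"
    using open_dihedral_domain[OF k] bounded_dihedral_domain by auto
  have hol: "holomorphic2_on f (dihedral_domain k)" using f by (simp add: bergman_space_def)
  have "set_borel_measurable borel (dihedral_domain k) (\<lambda>x. (cmod (f x))\<^sup>2)"
    using U by (intro set_borel_measurable_continuous_on continuous_intros holomorphic2_on_imp_continuous_on hol) auto
  from dihedral_integral(1)[OF k this] bergman_space_integrable(1)[OF f U]
  show "set_integrable lborel bidisc (\<lambda>z. (cmod (pullback k f z))\<^sup>2)"
    by (simp add: pullback_def norm_mult power_mult_distrib mult.commute)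
  show "set_borel_measurable borel bidisc (pullback k f)"
    by (intro set_borel_measurable_continuous_on holomorphic2_on_imp_continuous_on pullback_holomorphic k hol) auto
qed (use bounded_bidisc in auto)

text \<open>
  The function f o phi is invariant under the dihedral group, and the Jacobian changes sign
  under reflections.
\<close>

lemma pullback_rotate:
  assumes "\<zeta> ^ k = 1" "\<eta> ^ k = 1" "\<zeta> * \<eta> = 1"
  shows "pullback k f (\<zeta> * w1, \<eta> * w2) = pullback k f (w1, w2)"
    and "pullback k f (\<eta> * w2, \<zeta> * w1) = - pullback k f (w1, w2)"
proof -
  have "\<zeta> * w1 * (\<eta> * w2) = (\<zeta> * \<eta>) * (w1 * w2)" by (simp add: mult_ac)
  hence pr: "\<zeta> * w1 * (\<eta> * w2) = w1 * w2" "\<eta> * w2 * (\<zeta> * w1) = w1 * w2"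
    using assms(3) by (simp_all add: mult.commute)
  have "phi k (\<zeta> * w1, \<eta> * w2) = phi k (w1, w2)" "phi k (\<eta> * w2, \<zeta> * w1) = phi k (w1, w2)"
    unfolding phi_def using pr assms(1,2) by (simp_all add: power_mult_distrib add.commute)
  moreover have "phi_jacobian k (\<zeta> * w1, \<eta> * w2) = phi_jacobian k (w1, w2)"
    "phi_jacobian k (\<eta> * w2, \<zeta> * w1) = - phi_jacobian k (w1, w2)"
    using assms(1,2) by (simp_all add: phi_jacobian_def power_mult_distrib algebra_simps)
  ultimately show "pullback k f (\<zeta> * w1, \<eta> * w2) = pullback k f (w1, w2)"
    and "pullback k f (\<eta> * w2, \<zeta> * w1) = - pullback k f (w1, w2)"
    by (simp_all add: pullback_def)
qed

text \<open>
  Each of the 2k terms of the antisymmetrised kernel evaluates the pullback at a point of the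
  orbit of (w1, w2). By antisymmetry of the pullback, all of them contribute the same value.
\<close>

lemma antisym_kernel_reproducing:
  assumes k: "0 < k" and \<omega>: "primitive_root_of_unity k \<omega>" and f: "f \<in> bergman_space (dihedral_domain k)"
    and w: "norm w1 < 1" "norm w2 < 1"
  shows "(LINT z:bidisc|lborel. pullback k f z * cnj (antisym_kernel k \<omega> z (cnj w1, cnj w2)))
    = of_real (2 * real k * pi\<^sup>2) * pullback k f (w1, w2)"
proof -
  let ?g = "pullback k f"
  have hol: "holomorphic2_on ?g bidisc" using f by (intro pullback_holomorphic k) (simp add: bergman_space_def)
  have int: "set_integrable lborel bidisc ?g" by (rule pullback_integrable[OF k f])
  define B where "B a b z = ?g z / ((1 - a * cnj (fst z))\<^sup>2 * (1 - b * cnj (snd z))\<^sup>2)" for a b z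
  define \<zeta> \<eta> where "\<zeta> i = cnj \<omega> ^ i" and "\<eta> i = cnj \<omega> ^ (k - i)" for i
  have n\<omega>: "norm \<omega> = 1" by (rule norm_root_of_unity[OF \<omega> k])
  have nz: "norm (\<zeta> i * w1) < 1" "norm (\<eta> i * w2) < 1" for i
    using w n\<omega> by (simp_all add: \<zeta>_def \<eta>_def norm_mult norm_power)
  have \<omega>k: "cnj \<omega> ^ k = 1" using \<omega> by (simp add: primitive_root_of_unity_def flip: complex_cnj_power)
  have pw: "\<zeta> i ^ k = 1" "\<eta> i ^ k = 1" for i
    using \<omega>k unfolding \<zeta>_def \<eta>_def by (metis power_mult mult.commute power_one)+
  have pr: "\<zeta> i * \<eta> i = 1" if "i \<in> {1..k}" for i
    using that \<omega>k unfolding \<zeta>_def \<eta>_def by (simp flip: power_add)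
  have rep: "set_integrable lborel bidisc (B a b)" "(LINT z:bidisc|lborel. B a b z) = of_real (pi\<^sup>2) * ?g (a, b)"
    if "norm a < 1" "norm b < 1" for a b
    using bidisc_reproducing[OF hol int that] unfolding B_def[abs_def] by auto
  have expand: "?g z * cnj (antisym_kernel k \<omega> z (cnj w1, cnj w2))
     = (\<Sum>i=1..k. B (\<zeta> i * w1) (\<eta> i * w2) z - B (\<eta> i * w2) (\<zeta> i * w1) z)" for z
    unfolding antisym_kernel_def B_def \<zeta>_def \<eta>_def case_prod_beta
    by (simp add: sum_distrib_left right_diff_distrib mult_ac)
  have "(LINT z:bidisc|lborel. ?g z * cnj (antisym_kernel k \<omega> z (cnj w1, cnj w2)))
     = (\<Sum>i=1..k. (LINT z:bidisc|lborel. B (\<zeta> i * w1) (\<eta> i * w2) z) - (LINT z:bidisc|lborel. B (\<eta> i * w2) (\<zeta> i * w1) z))"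
  proof -
    have i: "set_integrable lborel bidisc (\<lambda>z. B (\<zeta> i * w1) (\<eta> i * w2) z - B (\<eta> i * w2) (\<zeta> i * w1) z)"
     "(LINT z:bidisc|lborel. B (\<zeta> i * w1) (\<eta> i * w2) z - B (\<eta> i * w2) (\<zeta> i * w1) z)
      = (LINT z:bidisc|lborel. B (\<zeta> i * w1) (\<eta> i * w2) z) - (LINT z:bidisc|lborel. B (\<eta> i * w2) (\<zeta> i * w1) z)" for i
      by (rule set_integral_diff[OF rep(1)[OF nz(1) nz(2)] rep(1)[OF nz(2) nz(1)]])+
    show ?thesis
      unfolding expand i(2)[symmetric] unfolding set_lebesgue_integral_def scaleR_sum_right
      by (rule Bochner_Integration.integral_sum) (use i(1) in \<open>simp add: set_integrable_def\<close>)
  qed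
  also have "\<dots> = (\<Sum>i=1..k. of_real (pi\<^sup>2) * (2 * ?g (w1, w2)))"
  proof (rule sum.cong[OF refl])
    fix i assume i: "i \<in> {1..k}"
    show "(LINT z:bidisc|lborel. B (\<zeta> i * w1) (\<eta> i * w2) z) - (LINT z:bidisc|lborel. B (\<eta> i * w2) (\<zeta> i * w1) z)
        = of_real (pi\<^sup>2) * (2 * ?g (w1, w2))"
      unfolding rep(2)[OF nz(1) nz(2)] rep(2)[OF nz(2) nz(1)] pullback_rotate[OF pw(1) pw(2) pr[OF i]]
      by simp
  qed
  also have "\<dots> = of_real (2 * real k * pi\<^sup>2) * ?g (w1, w2)" by simp
  finally show ?thesis .
qed

lemma bergman_inner_pullback:
  assumes k: "0 < k" and f: "f \<in> bergman_space (dihedral_domain k)" and h: "h \<in> bergman_space (dihedral_domain k)"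
  shows "bergman_inner (dihedral_domain k) f h
     = (1 / of_real (2 * real k * pi\<^sup>2)) * (LINT z:bidisc|lborel. pullback k f z * cnj (pullback k h z))"
proof -
  have U: "open (dihedral_domain k)" using open_dihedral_domain[OF k] .
  have "continuous_on (dihedral_domain k) f" "continuous_on (dihedral_domain k) h"
    using f h holomorphic2_on_imp_continuous_on by (auto simp: bergman_space_def)
  hence m: "set_borel_measurable borel (dihedral_domain k) (\<lambda>u. f u * cnj (h u))"
    using U by (intro set_borel_measurable_continuous_on continuous_intros) auto
  have "(2 * real k) *\<^sub>R (LINT u:dihedral_domain k|lborel. f u * cnj (h u))
     = (LINT z:bidisc|lborel. (cmod (phi_jacobian k z))\<^sup>2 *\<^sub>R (f (phi k z) * cnj (h (phi k z))))"
    by (rule dihedral_integral(2)[OF k m])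
  also have "\<dots> = (LINT z:bidisc|lborel. pullback k f z * cnj (pullback k h z))"
    unfolding pullback_def by (simp add: scaleR_conv_of_real complex_norm_square[unfolded of_real_power] mult_ac)
  finally have e: "(2 * real k) *\<^sub>R (LINT u:dihedral_domain k|lborel. f u * cnj (h u))
      = (LINT z:bidisc|lborel. pullback k f z * cnj (pullback k h z))" .
  show ?thesis
    unfolding bergman_inner_def set_integral_V[OF m] e[symmetric] using k
    by (simp add: scaleR_conv_of_real)
qed

text \<open>
  The pullback of K(., v) is the antisymmetrised kernel divided by the conjugate of the Jacobian
  at w.
\<close>

lemma dihedral_kernel_reproducing_regular:
  assumes k: "0 < k" and \<omega>: "primitive_root_of_unity k \<omega>" and f: "f \<in> bergman_space (dihedral_domain k)"
    and w: "(w1, w2) \<in> regular_points k"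
  shows "f (phi k (w1, w2)) = bergman_inner (dihedral_domain k) f (\<lambda>u. dihedral_kernel k u (phi k (w1, w2)))"
proof -
  let ?v = "phi k (w1, w2)"
  have n: "norm w1 < 1" "norm w2 < 1" and ne: "w1 ^ k \<noteq> w2 ^ k"
    using w by (auto simp: regular_points_def bidisc_def)
  have v: "?v \<in> dihedral_domain k" using n by (intro phi_in_dihedral_domain) (simp add: bidisc_def)
  let ?h = "\<lambda>u. dihedral_kernel k u ?v"
  have h: "?h \<in> bergman_space (dihedral_domain k)" by (rule dihedral_kernel_in_bergman_space[OF k v])
  define J where "J = phi_jacobian k (w1, w2)"
  have J: "J \<noteq> 0" using ne k by (simp add: J_def phi_jacobian_def)
  have pb: "pullback k ?h z * cnj J = antisym_kernel k \<omega> z (cnj w1, cnj w2)" if "z \<in> bidisc" for z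
  proof -
    obtain z1 z2 where z: "z = (z1, z2)" "norm z1 < 1" "norm z2 < 1"
      using \<open>z \<in> bidisc\<close> by (cases z) (auto simp: bidisc_def)
    have "antisym_kernel k \<omega> (z1, z2) (cnj w1, cnj w2) =
        of_nat k ^ 2 * (z1 ^ k - z2 ^ k) * (cnj w1 ^ k - cnj w2 ^ k) * kernel_rational k (phi k (z1, z2)) (phi k (cnj w1, cnj w2))"
      using antisym_kernel_eq[OF \<omega> k z(2,3), of "cnj w1" "cnj w2"] n by simp
    moreover have "cnj2 ?v = phi k (cnj w1, cnj w2)" using cnj2_simps(4)[of k "(w1, w2)"] by simp
    ultimately show ?thesis
      unfolding z(1) pullback_def dihedral_kernel_def J_def phi_jacobian_def
      by (simp add: power2_eq_square mult_ac)
  qed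
  have "(LINT z:bidisc|lborel. pullback k f z * cnj (pullback k ?h z)) * J
      = (LINT z:bidisc|lborel. pullback k f z * cnj (pullback k ?h z) * J)"
    by simp
  also have "\<dots> = (LINT z:bidisc|lborel. pullback k f z * cnj (antisym_kernel k \<omega> z (cnj w1, cnj w2)))"
    by (rule set_lebesgue_integral_cong) (use pb in \<open>auto simp: mult.assoc simp flip: pb\<close>)
  also have "\<dots> = of_real (2 * real k * pi\<^sup>2) * (f ?v * J)"
    unfolding antisym_kernel_reproducing[OF k \<omega> f n] by (simp add: pullback_def J_def)
  finally have "(LINT z:bidisc|lborel. pullback k f z * cnj (pullback k ?h z)) = of_real (2 * real k * pi\<^sup>2) * f ?v"
    using J by simp
  thus ?thesis unfolding bergman_inner_pullback[OF k f h] using k by simp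
qed

text \<open>
  If w1^k = w2^k is nonzero, shrinking w1 makes the powers differ in modulus; if both
  coordinates vanish, moving the first one is enough. The radius r keeps the sequence in a
  compact subset of the bidisc, where the kernel is uniformly bounded.
\<close>

lemma regular_points_sequence:
  assumes k: "0 < k" and w: "norm w1 < 1" "norm w2 < 1"
  obtains W r where "\<And>n::nat. W n \<in> regular_points k" "W \<longlonglongrightarrow> (w1, w2)" "r < 1"
    "\<And>n. norm (fst (W n)) \<le> r" "\<And>n. norm (snd (W n)) \<le> r"
proof -
  define t where "t n = real (Suc n) / real (Suc (Suc n))" for n
  have t: "0 < t n" "t n < 1" for n by (auto simp: t_def)
  have lim: "t \<longlonglongrightarrow> 1"
    unfolding t_def using LIMSEQ_Suc[OF LIMSEQ_n_over_Suc_n[where 'a = real]] .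
  consider "w1 ^ k \<noteq> w2 ^ k" | "w1 ^ k = w2 ^ k" "w1 \<noteq> 0" | "w1 ^ k = w2 ^ k" "w1 = 0" by blast
  thus ?thesis
  proof cases
    case 1
    show ?thesis
      by (rule that[of "\<lambda>_. (w1, w2)" "max (norm w1) (norm w2)"])
         (use 1 w in \<open>auto simp: regular_points_def bidisc_def\<close>)
  next
    case 2
    let ?W = "\<lambda>n. (of_real (t n) * w1, w2)"
    have small: "norm (of_real (t n) * w1) \<le> norm w1" for n
      using t[of n] by (simp add: norm_mult mult_left_le_one_le)
    show ?thesis
    proof (rule that[of ?W "max (norm w1) (norm w2)"])
      show "?W n \<in> regular_points k" for n
      proof -
        have "(of_real (t n) :: complex) ^ k \<noteq> 1"
        proof
          assume "(of_real (t n) :: complex) ^ k = 1"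
          hence "norm ((of_real (t n) :: complex) ^ k) = 1" by simp
          thus False using norm_power_lt_1[of "of_real (t n)" k] t[of n] k by simp
        qed
        hence "(of_real (t n) * w1) ^ k \<noteq> w2 ^ k" using 2 by (simp add: power_mult_distrib flip: 2(1))
        thus ?thesis using le_less_trans[OF small w(1)] w(2) by (simp add: regular_points_def bidisc_def)
      qed
      have "(\<lambda>n. of_real (t n) * w1) \<longlonglongrightarrow> of_real 1 * w1"
        by (intro tendsto_intros lim)
      thus "?W \<longlonglongrightarrow> (w1, w2)" by (intro tendsto_Pair tendsto_const) simp
      show "norm (fst (?W n)) \<le> max (norm w1) (norm w2)" for n using small[of n] by simp
    qed (use w in auto)
  next
    case 3
    hence z: "w2 = 0" using k by (metis power_eq_0_iff zero_power)
    define e where "e n = complex_of_real ((1 - t n) / 2)" for n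
    have e: "norm (e n) \<le> 1 / 2" "e n \<noteq> 0" for n
    proof -
      have "norm (e n) = \<bar>(1 - t n) / 2\<bar>" unfolding e_def by (rule norm_of_real)
      thus "norm (e n) \<le> 1 / 2" using t[of n] by simp
      have "(1 - t n) / 2 \<noteq> 0" using t[of n] by simp
      thus "e n \<noteq> 0" unfolding e_def of_real_eq_0_iff .
    qed
    show ?thesis
    proof (rule that[of "\<lambda>n. (e n, 0)" "1 / 2"])
      show "(e n, 0) \<in> regular_points k" for n
        using e[of n] k by (simp add: regular_points_def bidisc_def zero_power)
      have "e \<longlonglongrightarrow> complex_of_real ((1 - 1) / 2)"
        unfolding e_def by (intro tendsto_of_real tendsto_divide tendsto_diff tendsto_const lim) simp
      thus "(\<lambda>n. (e n, 0)) \<longlonglongrightarrow> (w1, w2)" unfolding 3 z by (intro tendsto_Pair tendsto_const) simp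
    qed (use e in auto)
  qed
qed

text \<open>
  At values of regular points the identity is known. Both sides depend continuously on v: the
  left side because f is holomorphic, the right side by dominated convergence, because K(u, v)
  is bounded for u in the domain and v near a given point.
\<close>

theorem dihedral_kernel_is_bergman_kernel:
  assumes k: "0 < k" and \<omega>: "primitive_root_of_unity k \<omega>"
  shows "is_bergman_kernel (dihedral_domain k) (dihedral_kernel k)"
  unfolding is_bergman_kernel_def
proof (intro ballI conjI)
  let ?U = "dihedral_domain k"
  have U: "open ?U" "bounded ?U"
    using open_dihedral_domain[OF k] bounded_dihedral_domain by auto
  fix v assume v: "v \<in> ?U"
  show "(\<lambda>u. dihedral_kernel k u v) \<in> bergman_space ?U"
    by (rule dihedral_kernel_in_bergman_space[OF k v])
  fix f assume f: "f \<in> bergman_space ?U"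
  have cf: "continuous_on ?U f" using f holomorphic2_on_imp_continuous_on by (auto simp: bergman_space_def)
  obtain w1 w2 where w: "norm w1 < 1" "norm w2 < 1" "v = phi k (w1, w2)"
    using v by (auto simp: dihedral_domain_def bidisc_def)
  obtain W r where W: "\<And>n::nat. W n \<in> regular_points k" "W \<longlonglongrightarrow> (w1, w2)" "r < 1"
    "\<And>n. norm (fst (W n)) \<le> r" "\<And>n. norm (snd (W n)) \<le> r"
    using regular_points_sequence[OF k w(1,2)] by blast
  let ?v = "\<lambda>n. phi k (W n)"
  have vU: "?v n \<in> ?U" for n using W(1)[of n] by (intro phi_in_dihedral_domain) (auto simp: regular_points_def)
  have vlim: "?v \<longlonglongrightarrow> v"
    unfolding w(3) using W(2) continuous_on_phi[of UNIV k]
    by (auto simp: continuous_on_eq_continuous_at intro: isCont_tendsto_compose)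
  have lim_comp: "(\<lambda>n. g (?v n)) \<longlonglongrightarrow> g v" if "continuous_on ?U g" for g :: "complex \<times> complex \<Rightarrow> complex"
    using that U(1) v vlim by (auto simp: continuous_on_eq_continuous_at intro: isCont_tendsto_compose)
  obtain C where C: "\<And>u w. u \<in> ?U \<Longrightarrow> norm (fst w) \<le> r \<Longrightarrow> norm (snd w) \<le> r
     \<Longrightarrow> norm (dihedral_kernel k u (phi k w)) \<le> C"
    using dihedral_kernel_bounded[OF k W(3)] by blast
  have meas: "set_borel_measurable borel ?U (\<lambda>u. f u * cnj (dihedral_kernel k u x))" if "x \<in> ?U" for x
    using U(1) holomorphic2_on_imp_continuous_on[OF holomorphic2_on_dihedral_kernel[OF k that]]
    by (intro set_borel_measurable_continuous_on continuous_intros cf) auto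
  let ?F = "\<lambda>x u. indicator ?U u *\<^sub>R (f u * cnj (dihedral_kernel k u x))"
  have inner: "bergman_inner ?U f (\<lambda>u. dihedral_kernel k u x) = (1 / pi\<^sup>2) *\<^sub>R integral\<^sup>L lborel (?F x)" if "x \<in> ?U" for x
    unfolding bergman_inner_def set_integral_V[OF meas[OF that]] unfolding set_lebesgue_integral_def ..
  have "(\<lambda>n. integral\<^sup>L lborel (?F (?v n))) \<longlonglongrightarrow> integral\<^sup>L lborel (?F v)"
  proof (rule integral_dominated_convergence[where w = "\<lambda>u. C * norm (indicator ?U u *\<^sub>R f u)"])
    show "?F v \<in> borel_measurable lborel" "?F (?v n) \<in> borel_measurable lborel" for n
      using meas[OF v] meas[OF vU] by (simp_all add: set_borel_measurable_def)
    show "integrable lborel (\<lambda>u. C * norm (indicator ?U u *\<^sub>R f u))"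
      using bergman_space_integrable(2)[OF f U] unfolding set_integrable_def
      by (intro integrable_mult_right integrable_norm)
    show "AE u in lborel. (\<lambda>n. ?F (?v n) u) \<longlonglongrightarrow> ?F v u"
    proof (rule AE_I2)
      fix u show "(\<lambda>n. ?F (?v n) u) \<longlonglongrightarrow> ?F v u"
      proof (cases "u \<in> ?U")
        case True
        have "(\<lambda>n. dihedral_kernel k (?v n) u) \<longlonglongrightarrow> dihedral_kernel k v u"
          using holomorphic2_on_imp_continuous_on[OF holomorphic2_on_dihedral_kernel[OF k True]] by (rule lim_comp)
        thus ?thesis unfolding cnj_dihedral_kernel by (intro tendsto_intros)
      qed simp
    qed
    show "AE u in lborel. norm (?F (?v n) u) \<le> C * norm (indicator ?U u *\<^sub>R f u)" for n
    proof (rule AE_I2)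
      fix u show "norm (?F (?v n) u) \<le> C * norm (indicator ?U u *\<^sub>R f u)"
      proof (cases "u \<in> ?U")
        case True
        from mult_right_mono[OF C[OF True W(4,5)[of n]] norm_ge_zero[of "f u"]] True
        show ?thesis by (simp add: norm_mult mult.commute)
      qed simp
    qed
  qed
  hence "(\<lambda>n. (1 / pi\<^sup>2) *\<^sub>R integral\<^sup>L lborel (?F (?v n))) \<longlonglongrightarrow> (1 / pi\<^sup>2) *\<^sub>R integral\<^sup>L lborel (?F v)"
    by (intro tendsto_intros)
  hence "(\<lambda>n. bergman_inner ?U f (\<lambda>u. dihedral_kernel k u (?v n))) \<longlonglongrightarrow> bergman_inner ?U f (\<lambda>u. dihedral_kernel k u v)"
    unfolding inner[OF v] inner[OF vU] .
  moreover have "bergman_inner ?U f (\<lambda>u. dihedral_kernel k u (?v n)) = f (?v n)" for n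
    using dihedral_kernel_reproducing_regular[OF k \<omega> f, of "fst (W n)" "snd (W n)"] W(1)[of n] by simp
  ultimately have "(\<lambda>n. f (?v n)) \<longlonglongrightarrow> bergman_inner ?U f (\<lambda>u. dihedral_kernel k u v)"
    by simp
  with lim_comp[OF cf] show "f v = bergman_inner ?U f (\<lambda>u. dihedral_kernel k u v)"
    by (rule LIMSEQ_unique)
qed

theorem proposition5p4:
  fixes k :: nat and \<omega> :: complex
  assumes "k > 0"
    and "primitive_root_of_unity k \<omega>"
  shows "\<exists>R. sesquiholomorphic_extension (regular_points k) bidisc (kernel_formula k \<omega>) R \<and>
           (\<forall>z\<in>bidisc. \<forall>w\<in>bidisc.
              bergman_kernel (dihedral_domain k) (phi k z) (phi k w) = R z w)"
proof (intro exI conjI ballI)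
  let ?R = "\<lambda>z w. dihedral_kernel k (phi k z) (phi k w)"
  have hol: "holomorphic2_on (\<lambda>z. ?R z w) bidisc" if "w \<in> bidisc" for w
    using assms(1) that
    by (intro holomorphic2_on_compose_phi holomorphic2_on_dihedral_kernel phi_in_dihedral_domain)
  show "sesquiholomorphic_extension (regular_points k) bidisc (kernel_formula k \<omega>) ?R"
    unfolding sesquiholomorphic_extension_def
  proof (intro conjI ballI)
    show "holomorphic2_on (\<lambda>z. ?R z w) bidisc" if "w \<in> bidisc" for w by (rule hol[OF that])
    show "holomorphic2_on (\<lambda>w. cnj (?R z w)) bidisc" if "z \<in> bidisc" for z
      unfolding cnj_dihedral_kernel by (rule hol[OF that])
    fix z w assume z: "z \<in> regular_points k" and w: "w \<in> regular_points k"
    have "cnj2 (phi k w) = phi k (cnj (fst w), cnj (snd w))"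
      using cnj2_simps(4)[of k w] by (cases w) simp
    thus "?R z w = kernel_formula k \<omega> z w"
      using kernel_formula_eq[OF assms(2,1), of "fst z" "snd z" "fst w" "snd w"] z w
      by (simp add: dihedral_kernel_def)
  qed
  show "bergman_kernel (dihedral_domain k) (phi k z) (phi k w) = ?R z w"
    if "z \<in> bidisc" "w \<in> bidisc" for z w
    using that assms
    by (intro bergman_kernel_eq dihedral_kernel_is_bergman_kernel phi_in_dihedral_domain)
qed

end
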